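(* Let $k$ be an algebraically closed field of characteristic zero, $n>1$ and $\mathbf{x}=(x_1,\dots,x_n)$. Let $R=\bigcup_{\Gamma\in\Lambda}k[[\Gamma,1]]$ and let $Q(R)$ be its quotient field. Then $k((\mathbf{x}))^{*}$ is the algebraic closure of $Q(R)$.
   Context: For $1\le i<j\le n$, the order-preserving monomial blowing-up $\varphi_{ij}$ is the linear automorphism of $\mathbb{R}^n$ which replaces the $j$-th coordinate $a_j$ of $(a_1,\dots,a_n)$ by $a_i+a_j$ and leaves the other coordinates unchanged; its inverse is an order-preserving monomial blowing-down. $\mathcal{S}$ is the set of finite compositions of order-preserving monomial blowing-downs of $\mathbb{R}^n$ and $\Lambda=\{\Phi(\mathbb{R}_{\ge0}^n):\Phi\in\mathcal{S}\}$. $K_{n,d}=k((x_n^{1/d}))\cdots((x_1^{1/d}))$ is the field of iterated formal Laurent series ($K_{1,d}=k((x_1^{1/d}))$, and $K_{n,d}=L((x_1^{1/d}))$ with $L=k((x_n^{1/d}))\cdots((x_2^{1/d}))$), whose elements are regarded as formal sums $f=\sum_{\mathbf{a}\in\mathbb{Z}^n}f_{\mathbf{a}}\mathbf{x}^{\mathbf{a}/d}$, $f_{\mathbf{a}}\in k$, with Newton diagram $\mathcal{E}(f)=\{\mathbf{a}/d: f_{\mathbf{a}}\neq0\}$; when $d\mid d'$, $K_{n,d}\subset K_{n,d'}$ in the obvious way. For $\Gamma\in\Lambda$ and $d\in\mathbb{Z}_{>0}$, $k[[\Gamma,d]]$ is the subring of $K_{n,d}$ consisting of the series $f$ with $\mathcal{E}(f)\subset\Gamma$.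 These rings form a direct system under inclusion; $k((\mathbf{x}))^{*}=\bigcup_{(\Gamma,d)\in\Lambda\times\mathbb{Z}_{>0}}Q(k[[\Gamma,d]])$, where $Q(-)$ denotes quotient field. *)

theory Defs
  imports Complex_Main "HOL-Computational_Algebra.Polynomial" "HOL-Algebra.Algebraic_Closure"
begin

text \<open>
  A point \<open>(a\<^sub>1, \<dots>, a\<^sub>n)\<close> of \<open>\<real>\<^sup>n\<close> is a function \<open>a :: nat \<Rightarrow> real\<close> that vanishes from \<open>n\<close> on;
  \<open>a\<^sub>i\<close> is \<open>a (i - 1)\<close>, so the coordinate belonging to \<open>x\<^sub>1\<close> is \<open>a 0\<close>.
\<close>

definition nonneg_orthant :: "nat \<Rightarrow> (nat \<Rightarrow> real) set" where
  "nonneg_orthant n = {a. (\<forall>i<n. 0 \<le> a i) \<and> (\<forall>i\<ge>n. a i = 0)}"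

definition blow_up :: "nat \<Rightarrow> nat \<Rightarrow> (nat \<Rightarrow> real) \<Rightarrow> (nat \<Rightarrow> real)" where
  "blow_up i j a = a(j := a i + a j)"

definition blow_down :: "nat \<Rightarrow> nat \<Rightarrow> (nat \<Rightarrow> real) \<Rightarrow> (nat \<Rightarrow> real)" where
  "blow_down i j = inv_into UNIV (blow_up i j)"

text \<open>The empty composition is included, so the orthant itself is one of the cones.\<close>

inductive_set blow_down_compositions :: "nat \<Rightarrow> ((nat \<Rightarrow> real) \<Rightarrow> (nat \<Rightarrow> real)) set" for n where
  empty: "id \<in> blow_down_compositions n"
| step: "\<Phi> \<in> blow_down_compositions n \<Longrightarrow> i < j \<Longrightarrow> j < n \<Longrightarrow>
    blow_down i j \<circ> \<Phi> \<in> blow_down_compositions n"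

definition cones :: "nat \<Rightarrow> (nat \<Rightarrow> real) set set" where
  "cones n = {\<Phi> ` nonneg_orthant n | \<Phi>. \<Phi> \<in> blow_down_compositions n}"

text \<open>
  A formal sum is its coefficient function on exponent vectors; the exponents are the actual
  ones, \<open>a/d\<close> in \<open>(1/d)\<int>\<^sup>n\<close>, so that \<open>K\<^sub>n\<^sub>,\<^sub>d \<subseteq> K\<^sub>n\<^sub>,\<^sub>d\<^sub>'\<close> for \<open>d dvd d'\<close> is set inclusion.
  The vector \<open>case_nat c b\<close> has first coordinate \<open>c\<close> followed by \<open>b\<close>.  Hence
  \<open>\<lambda>b. f (case_nat c b)\<close> is the coefficient of \<open>x\<^sub>1\<^sup>c\<close> in \<open>f\<close>, and the second equation
  describes the Laurent series in \<open>x\<^sub>1\<^sup>1\<^sup>/\<^sup>d\<close> with coefficients in the iterated Laurent series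
  field of the remaining variables.
\<close>

primrec iterated_laurent :: "nat \<Rightarrow> nat \<Rightarrow> ((nat \<Rightarrow> real) \<Rightarrow> 'k::zero) set" where
  "iterated_laurent d 0 = {f. \<forall>a. f a \<noteq> 0 \<longrightarrow> a = (\<lambda>_. 0)}"
| "iterated_laurent d (Suc n) = {f.
     (\<forall>a. f a \<noteq> 0 \<longrightarrow> real d * a 0 \<in> \<int>) \<and>
     (\<exists>m. \<forall>a. f a \<noteq> 0 \<longrightarrow> m \<le> a 0) \<and>
     (\<forall>c. (\<lambda>b. f (case_nat c b)) \<in> iterated_laurent d n)}"

definition newton_diagram :: "((nat \<Rightarrow> real) \<Rightarrow> 'k::zero) \<Rightarrow> (nat \<Rightarrow> real) set" where
  "newton_diagram f = {a. f a \<noteq> 0}"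

definition series_mult ::
    "((nat \<Rightarrow> real) \<Rightarrow> 'k::semiring_0) \<Rightarrow> ((nat \<Rightarrow> real) \<Rightarrow> 'k) \<Rightarrow> (nat \<Rightarrow> real) \<Rightarrow> 'k" where
  "series_mult f g c =
     (\<Sum>a | f a \<noteq> 0 \<and> g (\<lambda>i. c i - a i) \<noteq> 0. f a * g (\<lambda>i. c i - a i))"

text \<open>The index set of the sum above is finite for iterated Laurent series.\<close>

lemma finite_scaled_ints_between:
  assumes "d > 0"
  shows "finite {u::real. real d * u \<in> \<int> \<and> l \<le> u \<and> u \<le> r}"
proof -
  have "{u::real. real d * u \<in> \<int> \<and> l \<le> u \<and> u \<le> r}
      \<subseteq> (\<lambda>z. of_int z / real d) ` {\<lfloor>real d * l\<rfloor>..\<lceil>real d * r\<rceil>}"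
  proof
    fix u :: real
    assume u: "u \<in> {u. real d * u \<in> \<int> \<and> l \<le> u \<and> u \<le> r}"
    then obtain z where z: "real d * u = of_int z"
      by (auto elim: Ints_cases)
    have "real d * l \<le> of_int z" "of_int z \<le> real d * r"
      using u assms unfolding z[symmetric] by (auto intro: mult_left_mono)
    then have "z \<in> {\<lfloor>real d * l\<rfloor>..\<lceil>real d * r\<rceil>}"
      by (simp, linarith)
    moreover have "u = of_int z / real d"
      using z assms by (simp add: field_simps)
    ultimately show "u \<in> (\<lambda>z. of_int z / real d) ` {\<lfloor>real d * l\<rfloor>..\<lceil>real d * r\<rceil>}"
      by blast
  qed
  then show ?thesis
    by (rule finite_subset) simp
qed

lemma finite_series_mult_support:
  assumes "d > 0" "f \<in> iterated_laurent d n" "g \<in> iterated_laurent d n"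
  shows "finite {a. f a \<noteq> 0 \<and> g (\<lambda>i. c i - a i) \<noteq> 0}"
  using assms(2,3)
proof (induction n arbitrary: f g c)
  case 0
  then have "{a. f a \<noteq> 0 \<and> g (\<lambda>i. c i - a i) \<noteq> 0} \<subseteq> {\<lambda>_. 0}"
    by auto
  then show ?case
    by (rule finite_subset) simp
next
  case (Suc n)
  obtain l where l: "\<And>a. f a \<noteq> 0 \<Longrightarrow> l \<le> a 0"
    using Suc.prems(1) by auto
  obtain m where m: "\<And>a. g a \<noteq> 0 \<Longrightarrow> m \<le> a 0"
    using Suc.prems(2) by auto
  define U where "U = {u. real d * u \<in> \<int> \<and> l \<le> u \<and> u \<le> c 0 - m}"
  define T where "T u = {b. f (case_nat u b) \<noteq> 0 \<and>
    g (case_nat (c 0 - u) (\<lambda>i. c (Suc i) - b i)) \<noteq> 0}" for u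
  have "finite (T u)" for u
    unfolding T_def using Suc.prems
    by (intro Suc.IH[of "\<lambda>b. f (case_nat u b)" "\<lambda>b. g (case_nat (c 0 - u) b)" "\<lambda>i. c (Suc i)"]) auto
  moreover have "finite U"
    unfolding U_def using assms(1) by (rule finite_scaled_ints_between)
  ultimately have "finite (\<Union>u\<in>U. case_nat u ` T u)"
    by auto
  moreover have "{a. f a \<noteq> 0 \<and> g (\<lambda>i. c i - a i) \<noteq> 0} \<subseteq> (\<Union>u\<in>U. case_nat u ` T u)"
  proof
    fix a
    assume "a \<in> {a. f a \<noteq> 0 \<and> g (\<lambda>i. c i - a i) \<noteq> 0}"
    then have a: "f a \<noteq> 0" "g (\<lambda>i. c i - a i) \<noteq> 0"
      by auto
    have split: "case_nat (a 0) (\<lambda>i. a (Suc i)) = a"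
      "case_nat (c 0 - a 0) (\<lambda>i. c (Suc i) - a (Suc i)) = (\<lambda>i. c i - a i)"
      by (auto simp: fun_eq_iff split: nat.split)
    have "a 0 \<in> U"
      unfolding U_def using a l[of a] m[OF a(2)] Suc.prems(1) by auto
    moreover have "(\<lambda>i. a (Suc i)) \<in> T (a 0)"
      unfolding T_def using a by (simp add: split)
    ultimately show "a \<in> (\<Union>u\<in>U. case_nat u ` T u)"
      using split(1) by (auto intro!: bexI[of _ "a 0"] image_eqI[of _ _ "\<lambda>i. a (Suc i)"])
  qed
  ultimately show ?case
    by (rule finite_subset[rotated])
qed

text \<open>
  The union of all \<open>K\<^sub>n\<^sub>,\<^sub>d\<close>, \<open>d > 0\<close>, in which all the rings and quotient fields below live.
\<close>

definition laurent_union :: "nat \<Rightarrow> ((nat \<Rightarrow> real) \<Rightarrow> 'k::field) ring" where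
  "laurent_union n =
    \<lparr>carrier = (\<Union>d\<in>{0<..}. iterated_laurent d n),
     mult = series_mult,
     one = (\<lambda>a. if a = (\<lambda>_. 0) then 1 else 0),
     zero = (\<lambda>_. 0),
     add = (\<lambda>f g a. f a + g a)\<rparr>"

definition cone_series :: "nat \<Rightarrow> (nat \<Rightarrow> real) set \<Rightarrow> nat \<Rightarrow> ((nat \<Rightarrow> real) \<Rightarrow> 'k::field) set" where
  "cone_series n \<Gamma> d = {f \<in> iterated_laurent d n. newton_diagram f \<subseteq> \<Gamma>}"

definition fractions :: "('a, 'b) ring_scheme \<Rightarrow> 'a set \<Rightarrow> 'a set" where
  "fractions F A = {f \<otimes>\<^bsub>F\<^esub> inv\<^bsub>F\<^esub> g | f g. f \<in> A \<and> g \<in> A - {\<zero>\<^bsub>F\<^esub>}}"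

definition laurent_star :: "nat \<Rightarrow> ((nat \<Rightarrow> real) \<Rightarrow> 'k::field) ring" where
  "laurent_star n = (laurent_union n)
     \<lparr>carrier := (\<Union>\<Gamma>\<in>cones n. \<Union>d\<in>{0<..}. fractions (laurent_union n) (cone_series n \<Gamma> d))\<rparr>"

end

theory Submission
  imports Defs "HOL-Library.Function_Algebras"
begin

text \<open>
  Order all exponent vectors lexicographically.  The support of a nonzero series in \<open>k[[\<Gamma>, d]]\<close> has a
  least exponent \<open>c\<close>, and although the differences \<open>b - c\<close> may leave \<open>\<Gamma>\<close>, a larger cone of \<open>\<Lambda>\<close> contains them
  all (\<open>cone_absorbs_translate\<close>).  Thus every nonzero series is a monomial times a unit of some
  \<open>k[[\<Delta>, d]]\<close>.  Consequently \<open>k((x))\<^sup>*\<close> consists of the series in the sets \<open>x\<^sup>a k[[\<Gamma>, d]]\<close>; it is a field with a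
  valuation in \<open>\<rat>\<^sup>n\<close>, its valuation ring is the union of all \<open>k[[\<Gamma>, d]]\<close>, and its residue field is \<open>k\<close>.

  It is algebraically closed by the Newton-Puiseux argument (\<open>cone_quots_monic_root\<close>).  As the
  characteristic is zero, a translation kills the coefficient next to the leading one of a monic
  polynomial.  As \<open>\<rat>\<^sup>n\<close> is divisible, the variable can be scaled by a monomial so that all coefficients
  become integral and one of them, below the leading one, becomes a unit (\<open>newton_slope\<close>).  The residue
  polynomial over \<open>k\<close> is then not a power of a linear polynomial, so it splits into coprime factors of
  smaller degree.  These lift, because each \<open>k[[\<Gamma>, d]]\<close> is a power series ring up to a linear change of exponents:
  the lattice points of \<open>\<Gamma>\<close> form a graded monoid in which every element has finitely many divisors, and
  the factors are found degree by degree (\<open>hensel_cone_ring\<close>).  Induction on the degree finishes.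

  It is algebraic over \<open>Q(R)\<close>: a series in \<open>k[[\<Gamma>, d]]\<close> is a finite sum of parts whose exponents lie in one class
  modulo \<open>\<int>\<^sup>n\<close>, and the \<open>d\<close>-th power of such a part has integral exponents, so it lies in \<open>R\<close>
  (\<open>residue_part_power\<close>).

  The arguments run in a type \<open>'k cone_quot\<close> that collects the series of all dimensions and is a field; the
  ring of dimension \<open>n\<close> is the image of its subfield \<open>cone_quots n\<close> under the coefficient map \<open>coefs\<close>.
\<close>

section \<open>Exponent vectors and the lexicographic order\<close>

definition exponents :: "nat \<Rightarrow> nat \<Rightarrow> (nat \<Rightarrow> real) set" where
  "exponents n d = {a. (\<forall>i. real d * a i \<in> \<int>) \<and> (\<forall>i\<ge>n. a i = 0)}"

text \<open>
  The first nonzero coordinate, if there is one, is positive.  The coordinate of \<open>x\<^sub>1\<close> is the most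
  significant one, as it is in \<open>k((x\<^sub>n))\<dots>((x\<^sub>1))\<close>.
\<close>

definition lex_nonneg :: "(nat \<Rightarrow> real) \<Rightarrow> bool" where
  "lex_nonneg a \<longleftrightarrow> (\<forall>i. (\<forall>j<i. a j = 0) \<longrightarrow> 0 \<le> a i)"

lemma exponentsD:
  assumes "a \<in> exponents n d"
  shows "real d * a i \<in> \<int>" "i \<ge> n \<Longrightarrow> a i = 0"
  using assms unfolding exponents_def by blast+

lemma exponents_0 [simp]: "0 \<in> exponents n d"
  by (auto simp: exponents_def)

lemma exponents_add: "a \<in> exponents n d \<Longrightarrow> b \<in> exponents n d \<Longrightarrow> a + b \<in> exponents n d"
  by (auto simp: exponents_def ring_distribs)

lemma exponents_diff: "a \<in> exponents n d \<Longrightarrow> b \<in> exponents n d \<Longrightarrow> a - b \<in> exponents n d"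
  by (auto simp: exponents_def ring_distribs)

lemma exponents_uminus: "a \<in> exponents n d \<Longrightarrow> - a \<in> exponents n d"
  by (auto simp: exponents_def)

lemma exponents_mono:
  assumes "n \<le> n'" "d dvd d'"
  shows "exponents n d \<subseteq> exponents n' d'"
proof
  fix a assume a: "a \<in> exponents n d"
  obtain e where e: "d' = d * e" using assms(2) by auto
  have "real d' * a i \<in> \<int>" for i
  proof -
    have "real d' * a i = real e * (real d * a i)" using e by simp
    also have "\<dots> \<in> \<int>"
      by (intro Ints_mult Ints_of_nat exponentsD(1)[OF a])
    finally show ?thesis .
  qed
  thus "a \<in> exponents n' d'" using a assms(1) by (auto simp: exponents_def)
qed

lemma lex_nonneg_add:
  assumes a: "lex_nonneg a" and b: "lex_nonneg b"
  shows "lex_nonneg (a + b)"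
  unfolding lex_nonneg_def
proof (intro allI impI)
  fix i assume z: "\<forall>j<i. (a + b) j = 0"
  have "a j = 0 \<and> b j = 0" if "j < i" for j
    using that
  proof (induction j rule: less_induct)
    case (less j)
    have "0 \<le> a j" "0 \<le> b j"
      using less a b unfolding lex_nonneg_def by (meson less_trans)+
    moreover have "a j + b j = 0" using z less.prems by auto
    ultimately show ?case by auto
  qed
  hence "0 \<le> a i" "0 \<le> b i" using a b unfolding lex_nonneg_def by blast+
  thus "0 \<le> (a + b) i" by simp
qed

lemma lex_nonneg_0 [simp]: "lex_nonneg 0"
  by (auto simp: lex_nonneg_def)

lemma lex_nonneg_antisym:
  assumes "lex_nonneg a" "lex_nonneg (- a)"
  shows "a = 0"
proof
  fix i show "a i = 0 i"
  proof (induction i rule: less_induct)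
    case (less i)
    hence "\<forall>j<i. a j = 0" "\<forall>j<i. (- a) j = 0" by auto
    hence "0 \<le> a i" "0 \<le> (- a) i" using assms unfolding lex_nonneg_def by blast+
    thus ?case by simp
  qed
qed

lemma lex_nonneg_total: "lex_nonneg a \<or> lex_nonneg (- a)"
proof (cases "lex_nonneg a")
  case False
  then obtain i where i: "\<forall>j<i. a j = 0" "a i < 0"
    unfolding lex_nonneg_def by (auto simp: not_le)
  have "0 \<le> (- a) l" if "\<forall>j<l. (- a) j = 0" for l
    using i that by (cases l i rule: linorder_cases) auto
  thus ?thesis unfolding lex_nonneg_def by blast
qed simp

lemma lex_nonneg_scale:
  assumes "lex_nonneg a" "0 \<le> t"
  shows "lex_nonneg (\<lambda>i. t * a i)"
  using assms unfolding lex_nonneg_def by (cases "t = 0") auto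

text \<open>
  The recursion on dimension that matches the recursion of \<open>iterated_laurent\<close>.
\<close>

lemma lex_nonneg_split:
  "lex_nonneg a \<longleftrightarrow> 0 < a 0 \<or> (a 0 = 0 \<and> lex_nonneg (\<lambda>i. a (Suc i)))"
proof -
  have "lex_nonneg (\<lambda>i. a (Suc i))" if "lex_nonneg a" "a 0 = 0"
    unfolding lex_nonneg_def
  proof (intro allI impI)
    fix i assume "\<forall>j<i. a (Suc j) = 0"
    hence "\<forall>j<Suc i. a j = 0" using that(2) by (auto simp: less_Suc_eq_0_disj)
    thus "0 \<le> a (Suc i)" using that(1) unfolding lex_nonneg_def by blast
  qed
  moreover have "0 \<le> a 0" if "lex_nonneg a" using that unfolding lex_nonneg_def by auto
  moreover have "lex_nonneg a" if "a 0 > 0" using that unfolding lex_nonneg_def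
    by (auto, case_tac i, auto)
  moreover have "lex_nonneg a" if "a 0 = 0" "lex_nonneg (\<lambda>i. a (Suc i))"
    unfolding lex_nonneg_def
  proof (intro allI impI)
    fix i assume z: "\<forall>j<i. a j = 0"
    show "0 \<le> a i"
      by (cases i) (use z that in \<open>auto simp: lex_nonneg_def\<close>)
  qed
  ultimately show ?thesis by (metis order_less_le)
qed

section \<open>Blowing-downs\<close>

lemma blow_up_alt: "i \<noteq> j \<Longrightarrow> blow_up i j (a(j := a j - a i)) = a"
  by (auto simp: blow_up_def)

lemma bij_blow_up: "i \<noteq> j \<Longrightarrow> bij (blow_up i j)"
  by (rule o_bij[of "\<lambda>a. a(j := a j - a i)"]) (auto simp: blow_up_def fun_eq_iff)

lemma blow_down_eq:
  assumes "i \<noteq> j"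
  shows "blow_down i j a = a(j := a j - a i)"
  unfolding blow_down_def
  by (rule inv_f_eq) (use assms bij_blow_up in \<open>auto simp: blow_up_alt bij_is_inj\<close>)

lemma bij_blow_down: "i \<noteq> j \<Longrightarrow> bij (blow_down i j)"
  unfolding blow_down_def using bij_blow_up bij_imp_bij_inv by blast

lemma blow_up_down: "i \<noteq> j \<Longrightarrow> blow_up i j (blow_down i j a) = a"
  by (simp add: blow_down_eq blow_up_alt)

lemma blow_down_up: "i \<noteq> j \<Longrightarrow> blow_down i j (blow_up i j a) = a"
  by (auto simp: blow_down_eq blow_up_def)

lemma blow_up_exponents:
  "i < j \<Longrightarrow> j < n \<Longrightarrow> a \<in> exponents n d \<Longrightarrow> blow_up i j a \<in> exponents n d"
  by (auto simp: exponents_def blow_up_def ring_distribs)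

lemma blow_down_exponents:
  "i < j \<Longrightarrow> j < n \<Longrightarrow> a \<in> exponents n d \<Longrightarrow> blow_down i j a \<in> exponents n d"
  by (auto simp: exponents_def blow_down_eq ring_distribs)

text \<open>
  A blowing-down changes a coordinate by an earlier one only, so it alters neither the position nor the
  value of the first nonzero coordinate: this is what order-preserving means.
\<close>

lemma blow_down_lex_nonneg_iff:
  assumes "i < j"
  shows "lex_nonneg (blow_down i j a) \<longleftrightarrow> lex_nonneg a"
proof -
  have z: "(\<forall>l<k. blow_down i j a l = 0) \<longleftrightarrow> (\<forall>l<k. a l = 0)" for k
  proof (induction k)
    case (Suc k)
    have "blow_down i j a k = 0 \<longleftrightarrow> a k = 0" if "\<forall>l<k. a l = 0"
      using assms that by (auto simp: blow_down_eq)
    thus ?case using Suc by (auto simp: less_Suc_eq)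
  qed simp
  have "0 \<le> blow_down i j a k \<longleftrightarrow> 0 \<le> a k" if "\<forall>l<k. a l = 0" for k
    using assms that by (auto simp: blow_down_eq)
  thus ?thesis unfolding lex_nonneg_def z by blast
qed

lemma compositions_add:
  "\<Phi> \<in> blow_down_compositions n \<Longrightarrow> \<Phi> (a + b) = \<Phi> a + \<Phi> b"
  by (induction rule: blow_down_compositions.induct) (auto simp: blow_down_eq fun_eq_iff)

lemma compositions_scale:
  "\<Phi> \<in> blow_down_compositions n \<Longrightarrow> \<Phi> (\<lambda>i. t * a i) = (\<lambda>i. t * \<Phi> a i)"
  by (induction rule: blow_down_compositions.induct) (auto simp: blow_down_eq fun_eq_iff ring_distribs)

lemma compositions_0: "\<Phi> \<in> blow_down_compositions n \<Longrightarrow> \<Phi> 0 = 0"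
  using compositions_add[of \<Phi> n 0 0] by simp

lemma compositions_bij: "\<Phi> \<in> blow_down_compositions n \<Longrightarrow> bij \<Phi>"
  by (induction rule: blow_down_compositions.induct) (auto intro!: bij_comp bij_blow_down simp del: comp_apply simp: bij_id[unfolded id_def])

lemma compositions_exponents_iff:
  "\<Phi> \<in> blow_down_compositions n \<Longrightarrow> \<Phi> a \<in> exponents n d \<longleftrightarrow> a \<in> exponents n d"
proof (induction rule: blow_down_compositions.induct)
  case (step \<Phi> i j)
  thus ?case
    using blow_down_exponents[of i j n "\<Phi> a" d] blow_up_exponents[of i j n "blow_down i j (\<Phi> a)" d]
    by (auto simp: blow_up_down)
qed auto

lemma compositions_lex_nonneg_iff:
  "\<Phi> \<in> blow_down_compositions n \<Longrightarrow> lex_nonneg (\<Phi> a) \<longleftrightarrow> lex_nonneg a"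
  by (induction rule: blow_down_compositions.induct) (auto simp: blow_down_lex_nonneg_iff)

lemma compositions_comp:
  "\<Phi> \<in> blow_down_compositions n \<Longrightarrow> \<Phi>' \<in> blow_down_compositions n \<Longrightarrow>
    \<Phi> \<circ> \<Phi>' \<in> blow_down_compositions n"
  by (induction rule: blow_down_compositions.induct)
     (auto simp: o_assoc[symmetric] intro: blow_down_compositions.step)

lemma compositions_mono:
  "\<Phi> \<in> blow_down_compositions n \<Longrightarrow> n \<le> n' \<Longrightarrow> \<Phi> \<in> blow_down_compositions n'"
  by (induction rule: blow_down_compositions.induct)
     (auto intro: blow_down_compositions.intros)

lemma compositions_vanish:
  "\<Phi> \<in> blow_down_compositions n \<Longrightarrow> i \<ge> n \<Longrightarrow> \<Phi> a i = a i"
  by (induction rule: blow_down_compositions.induct) (auto simp: blow_down_eq)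

section \<open>Cones\<close>

lemma orthant_in_cones: "nonneg_orthant n \<in> cones n"
  unfolding cones_def using blow_down_compositions.empty[of n] by (force intro!: exI[of _ id])

lemma coneE:
  assumes "\<Gamma> \<in> cones n"
  obtains \<Phi> where "\<Phi> \<in> blow_down_compositions n" "\<Gamma> = \<Phi> ` nonneg_orthant n"
  using assms unfolding cones_def by auto

lemma cone_image:
  assumes "\<Gamma> \<in> cones n" "\<Phi> \<in> blow_down_compositions n"
  shows "\<Phi> ` \<Gamma> \<in> cones n"
proof -
  obtain \<Phi>' where \<Phi>': "\<Phi>' \<in> blow_down_compositions n" "\<Gamma> = \<Phi>' ` nonneg_orthant n"
    using assms(1) by (rule coneE)
  have "\<Phi> ` \<Gamma> = (\<Phi> \<circ> \<Phi>') ` nonneg_orthant n"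
    unfolding \<Phi>'(2) image_comp ..
  thus ?thesis
    using compositions_comp[OF assms(2) \<Phi>'(1)] unfolding cones_def by blast
qed

lemma cone_0 [intro]: "\<Gamma> \<in> cones n \<Longrightarrow> 0 \<in> \<Gamma>"
  by (erule coneE) (auto simp: nonneg_orthant_def dest!: compositions_0 intro!: rev_image_eqI[of 0])

lemma cone_add:
  assumes "\<Gamma> \<in> cones n" "a \<in> \<Gamma>" "b \<in> \<Gamma>"
  shows "a + b \<in> \<Gamma>"
proof -
  obtain \<Phi> where \<Phi>: "\<Phi> \<in> blow_down_compositions n" "\<Gamma> = \<Phi> ` nonneg_orthant n"
    using assms(1) by (rule coneE)
  obtain a' b' where "a = \<Phi> a'" "b = \<Phi> b'" "a' \<in> nonneg_orthant n" "b' \<in> nonneg_orthant n"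
    using assms \<Phi> by auto
  thus ?thesis
    unfolding \<Phi>(2) by (intro image_eqI[of _ _ "a' + b'"])
      (auto simp: compositions_add[OF \<Phi>(1)] nonneg_orthant_def)
qed

lemma cone_scale:
  assumes "\<Gamma> \<in> cones n" "a \<in> \<Gamma>" "0 \<le> t"
  shows "(\<lambda>i. t * a i) \<in> \<Gamma>"
proof -
  obtain \<Phi> where \<Phi>: "\<Phi> \<in> blow_down_compositions n" "\<Gamma> = \<Phi> ` nonneg_orthant n"
    using assms(1) by (rule coneE)
  obtain a' where "a = \<Phi> a'" "a' \<in> nonneg_orthant n"
    using assms \<Phi> by auto
  thus ?thesis using assms(3)
    unfolding \<Phi>(2) by (intro image_eqI[of _ _ "\<lambda>i. t * a' i"])
      (auto simp: compositions_scale[OF \<Phi>(1)] nonneg_orthant_def)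
qed

lemma cone_lex_nonneg:
  assumes "\<Gamma> \<in> cones n" "a \<in> \<Gamma>"
  shows "lex_nonneg a"
proof -
  obtain \<Phi> where \<Phi>: "\<Phi> \<in> blow_down_compositions n" "\<Gamma> = \<Phi> ` nonneg_orthant n"
    using assms(1) by (rule coneE)
  have "lex_nonneg b" if "b \<in> nonneg_orthant n" for b
  proof -
    have "0 \<le> b i" for i using that by (cases "i < n") (auto simp: nonneg_orthant_def)
    thus ?thesis by (auto simp: lex_nonneg_def)
  qed
  thus ?thesis using assms(2) \<Phi> compositions_lex_nonneg_iff[OF \<Phi>(1)] by auto
qed

lemma cones_mono:
  assumes "\<Gamma> \<in> cones n" "n \<le> n'"
  shows "\<exists>\<Gamma>'\<in>cones n'. \<Gamma> \<subseteq> \<Gamma>'"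
proof -
  obtain \<Phi> where \<Phi>: "\<Phi> \<in> blow_down_compositions n" "\<Gamma> = \<Phi> ` nonneg_orthant n"
    using assms(1) by (rule coneE)
  have "nonneg_orthant n \<subseteq> nonneg_orthant n'"
  proof
    fix a assume a: "a \<in> nonneg_orthant n"
    hence "0 \<le> a i" for i by (cases "i < n") (auto simp: nonneg_orthant_def)
    thus "a \<in> nonneg_orthant n'" using a assms(2) by (auto simp: nonneg_orthant_def)
  qed
  hence "\<Gamma> \<subseteq> \<Phi> ` nonneg_orthant n'" unfolding \<Phi>(2) by (rule image_mono)
  moreover have "\<Phi> ` nonneg_orthant n' \<in> cones n'"
    unfolding cones_def using compositions_mono[OF \<Phi>(1) assms(2)] by blast
  ultimately show ?thesis by blast
qed

text \<open>
  Enlarging the composition on its outer side turns a cone into its preimage under a blowing-up.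
  The next two lemmas iterate this; a cone is thereby adapted to vectors one coordinate at a time.
\<close>

lemma cone_vimage_blow_up:
  assumes "\<Gamma> \<in> cones n" "i < j" "j < n"
  shows "blow_up i j -` \<Gamma> \<in> cones n"
proof -
  have "blow_down i j \<circ> id \<in> blow_down_compositions n"
    using assms by (intro blow_down_compositions.intros)
  hence "blow_down i j ` \<Gamma> \<in> cones n" using cone_image[OF assms(1)] by fastforce
  also have "blow_down i j ` \<Gamma> = blow_up i j -` \<Gamma>"
    using assms(2) by (force simp: blow_up_down blow_down_up image_iff)
  finally show ?thesis .
qed

lemma cone_vimage_shear1:
  assumes "\<Gamma> \<in> cones n" "i < j" "j < n"
  shows "(\<lambda>a. a(j := a j + real m * a i)) -` \<Gamma> \<in> cones n"
proof (induction m)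
  case 0
  thus ?case using assms(1) by (auto simp: vimage_def)
next
  case (Suc m)
  have eq: "(\<lambda>a. a(j := a j + real (Suc m) * a i)) =
      (\<lambda>a. a(j := a j + real m * a i)) \<circ> blow_up i j"
    using assms(2) by (auto simp: blow_up_def fun_eq_iff algebra_simps)
  show ?case
    unfolding eq vimage_comp[symmetric] by (rule cone_vimage_blow_up[OF Suc assms(2,3)])
qed

lemma cone_vimage_shear:
  assumes "\<Gamma> \<in> cones n" "l \<le> j" "j < n"
  shows "(\<lambda>a. a(j := a j + real m * (\<Sum>i<l. a i))) -` \<Gamma> \<in> cones n"
  using assms(2)
proof (induction l)
  case 0
  thus ?case using assms(1) by (auto simp: vimage_def)
next
  case (Suc l)
  have eq: "(\<lambda>a. a(j := a j + real m * (\<Sum>i<Suc l. a i))) =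
      (\<lambda>a. a(j := a j + real m * (\<Sum>i<l. a i))) \<circ> (\<lambda>a. a(j := a j + real m * a l))"
    using Suc.prems by (auto simp: fun_eq_iff algebra_simps)
  show ?case
    unfolding eq vimage_comp[symmetric]
    by (rule cone_vimage_shear1[OF Suc.IH]) (use Suc.prems assms(3) in auto)
qed

lemma exponents_shear:
  assumes "a \<in> exponents n d" "j < n"
  shows "a(j := a j + real m * (\<Sum>i<l. a i)) \<in> exponents n d"
proof -
  have "real d * (real m * (\<Sum>i<l. a i)) = real m * (\<Sum>i<l. real d * a i)"
    by (simp add: sum_distrib_left algebra_simps)
  also have "\<dots> \<in> \<int>"
    by (intro Ints_mult Ints_sum Ints_of_nat exponentsD(1)[OF assms(1)])
  finally show ?thesis using assms by (auto simp: exponents_def ring_distribs)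
qed

text \<open>
  The engine of the whole development.  Suppose that the first \<open>k\<close> coordinates are nonnegative on \<open>S\<close>.
  Adding a large multiple of their sum to coordinate \<open>k\<close> makes that coordinate nonnegative as well: if
  the sum vanishes, lexicographic nonnegativity already gives the sign, and otherwise the sum is at
  least \<open>1/d\<close>, because the exponents lie in a lattice, and outweighs the lower bound \<open>- C\<close>.  Such
  shears are compositions of blowing-ups, and they preserve all hypotheses.
\<close>

lemma lex_nonneg_subset_cone_aux:
  assumes "d > 0" "C \<ge> 0" "k \<le> n"
    and "S \<subseteq> exponents n d"
    and "\<And>a. a \<in> S \<Longrightarrow> lex_nonneg a"
    and "\<And>a i. a \<in> S \<Longrightarrow> - C \<le> a i"
    and "\<And>a i. a \<in> S \<Longrightarrow> i < k \<Longrightarrow> 0 \<le> a i"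
  shows "\<exists>\<Gamma>\<in>cones n. S \<subseteq> \<Gamma>"
  using assms(3-7)
proof (induction "n - k" arbitrary: k S)
  case 0
  hence "S \<subseteq> nonneg_orthant n" unfolding nonneg_orthant_def exponents_def by fastforce
  thus ?case using orthant_in_cones by blast
next
  case (Suc r)
  hence k: "k < n" by simp
  \<comment> \<open>the shear \<open>B\<close> adds at least \<open>m / d \<ge> C\<close> wherever the earlier coordinates do not all vanish\<close>
  obtain m :: nat where m: "C * real d \<le> real m" using real_arch_simple by blast
  define B where "B a = a(k := a k + real m * (\<Sum>i<k. a i))" for a :: "nat \<Rightarrow> real"
  have B_id: "B a = a" if "\<forall>i<k. a i = 0" for a
    using that by (auto simp: B_def)
  have lex: "lex_nonneg (B a)" if a: "a \<in> S" for a
    unfolding lex_nonneg_def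
  proof (intro allI impI)
    fix i assume z: "\<forall>j<i. B a j = 0"
    show "0 \<le> B a i"
    proof (cases "i < k")
      case True
      thus ?thesis using Suc.prems(5) a by (auto simp: B_def)
    next
      case False
      have "a j = 0" if "j < k" for j
      proof -
        have "B a j = 0" using z that False by auto
        thus ?thesis using that by (simp add: B_def)
      qed
      hence "B a = a" by (intro B_id) auto
      thus ?thesis using z Suc.prems(3)[OF a] unfolding lex_nonneg_def by auto
    qed
  qed
  have Bk: "0 \<le> B a k" if a: "a \<in> S" for a
  proof (cases "\<forall>i<k. a i = 0")
    case True
    thus ?thesis using B_id Suc.prems(3)[OF a] unfolding lex_nonneg_def by auto
  next
    case False
    then obtain i where i: "i < k" "a i \<noteq> 0" by blast
    have "0 < a i" using Suc.prems(5)[OF a i(1)] i(2) by linarith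
    also have "a i \<le> (\<Sum>i<k. a i)"
      using i Suc.prems(5)[OF a] by (intro member_le_sum) auto
    finally have "0 < real d * (\<Sum>i<k. a i)" using assms(1) by simp
    moreover have "real d * (\<Sum>i<k. a i) \<in> \<int>"
      unfolding sum_distrib_left by (intro Ints_sum exponentsD(1)[OF subsetD[OF Suc.prems(2) a]])
    ultimately have "1 \<le> \<bar>real d * (\<Sum>i<k. a i)\<bar>"
      by (intro Ints_nonzero_abs_ge1) linarith+
    with \<open>0 < real d * (\<Sum>i<k. a i)\<close> have ge1: "1 \<le> real d * (\<Sum>i<k. a i)"
      by linarith
    have "C * 1 \<le> C * (real d * (\<Sum>i<k. a i))" using ge1 assms(2) by (intro mult_left_mono)
    also have "\<dots> = (C * real d) * (\<Sum>i<k. a i)" by simp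
    also have "\<dots> \<le> real m * (\<Sum>i<k. a i)"
      using m Suc.prems(5)[OF a] by (intro mult_right_mono sum_nonneg) auto
    finally show ?thesis using Suc.prems(4)[OF a, of k] by (simp add: B_def)
  qed
  have "\<exists>\<Gamma>\<in>cones n. B ` S \<subseteq> \<Gamma>"
  proof (rule Suc.hyps(1)[of "Suc k"])
    show "r = n - Suc k" "Suc k \<le> n" using Suc.hyps(2) k by auto
    show "B ` S \<subseteq> exponents n d"
      using Suc.prems(2) exponents_shear[OF _ k] by (auto simp: B_def)
    show "lex_nonneg b" if "b \<in> B ` S" for b using lex that by auto
    show "- C \<le> b i" if b: "b \<in> B ` S" for b i
    proof -
      obtain a where a: "a \<in> S" "b = B a" using b by auto
      show ?thesis
      proof (cases "i = k")
        case True thus ?thesis using Bk[OF a(1)] a(2) assms(2) by auto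
      next
        case False thus ?thesis using Suc.prems(4)[OF a(1)] a(2) by (auto simp: B_def)
      qed
    qed
    show "0 \<le> b i" if b: "b \<in> B ` S" "i < Suc k" for b i
    proof -
      obtain a where a: "a \<in> S" "b = B a" using b by auto
      show ?thesis
      proof (cases "i = k")
        case True thus ?thesis using Bk[OF a(1)] a(2) by auto
      next
        case False thus ?thesis using Suc.prems(5)[OF a(1)] a(2) b(2) by (auto simp: B_def)
      qed
    qed
  qed
  then obtain \<Gamma> where "\<Gamma> \<in> cones n" "B ` S \<subseteq> \<Gamma>" by blast
  moreover have "B -` \<Gamma> \<in> cones n"
    unfolding B_def using \<open>\<Gamma> \<in> cones n\<close> k by (intro cone_vimage_shear) auto
  ultimately show ?case by (intro bexI[of _ "B -` \<Gamma>"]) auto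
qed

lemma lex_nonneg_subset_cone:
  assumes "d > 0" "S \<subseteq> exponents n d"
    and "\<And>a. a \<in> S \<Longrightarrow> lex_nonneg a"
    and "\<And>a i. a \<in> S \<Longrightarrow> C \<le> a i"
  shows "\<exists>\<Gamma>\<in>cones n. S \<subseteq> \<Gamma>"
proof (rule lex_nonneg_subset_cone_aux[of d "\<bar>C\<bar>" 0])
  show "- \<bar>C\<bar> \<le> a i" if "a \<in> S" for a i
    using assms(4)[OF that, of i] by linarith
qed (use assms in auto)

lemma exponents_bounded_below: "a \<in> exponents n d \<Longrightarrow> \<exists>C\<le>0. \<forall>i. C \<le> a i"
proof -
  assume a: "a \<in> exponents n d"
  have "- (\<Sum>i<n. \<bar>a i\<bar>) \<le> a i" for i
  proof (cases "i < n")
    case True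
    have "\<bar>a i\<bar> \<le> (\<Sum>i<n. \<bar>a i\<bar>)" using True
      by (intro member_le_sum) auto
    thus ?thesis by linarith
  next
    case False
    thus ?thesis using a by (auto simp: exponents_def sum_nonneg)
  qed
  thus ?thesis by (intro exI[of _ "- (\<Sum>i<n. \<bar>a i\<bar>)"]) (auto simp: sum_nonneg)
qed

lemma finite_lex_nonneg_subset_cone:
  assumes "d > 0" "finite S" "S \<subseteq> exponents n d"
    and "\<And>a. a \<in> S \<Longrightarrow> lex_nonneg a"
  shows "\<exists>\<Gamma>\<in>cones n. S \<subseteq> \<Gamma>"
proof -
  obtain C where C: "\<And>a. a \<in> S \<Longrightarrow> C a \<le> 0 \<and> (\<forall>i. C a \<le> a i)"
    using exponents_bounded_below assms(3) by (metis subset_iff)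
  show ?thesis
  proof (rule lex_nonneg_subset_cone[OF assms(1,3,4)])
    fix a i assume a: "a \<in> S"
    have "(\<Sum>b\<in>S. C b) \<le> C a"
      using sum.remove[OF assms(2) a, of C] sum_nonpos[of "S - {a}" C] C by simp
    thus "(\<Sum>b\<in>S. C b) \<le> a i" using C[OF a] by (meson order_trans)
  qed auto
qed

text \<open>
  A cone is generated by the images of the unit vectors, so it is contained in every cone of \<open>\<Lambda>\<close> that
  contains these.
\<close>

lemma cone_subsetI:
  assumes "\<Gamma> \<in> cones n" "\<Phi> \<in> blow_down_compositions n"
    and gen: "\<And>j. j < n \<Longrightarrow> \<Phi> (\<lambda>i. if i = j then 1 else 0) \<in> \<Gamma>"
  shows "\<Phi> ` nonneg_orthant n \<subseteq> \<Gamma>"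
proof
  fix b assume "b \<in> \<Phi> ` nonneg_orthant n"
  then obtain a where a: "b = \<Phi> a" "a \<in> nonneg_orthant n" by auto
  have "l \<le> n \<Longrightarrow> \<Phi> (\<lambda>i. if i < l then a i else 0) \<in> \<Gamma>" for l
  proof (induction l)
    case 0
    have "(\<lambda>i. if i < 0 then a i else 0) = 0" by auto
    thus ?case using compositions_0[OF assms(2)] cone_0[OF assms(1)] by simp
  next
    case (Suc l)
    have eq: "(\<lambda>i. if i < Suc l then a i else 0) = (\<lambda>i. if i < l then a i else 0)
        + (\<lambda>i. a l * (if i = l then 1 else 0))"
      by (auto simp: fun_eq_iff less_Suc_eq)
    have "0 \<le> a l" using a(2) Suc.prems by (auto simp: nonneg_orthant_def)
    thus ?case
      unfolding eq compositions_add[OF assms(2)] compositions_scale[OF assms(2)]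
      using Suc by (intro cone_add[OF assms(1)] cone_scale[OF assms(1)] gen) auto
  qed
  from this[of n] have "\<Phi> (\<lambda>i. if i < n then a i else 0) \<in> \<Gamma>" by simp
  also have "(\<lambda>i. if i < n then a i else 0) = a"
    using a(2) by (auto simp: nonneg_orthant_def)
  finally show "b \<in> \<Gamma>" using a(1) by simp
qed

text \<open>
  The finitely many generators of both cones are lexicographically nonnegative, so one cone of \<open>\<Lambda>\<close>
  contains all of them.
\<close>

lemma cones_directed:
  assumes "\<Gamma>1 \<in> cones n" "\<Gamma>2 \<in> cones n"
  shows "\<exists>\<Gamma>\<in>cones n. \<Gamma>1 \<subseteq> \<Gamma> \<and> \<Gamma>2 \<subseteq> \<Gamma>"
proof -
  obtain \<Phi>1 where \<Phi>1: "\<Phi>1 \<in> blow_down_compositions n" "\<Gamma>1 = \<Phi>1 ` nonneg_orthant n"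
    using assms(1) by (rule coneE)
  obtain \<Phi>2 where \<Phi>2: "\<Phi>2 \<in> blow_down_compositions n" "\<Gamma>2 = \<Phi>2 ` nonneg_orthant n"
    using assms(2) by (rule coneE)
  define e :: "nat \<Rightarrow> nat \<Rightarrow> real"
    where "e j = (\<lambda>i. if i = j then 1 else 0)" for j
  have e: "e j \<in> exponents n 1" "lex_nonneg (e j)" if "j < n" for j
    using that by (auto simp: e_def exponents_def lex_nonneg_def)
  have "\<exists>\<Gamma>\<in>cones n. (\<Phi>1 \<circ> e) ` {..<n} \<union> (\<Phi>2 \<circ> e) ` {..<n} \<subseteq> \<Gamma>"
    using e by (intro finite_lex_nonneg_subset_cone[of 1])
      (auto simp: compositions_exponents_iff[OF \<Phi>1(1)] compositions_exponents_iff[OF \<Phi>2(1)]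
        compositions_lex_nonneg_iff[OF \<Phi>1(1)] compositions_lex_nonneg_iff[OF \<Phi>2(1)])
  then obtain \<Gamma>
    where "\<Gamma> \<in> cones n" "(\<Phi>1 \<circ> e) ` {..<n} \<union> (\<Phi>2 \<circ> e) ` {..<n} \<subseteq> \<Gamma>"
      by blast
  thus ?thesis
    using cone_subsetI[OF _ \<Phi>1(1), of \<Gamma>] cone_subsetI[OF _ \<Phi>2(1), of \<Gamma>]
    unfolding \<Phi>1(2) \<Phi>2(2) e_def
    by (intro bexI[of _ \<Gamma>] conjI) (simp_all add: image_subset_iff)
qed

text \<open>
  Applied to the support \<open>S\<close> of a series in \<open>x\<^sup>a k[[\<Gamma>, d]]\<close> with lexicographically least exponent \<open>c\<close>,
  this says that the series is \<open>x\<^sup>c\<close> times a unit of some \<open>k[[\<Delta>, d]]\<close>.  In the coordinates that carry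
  \<open>\<Gamma>\<close> to the orthant the differences \<open>b - c\<close> are bounded below, since \<open>b - a\<close> is nonnegative there,
  hence they fit into one cone; that cone is then carried back.
\<close>

lemma cone_absorbs_translate:
  assumes "d > 0" "\<Gamma> \<in> cones n" "S \<subseteq> exponents n d" "a \<in> exponents n d" "c \<in> exponents n d"
    and "\<And>b. b \<in> S \<Longrightarrow> b - a \<in> \<Gamma>"
    and "\<And>b. b \<in> S \<Longrightarrow> lex_nonneg (b - c)"
  shows "\<exists>\<Delta>\<in>cones n. \<forall>b\<in>S. b - c \<in> \<Delta>"
proof -
  obtain \<Phi> where \<Phi>: "\<Phi> \<in> blow_down_compositions n" "\<Gamma> = \<Phi> ` nonneg_orthant n"
    using assms(2) by (rule coneE)
  define \<Psi> where "\<Psi> = inv_into UNIV \<Phi>"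
  have [simp]: "\<Phi> (\<Psi> b) = b" "\<Psi> (\<Phi> b) = b" for b
    using compositions_bij[OF \<Phi>(1)] unfolding \<Psi>_def
    by (simp_all add: bij_is_surj surj_f_inv_f bij_is_inj)
  have ex: "\<Psi> b \<in> exponents n d" if "b \<in> exponents n d" for b
    using compositions_exponents_iff[OF \<Phi>(1), of "\<Psi> b"] that by simp
  obtain C where C: "\<And>i. C \<le> \<Psi> (a - c) i"
    using exponents_bounded_below ex[OF exponents_diff[OF assms(4,5)]] by blast
  have "\<exists>\<Delta>\<in>cones n. (\<lambda>b. \<Psi> (b - c)) ` S \<subseteq> \<Delta>"
  proof (rule lex_nonneg_subset_cone[OF assms(1)])
    show "(\<lambda>b. \<Psi> (b - c)) ` S \<subseteq> exponents n d"
      using assms(3,5) ex exponents_diff by blast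
    show "lex_nonneg y" if "y \<in> (\<lambda>b. \<Psi> (b - c)) ` S" for y
      using that assms(7) compositions_lex_nonneg_iff[OF \<Phi>(1), of y] by auto
    show "C \<le> y i" if y: "y \<in> (\<lambda>b. \<Psi> (b - c)) ` S" for y i
    proof -
      obtain b where b: "b \<in> S" "y = \<Psi> (b - c)" using y by auto
      obtain z where z: "z \<in> nonneg_orthant n" "b - a = \<Phi> z"
        using assms(6)[OF b(1)] \<Phi>(2) by auto
      have "\<Phi> (z + \<Psi> (a - c)) = b - c"
        using z(2) by (simp add: compositions_add[OF \<Phi>(1)] flip: z(2))
      hence "y = z + \<Psi> (a - c)" using b(2)
        by (metis \<open>\<And>b. \<Psi> (\<Phi> b) = b\<close>)
      moreover have "0 \<le> z i" using z(1) by (cases "i < n") (auto simp: nonneg_orthant_def)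
      ultimately show ?thesis using C[of i] by simp
    qed
  qed
  then obtain \<Delta>
    where \<Delta>: "\<Delta> \<in> cones n" "(\<lambda>b. \<Psi> (b - c)) ` S \<subseteq> \<Delta>"
      by blast
  have "b - c \<in> \<Phi> ` \<Delta>" if "b \<in> S" for b
    using \<Delta>(2) that by (intro image_eqI[of _ _ "\<Psi> (b - c)"]) auto
  thus ?thesis using cone_image[OF \<Delta>(1) \<Phi>(1)] by blast
qed

section \<open>Supports of iterated Laurent series\<close>

text \<open>
  Membership in \<open>k((x\<^sub>n\<^sup>1\<^sup>/\<^sup>d))\<dots>((x\<^sub>1\<^sup>1\<^sup>/\<^sup>d))\<close> depends on the support alone.  The indicator function gives a
  predicate on supports that is independent of the coefficient type.
\<close>

definition laurent_support :: "nat \<Rightarrow> nat \<Rightarrow> (nat \<Rightarrow> real) set \<Rightarrow> bool" where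
  "laurent_support d n S \<longleftrightarrow> (\<lambda>a. if a \<in> S then 1 else 0 :: nat) \<in> iterated_laurent d n"

lemma iterated_laurent_support_cong:
  fixes f :: "(nat \<Rightarrow> real) \<Rightarrow> 'a::zero" and g :: "(nat \<Rightarrow> real) \<Rightarrow> 'b::zero"
  assumes "f \<in> iterated_laurent d n" "\<And>a. g a \<noteq> 0 \<Longrightarrow> f a \<noteq> 0"
  shows "g \<in> iterated_laurent d n"
  using assms
proof (induction n arbitrary: f g)
  case (Suc n)
  have "(\<lambda>b. g (case_nat c b)) \<in> iterated_laurent d n" for c
    by (rule Suc.IH[of "\<lambda>b. f (case_nat c b)"]) (use Suc.prems in auto)
  moreover obtain m where "\<And>a. f a \<noteq> 0 \<Longrightarrow> m \<le> a 0" using Suc.prems(1)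
    by auto
  hence "\<exists>m. \<forall>a. g a \<noteq> 0 \<longrightarrow> m \<le> a 0" using Suc.prems(2)
    by blast
  ultimately show ?case using Suc.prems by auto
qed auto

lemma iterated_laurent_iff: "f \<in> iterated_laurent d n \<longleftrightarrow> laurent_support d n {a. f a \<noteq> 0}"
  unfolding laurent_support_def
  by (auto elim!: iterated_laurent_support_cong split: if_splits)

lemma laurent_support_mono: "laurent_support d n S \<Longrightarrow> T \<subseteq> S \<Longrightarrow> laurent_support d n T"
  unfolding laurent_support_def by (erule iterated_laurent_support_cong) (auto split: if_splits)

lemma laurent_support_0 [simp]: "laurent_support d 0 S \<longleftrightarrow> S \<subseteq> {\<lambda>_. 0}"
  unfolding laurent_support_def by auto

lemma laurent_support_Suc [simp]:
  "laurent_support d (Suc n) S \<longleftrightarrow> (\<forall>a\<in>S. real d * a 0 \<in> \<int>) \<and> (\<exists>m. \<forall>a\<in>S. m \<le> a 0) \<and>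
     (\<forall>c. laurent_support d n {b. case_nat c b \<in> S})"
  unfolding laurent_support_def by auto

lemma case_nat_tail [simp]: "case_nat (a 0) (\<lambda>i. a (Suc i)) = a"
  by (auto simp: fun_eq_iff split: nat.split)

lemma laurent_support_mult: "laurent_support d n S \<Longrightarrow> laurent_support (d * e) n S"
proof (induction n arbitrary: S)
  case (Suc n)
  have "real (d * e) * a 0 \<in> \<int>" if "a \<in> S" for a
  proof -
    have "real e * (real d * a 0) \<in> \<int>"
      by (rule Ints_mult) (use Suc.prems that in auto)
    thus ?thesis by (simp add: mult_ac)
  qed
  thus ?case using Suc by (simp del: of_nat_mult)
qed simp

lemma laurent_support_Suc_dim: "laurent_support d n S \<Longrightarrow> laurent_support d (Suc n) S"
proof (induction n arbitrary: S)
  case 0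
  hence S: "S \<subseteq> {\<lambda>_. 0}" by simp
  have "b = (\<lambda>_. 0)" if "case_nat c b \<in> S" for b c
  proof -
    have "case_nat c b = (\<lambda>_. 0)" using S that by auto
    hence "case_nat c b (Suc i) = 0" for i by metis
    thus ?thesis by auto
  qed
  thus ?case using S by (auto simp: subset_iff intro!: exI[of _ 0])
next
  case (Suc n)
  have "laurent_support d (Suc n) {b. case_nat c b \<in> S}" for c
    by (rule Suc.IH) (use Suc.prems in auto)
  thus ?case using Suc.prems unfolding laurent_support_Suc[of d "Suc n"] by auto
qed

lemma laurent_support_mono_dim:
  assumes "laurent_support d n S" "n \<le> n'"
  shows "laurent_support d n' S"
  using assms(2) by (induction rule: dec_induct) (intro assms(1) laurent_support_Suc_dim; assumption)+

lemma laurent_support_empty: "laurent_support d n {}"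
  by (induction n) auto

lemma laurent_support_Un:
  "laurent_support d n S \<Longrightarrow> laurent_support d n T \<Longrightarrow> laurent_support d n (S \<union> T)"
proof (induction n arbitrary: S T)
  case (Suc n)
  from Suc.prems have "\<exists>l. \<forall>a\<in>S. l \<le> a 0" "\<exists>m. \<forall>a\<in>T. m \<le> a 0"
    by auto
  then obtain l m where lm: "\<And>a. a \<in> S \<Longrightarrow> l \<le> a 0" "\<And>a. a \<in> T \<Longrightarrow> m \<le> a 0"
    by blast
  have "\<forall>a\<in>S \<union> T. min l m \<le> a 0" using lm by force
  moreover have "laurent_support d n {b. case_nat c b \<in> S \<union> T}" for c
    using Suc.IH[of "{b. case_nat c b \<in> S}" "{b. case_nat c b \<in> T}"] Suc.prems
    by (simp add: Collect_disj_eq)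
  ultimately show ?case using Suc.prems by auto
qed auto

lemma laurent_support_UN:
  "finite I \<Longrightarrow> (\<And>i. i \<in> I \<Longrightarrow> laurent_support d n (S i)) \<Longrightarrow> laurent_support d n (\<Union>i\<in>I. S i)"
  by (induction I rule: finite_induct) (auto intro: laurent_support_empty laurent_support_Un)

text \<open>
  Supports of products are again supports of iterated Laurent series: in the fibre over a value \<open>u\<close> of
  the first coordinate only finitely many splittings \<open>u = v + (u - v)\<close> contribute.
\<close>

lemma laurent_support_sumset:
  assumes "d > 0"
  shows "laurent_support d n S \<Longrightarrow> laurent_support d n T \<Longrightarrow>
    laurent_support d n {a + b | a b. a \<in> S \<and> b \<in> T}"
proof (induction n arbitrary: S T)
  case 0
  have "a + b = (\<lambda>_. 0)" if "a \<in> S" "b \<in> T" for a b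
  proof -
    have "a = (\<lambda>_. 0)" "b = (\<lambda>_. 0)" using that 0 by auto
    thus ?thesis by (simp add: fun_eq_iff)
  qed
  thus ?case unfolding laurent_support_0 by blast
next
  case (Suc n)
  let ?P = "{a + b | a b. a \<in> S \<and> b \<in> T}"
  from Suc.prems have "\<exists>l. \<forall>a\<in>S. l \<le> a 0" "\<exists>m. \<forall>a\<in>T. m \<le> a 0"
    by auto
  then obtain l m where lm: "\<And>a. a \<in> S \<Longrightarrow> l \<le> a 0" "\<And>a. a \<in> T \<Longrightarrow> m \<le> a 0"
    by blast
  have ints: "real d * a 0 \<in> \<int>" if "a \<in> S \<union> T" for a using Suc.prems that
    by auto
  have "real d * (a + b) 0 \<in> \<int>" if "a \<in> S" "b \<in> T" for a b
    using ints[of a] ints[of b] that by (simp add: ring_distribs)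
  hence 1: "\<forall>c\<in>?P. real d * c 0 \<in> \<int>" by blast
  have "l + m \<le> (a + b) 0" if "a \<in> S" "b \<in> T" for a b
    using lm(1)[OF that(1)] lm(2)[OF that(2)] by simp
  hence 2: "\<forall>c\<in>?P. l + m \<le> c 0" by blast
  have 3: "laurent_support d n {b. case_nat u b \<in> ?P}" for u
  proof -
    define U where "U = {v. real d * v \<in> \<int> \<and> l \<le> v \<and> v \<le> u - m}"
    define P where "P v = {a + b | a b. a \<in> {b. case_nat v b \<in> S} \<and> b \<in> {b. case_nat (u - v) b \<in> T}}" for v
    have "finite U" unfolding U_def using assms by (rule finite_scaled_ints_between)
    moreover have "laurent_support d n (P v)" for v
      unfolding P_def by (rule Suc.IH) (use Suc.prems in auto)
    ultimately have "laurent_support d n (\<Union>v\<in>U. P v)" by (intro laurent_support_UN)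
    moreover have "{b. case_nat u b \<in> ?P} \<subseteq> (\<Union>v\<in>U. P v)"
    proof
      fix c assume "c \<in> {b. case_nat u b \<in> ?P}"
      then obtain a b where ab: "case_nat u c = a + b" "a \<in> S" "b \<in> T" by blast
      have u: "u = a 0 + b 0" using fun_cong[OF ab(1), of 0] by simp
      have c: "c = (\<lambda>i. a (Suc i)) + (\<lambda>i. b (Suc i))"
      proof
        fix i show "c i = ((\<lambda>i. a (Suc i)) + (\<lambda>i. b (Suc i))) i"
          using fun_cong[OF ab(1), of "Suc i"] by simp
      qed
      have "a 0 \<in> U" unfolding U_def using ints[of a] lm(1)[OF ab(2)] lm(2)[OF ab(3)] ab(2) u
        by auto
      moreover have "c \<in> P (a 0)"
      proof -
        have "(\<lambda>i. a (Suc i)) \<in> {b. case_nat (a 0) b \<in> S}" "(\<lambda>i. b (Suc i)) \<in> {b'. case_nat (u - a 0) b' \<in> T}"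
          using ab(2,3) u by simp_all
        thus ?thesis unfolding P_def using c by blast
      qed
      ultimately show "c \<in> (\<Union>v\<in>U. P v)" by blast
    qed
    ultimately show ?thesis by (rule laurent_support_mono)
  qed
  show ?case unfolding laurent_support_Suc using 1 2 3 by blast
qed

lemma laurent_support_finite:
  assumes "d > 0" "laurent_support d n S" "laurent_support d n T"
  shows "finite {a \<in> S. c - a \<in> T}"
proof -
  have "{a. (if a \<in> S then 1 else 0 :: nat) \<noteq> 0 \<and> (if (\<lambda>i. c i - a i) \<in> T then 1 else 0 :: nat) \<noteq> 0}
      = {a \<in> S. c - a \<in> T}"
    by (auto simp: fun_diff_def)
  thus ?thesis
    using finite_series_mult_support[OF assms(1) assms(2,3)[unfolded laurent_support_def], of c]
    by simp
qed

lemma laurent_support_exponents: "laurent_support d n S \<Longrightarrow> S \<subseteq> exponents n d"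
proof (induction n arbitrary: S)
  case 0
  thus ?case by (auto simp: exponents_def)
next
  case (Suc n)
  show ?case
  proof
    fix a assume a: "a \<in> S"
    have "laurent_support d n {b. case_nat (a 0) b \<in> S}" using Suc.prems by auto
    from Suc.IH[OF this] have t: "(\<lambda>i. a (Suc i)) \<in> exponents n d" using a
      by (simp add: subset_iff)
    have "real d * a i \<in> \<int>" for i
      using exponentsD(1)[OF t] Suc.prems a by (cases i) auto
    moreover have "a i = 0" if "i \<ge> Suc n" for i
      using exponentsD(2)[OF t, of "i - 1"] that by (cases i) auto
    ultimately show "a \<in> exponents (Suc n) d" unfolding exponents_def by blast
  qed
qed

text \<open>
  Supports are well-ordered lexicographically; choose the least first coordinate, which exists by
  discreteness, and continue in its fibre.
\<close>

lemma laurent_support_lex_least: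
  assumes "d > 0"
  shows "laurent_support d n S \<Longrightarrow> S \<noteq> {} \<Longrightarrow> \<exists>c\<in>S. \<forall>b\<in>S. lex_nonneg (b - c)"
proof (induction n arbitrary: S)
  case 0
  hence "S = {\<lambda>_. 0}" by auto
  thus ?case by (auto simp: lex_nonneg_def)
next
  case (Suc n)
  obtain l where l: "\<And>a. a \<in> S \<Longrightarrow> l \<le> a 0" using Suc.prems by auto
  obtain a0 where a0: "a0 \<in> S" using Suc.prems by auto
  define U where "U = (\<lambda>a. a 0) ` S \<inter> {..a0 0}"
  have "U \<subseteq> {u. real d * u \<in> \<int> \<and> l \<le> u \<and> u \<le> a0 0}"
    unfolding U_def using l Suc.prems by auto
  hence fin: "finite U" using finite_scaled_ints_between[OF assms] finite_subset by blast
  have U0: "a0 0 \<in> U" unfolding U_def using a0 by auto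
  define u where "u = Min U"
  have "u \<in> U" unfolding u_def using fin U0 by (intro Min_in) auto
  have u_min: "u \<le> b 0" if "b \<in> S" for b
  proof (cases "b 0 \<le> a0 0")
    case True
    thus ?thesis unfolding u_def using fin that by (intro Min_le) (auto simp: U_def)
  next
    case False
    have "u \<le> a0 0" unfolding u_def using fin U0 by (intro Min_le)
    thus ?thesis using False by linarith
  qed
  obtain a1 where a1: "a1 \<in> S" "a1 0 = u" using \<open>u \<in> U\<close> unfolding U_def by auto
  let ?F = "{b. case_nat u b \<in> S}"
  have "(\<lambda>i. a1 (Suc i)) \<in> ?F" using a1 by (metis case_nat_tail mem_Collect_eq)
  hence "?F \<noteq> {}" by blast
  moreover have "laurent_support d n ?F" using Suc.prems by auto
  ultimately obtain c where c: "c \<in> ?F" "\<forall>b\<in>?F. lex_nonneg (b - c)" using Suc.IH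
    by blast
  have "lex_nonneg (b - case_nat u c)" if b: "b \<in> S" for b
  proof (cases "b 0 = u")
    case True
    have "(\<lambda>i. b (Suc i)) \<in> ?F" using b True by (metis case_nat_tail mem_Collect_eq)
    hence "lex_nonneg ((\<lambda>i. b (Suc i)) - c)" using c(2) by blast
    thus ?thesis using True by (subst lex_nonneg_split) (simp add: fun_diff_def)
  next
    case False
    thus ?thesis using u_min[OF b] by (subst lex_nonneg_split) simp
  qed
  thus ?case using c(1) by blast
qed

text \<open>
  A support may leave the orthant as long as each coordinate is bounded below in terms of the earlier
  ones.  The second argument of \<open>\<beta>\<close> is the vector of earlier coordinates.
\<close>

lemma laurent_supportI:
  fixes \<beta> :: "nat \<Rightarrow> (nat \<Rightarrow> real) \<Rightarrow> real"
  assumes "S \<subseteq> exponents n d"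
    and "\<And>a j. a \<in> S \<Longrightarrow> j < n \<Longrightarrow> \<beta> j (\<lambda>i. if i < j then a i else 0) \<le> a j"
  shows "laurent_support d n S"
  using assms
proof (induction n arbitrary: S \<beta>)
  case 0
  thus ?case by (auto simp: exponents_def)
next
  case (Suc n)
  have 1: "\<forall>a\<in>S. real d * a 0 \<in> \<int>" using Suc.prems(1) exponentsD(1) by blast
  have 2: "\<forall>a\<in>S. \<beta> 0 (\<lambda>_. 0) \<le> a 0" using Suc.prems(2)[of _ 0] by auto
  have 3: "laurent_support d n {b. case_nat c b \<in> S}" for c
  proof (rule Suc.IH)
    show "{b. case_nat c b \<in> S} \<subseteq> exponents n d"
    proof clarify
      fix b assume "case_nat c b \<in> S"
      hence e: "case_nat c b \<in> exponents (Suc n) d" using Suc.prems(1) by blast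
      show "b \<in> exponents n d"
        using exponentsD(1)[OF e, of "Suc _"] exponentsD(2)[OF e, of "Suc _"]
        by (auto simp: exponents_def)
    qed
    fix b j assume b: "b \<in> {b. case_nat c b \<in> S}" "j < n"
    have "(\<lambda>i. if i < Suc j then case_nat c b i else 0) = case_nat c (\<lambda>i. if i < j then b i else 0)"
      by (auto simp: fun_eq_iff split: nat.split)
    thus "(\<lambda>j r. \<beta> (Suc j) (case_nat c r)) j (\<lambda>i. if i < j then b i else 0) \<le> b j"
      using Suc.prems(2)[of "case_nat c b" "Suc j"] b by auto
  qed
  show ?case unfolding laurent_support_Suc using 1 2 3 by blast
qed

text \<open>
  Blowing-downs are triangular, so a lower bound for a coordinate in terms of earlier ones is
  transformed into another one of the same kind.
\<close>

lemma cone_coordinates_bounded_below: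
  assumes "\<Phi> \<in> blow_down_compositions n"
  shows "\<exists>\<beta>. \<forall>a\<in>\<Phi> ` nonneg_orthant n. \<forall>j. \<beta> j (\<lambda>i. if i < j then a i else 0 :: real) \<le> a j"
  using assms
proof (induction rule: blow_down_compositions.induct)
  case empty
  have "0 \<le> a j" if "a \<in> nonneg_orthant n" for a j
    using that by (cases "j < n") (auto simp: nonneg_orthant_def)
  thus ?case by (intro exI[of _ "\<lambda>_ _. 0"]) auto
next
  case (step \<Phi> i j)
  obtain \<beta> where \<beta>: "\<And>a l. a \<in> \<Phi> ` nonneg_orthant n \<Longrightarrow> \<beta> l (\<lambda>i. if i < l then a i else 0) \<le> a l"
    using step.IH by blast
  define \<beta>' where "\<beta>' l r = (if l < j then \<beta> l r else if l = j then \<beta> l r - r i else \<beta> l (blow_up i j r))" for l r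
  have "\<beta>' l (\<lambda>k. if k < l then a k else 0) \<le> a l" if "a \<in> (blow_down i j \<circ> \<Phi>) ` nonneg_orthant n" for a l
  proof -
    obtain a' where a': "a' \<in> \<Phi> ` nonneg_orthant n" "a = blow_down i j a'"
      using \<open>a \<in> (blow_down i j \<circ> \<Phi>) ` nonneg_orthant n\<close> by auto
    have a: "a = a'(j := a' j - a' i)" using a'(2) step.hyps blow_down_eq by auto
    consider "l < j" | "l = j" | "l > j" by linarith
    thus ?thesis
    proof cases
      case 1
      hence "(\<lambda>k. if k < l then a k else 0) = (\<lambda>k. if k < l then a' k else 0)"
        by (auto simp: a)
      thus ?thesis using \<beta>[OF a'(1), of l] 1 by (simp add: \<beta>'_def a)
    next
      case 2
      hence "(\<lambda>k. if k < l then a k else 0) = (\<lambda>k. if k < l then a' k else 0)"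
        by (auto simp: a)
      thus ?thesis using \<beta>[OF a'(1), of l] 2 step.hyps by (simp add: \<beta>'_def a)
    next
      case 3
      hence "blow_up i j (\<lambda>k. if k < l then a k else 0) = (\<lambda>k. if k < l then a' k else 0)"
        using step.hyps by (auto simp: a blow_up_def fun_eq_iff)
      thus ?thesis using \<beta>[OF a'(1), of l] 3 by (simp add: \<beta>'_def a)
    qed
  qed
  thus ?case by blast
qed

lemma laurent_support_translated_cone:
  assumes "\<Gamma> \<in> cones n"
  shows "laurent_support d n {b \<in> exponents n d. b - a \<in> \<Gamma>}"
proof -
  obtain \<Phi> where \<Phi>: "\<Phi> \<in> blow_down_compositions n" "\<Gamma> = \<Phi> ` nonneg_orthant n"
    using assms by (rule coneE)
  obtain \<beta> where \<beta>: "\<And>c j. c \<in> \<Gamma> \<Longrightarrow> \<beta> j (\<lambda>i. if i < j then c i else 0) \<le> c j"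
    using cone_coordinates_bounded_below[OF \<Phi>(1)] \<Phi>(2) by blast
  show ?thesis
  proof (rule laurent_supportI[where \<beta> = "\<lambda>j r. a j + \<beta> j (\<lambda>i. if i < j then r i - a i else 0)"])
    fix b j assume "b \<in> {b \<in> exponents n d. b - a \<in> \<Gamma>}"
    hence "b - a \<in> \<Gamma>" by blast
    from \<beta>[OF this, of j] have "\<beta> j (\<lambda>i. if i < j then b i - a i else 0) \<le> b j - a j"
      unfolding minus_apply .
    moreover have "(\<lambda>i. if i < j then (if i < j then b i else 0) - a i else 0) = (\<lambda>i. if i < j then b i - a i else 0)"
      by auto
    ultimately show "a j + \<beta> j (\<lambda>i. if i < j then (if i < j then b i else 0) - a i else 0) \<le> b j"
      by simp
  qed auto
qed

section \<open>Multiplication of series\<close>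

lemma series_mult_altdef:
  "series_mult f g c = (\<Sum>a | f a \<noteq> 0 \<and> g (c - a) \<noteq> 0. f a * g (c - a))"
  unfolding series_mult_def fun_diff_def ..

lemma series_mult_eq:
  assumes "finite A" "\<And>a. f a \<noteq> 0 \<Longrightarrow> g (c - a) \<noteq> 0 \<Longrightarrow> a \<in> A"
  shows "series_mult f g c = (\<Sum>a\<in>A. f a * g (c - a))"
  unfolding series_mult_altdef by (rule sum.mono_neutral_left) (use assms in auto)

lemma series_mult_nonzero:
  assumes "series_mult f g c \<noteq> 0"
  shows "\<exists>a b. f a \<noteq> 0 \<and> g b \<noteq> 0 \<and> c = a + b"
proof -
  have "{a. f a \<noteq> 0 \<and> g (c - a) \<noteq> 0} \<noteq> {}"
    using assms unfolding series_mult_altdef by (metis sum.empty)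
  then obtain a where "f a \<noteq> 0" "g (c - a) \<noteq> 0" by blast
  thus ?thesis by (intro exI[of _ a] exI[of _ "c - a"]) simp
qed

lemma series_mult_commute:
  fixes f :: "(nat \<Rightarrow> real) \<Rightarrow> 'a::comm_semiring_0"
  shows "series_mult f g = series_mult g f"
proof
  fix c :: "nat \<Rightarrow> real"
  show "series_mult f g c = series_mult g f c"
    unfolding series_mult_altdef
    by (rule sum.reindex_bij_witness[of _ "\<lambda>a. c - a" "\<lambda>a. c - a"]) (auto simp: mult.commute)
qed

text \<open>
  Both sides are the sum of \<open>f a * h b * g (c - a - b)\<close>.  Restricting \<open>a\<close> and \<open>b\<close> to the finite sets of
  indices that can contribute reduces the claim to an exchange of finite sums.  Together with
  commutativity it gives associativity.
\<close>

lemma series_mult_left_commute: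
  fixes f :: "(nat \<Rightarrow> real) \<Rightarrow> 'a::comm_semiring_0"
  assumes "d > 0" "f \<in> iterated_laurent d n" "g \<in> iterated_laurent d n" "h \<in> iterated_laurent d n"
  shows "series_mult h (series_mult f g) = series_mult f (series_mult h g)"
proof
  fix c :: "nat \<Rightarrow> real"
  note ls = assms(2-4)[unfolded iterated_laurent_iff]
  define A where "A = {a \<in> {a. f a \<noteq> 0}. c - a \<in> {b + e | b e. b \<in> {a. h a \<noteq> 0} \<and> e \<in> {a. g a \<noteq> 0}}}"
  define B where "B = {b \<in> {a. h a \<noteq> 0}. c - b \<in> {a + e | a e. a \<in> {a. f a \<noteq> 0} \<and> e \<in> {a. g a \<noteq> 0}}}"
  have fin: "finite A" "finite B"
    unfolding A_def B_def
    by (rule laurent_support_finite[OF assms(1)], rule ls, rule laurent_support_sumset[OF assms(1)], (rule ls)+)+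
  have "series_mult h (series_mult f g) c = (\<Sum>b\<in>B. h b * series_mult f g (c - b))"
    by (rule series_mult_eq[OF fin(2)]) (unfold B_def, use series_mult_nonzero in blast)
  also have "\<dots> = (\<Sum>b\<in>B. \<Sum>a\<in>A. h b * (f a * g (c - b - a)))"
  proof (intro sum.cong refl)
    fix b assume b: "b \<in> B"
    have "series_mult f g (c - b) = (\<Sum>a\<in>A. f a * g (c - b - a))"
    proof (rule series_mult_eq[OF fin(1)])
      fix a assume "f a \<noteq> 0" "g (c - b - a) \<noteq> 0"
      moreover have "c - a = b + (c - b - a)" by (simp add: algebra_simps)
      ultimately show "a \<in> A" using b unfolding A_def B_def by blast
    qed
    thus "h b * series_mult f g (c - b) = (\<Sum>a\<in>A. h b * (f a * g (c - b - a)))"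
      by (simp add: sum_distrib_left)
  qed
  also have "\<dots> = (\<Sum>a\<in>A. \<Sum>b\<in>B. f a * (h b * g (c - a - b)))"
    by (subst sum.swap) (simp add: algebra_simps)
  also have "\<dots> = (\<Sum>a\<in>A. f a * series_mult h g (c - a))"
  proof (intro sum.cong refl)
    fix a assume a: "a \<in> A"
    have "series_mult h g (c - a) = (\<Sum>b\<in>B. h b * g (c - a - b))"
    proof (rule series_mult_eq[OF fin(2)])
      fix b assume "h b \<noteq> 0" "g (c - a - b) \<noteq> 0"
      moreover have "c - b = a + (c - a - b)" by (simp add: algebra_simps)
      ultimately show "b \<in> B" using a unfolding A_def B_def by blast
    qed
    thus "(\<Sum>b\<in>B. f a * (h b * g (c - a - b))) = f a * series_mult h g (c - a)"
      by (simp add: sum_distrib_left)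
  qed
  also have "\<dots> = series_mult f (series_mult h g) c"
    by (rule series_mult_eq[OF fin(1), symmetric]) (unfold A_def, use series_mult_nonzero in blast)
  finally show "series_mult h (series_mult f g) c = series_mult f (series_mult h g) c" .
qed

lemma series_mult_assoc:
  fixes f :: "(nat \<Rightarrow> real) \<Rightarrow> 'a::comm_semiring_0"
  assumes "d > 0" "f \<in> iterated_laurent d n" "g \<in> iterated_laurent d n" "h \<in> iterated_laurent d n"
  shows "series_mult (series_mult f g) h = series_mult f (series_mult g h)"
  using series_mult_left_commute[OF assms] by (simp add: series_mult_commute)

lemma series_mult_add_right:
  fixes f :: "(nat \<Rightarrow> real) \<Rightarrow> 'a::comm_semiring_0"
  assumes "d > 0" "f \<in> iterated_laurent d n" "g \<in> iterated_laurent d n" "h \<in> iterated_laurent d n"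
  shows "series_mult f (\<lambda>a. g a + h a) = (\<lambda>a. series_mult f g a + series_mult f h a)"
proof
  fix c :: "nat \<Rightarrow> real"
  note ls = assms(2-4)[unfolded iterated_laurent_iff]
  define A where "A = {a \<in> {a. f a \<noteq> 0}. c - a \<in> {a. g a \<noteq> 0} \<union> {a. h a \<noteq> 0}}"
  have fin: "finite A" unfolding A_def 
    by (rule laurent_support_finite[OF assms(1)], rule ls, rule laurent_support_Un) (rule ls)+
  have "series_mult f (\<lambda>a. g a + h a) c = (\<Sum>a\<in>A. f a * (g (c - a) + h (c - a)))"
    by (rule series_mult_eq[OF fin]) (auto simp: A_def)
  moreover have "series_mult f g c = (\<Sum>a\<in>A. f a * g (c - a))"
    by (rule series_mult_eq[OF fin]) (auto simp: A_def)
  moreover have "series_mult f h c = (\<Sum>a\<in>A. f a * h (c - a))"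
    by (rule series_mult_eq[OF fin]) (auto simp: A_def)
  ultimately show "series_mult f (\<lambda>a. g a + h a) c = series_mult f g c + series_mult f h c"
    by (simp add: ring_distribs sum.distrib)
qed

lemma series_mult_single:
  fixes f :: "(nat \<Rightarrow> real) \<Rightarrow> 'a::semiring_0"
  shows "series_mult (\<lambda>a. if a = e then x else 0) f c = x * f (c - e)"
  by (subst series_mult_eq[of "{e}"]) (auto split: if_splits)

section \<open>The graded monoid of lattice points of a cone\<close>

definition cone_exponents :: "nat \<Rightarrow> nat \<Rightarrow> (nat \<Rightarrow> real) set \<Rightarrow> (nat \<Rightarrow> real) set" where
  "cone_exponents n d \<Gamma> = \<Gamma> \<inter> exponents n d"

lemma cone_exponents_add:
  "\<Gamma> \<in> cones n \<Longrightarrow> a \<in> cone_exponents n d \<Gamma> \<Longrightarrow> b \<in> cone_exponents n d \<Gamma> \<Longrightarrow> a + b \<in> cone_exponents n d \<Gamma>"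
  unfolding cone_exponents_def using cone_add exponents_add by blast

lemma cone_exponents_0: "\<Gamma> \<in> cones n \<Longrightarrow> 0 \<in> cone_exponents n d \<Gamma>"
  unfolding cone_exponents_def using cone_0 exponents_0 by blast

lemma cone_exponents_laurent_support:
  assumes "\<Gamma> \<in> cones n"
  shows "laurent_support d n (cone_exponents n d \<Gamma>)"
  using laurent_support_translated_cone[OF assms, of d 0]
  by (rule laurent_support_mono) (auto simp: cone_exponents_def)

lemma cone_exponents_finite:
  assumes "d > 0" "\<Gamma> \<in> cones n"
  shows "finite {b \<in> cone_exponents n d \<Gamma>. c - b \<in> cone_exponents n d \<Gamma>}"
  using laurent_support_finite[OF assms(1)] cone_exponents_laurent_support[OF assms(2)] by blast

text \<open>
  In the coordinates that carry \<open>\<Gamma>\<close> to the orthant, the lattice points of \<open>\<Gamma>\<close> form \<open>\<nat>\<^sup>n\<close> up to the factor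
  \<open>d\<close>; \<open>\<sigma>\<close> is the total degree.
\<close>

lemma cone_exponents_grading:
  assumes "d > 0" "\<Gamma> \<in> cones n"
  shows "\<exists>\<sigma>::(nat \<Rightarrow> real) \<Rightarrow> nat. \<forall>a\<in>cone_exponents n d \<Gamma>. (\<sigma> a = 0 \<longrightarrow> a = 0) \<and>
    (\<forall>b\<in>cone_exponents n d \<Gamma>. \<sigma> (a + b) = \<sigma> a + \<sigma> b)"
proof -
  obtain \<Phi> where \<Phi>: "\<Phi> \<in> blow_down_compositions n" "\<Gamma> = \<Phi> ` nonneg_orthant n"
    using assms(2) by (rule coneE)
  define \<sigma> where "\<sigma> a = nat \<lfloor>\<Sum>i<n. real d * inv_into UNIV \<Phi> a i\<rfloor>" for a
  have inv: "inv_into UNIV \<Phi> (\<Phi> y) = y" for y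
    using compositions_bij[OF \<Phi>(1)] by (simp add: bij_is_inj)
  have \<sigma>: "real (\<sigma> (\<Phi> y)) = (\<Sum>i<n. real d * y i)" if y: "y \<in> nonneg_orthant n" "\<Phi> y \<in> exponents n d" for y
  proof -
    have "y \<in> exponents n d" using y compositions_exponents_iff[OF \<Phi>(1)] by simp
    hence "(\<Sum>i<n. real d * y i) \<in> \<int>" by (intro Ints_sum exponentsD(1))
    then obtain z where z: "(\<Sum>i<n. real d * y i) = of_int z" by (rule Ints_cases)
    have "0 \<le> (\<Sum>i<n. real d * y i)" using y(1)
      by (intro sum_nonneg) (auto simp: nonneg_orthant_def)
    hence "0 \<le> z" unfolding z by simp
    thus ?thesis unfolding \<sigma>_def inv z by simp
  qed
  have zero: "\<sigma> (\<Phi> y) = 0 \<longrightarrow> \<Phi> y = 0" if y: "y \<in> nonneg_orthant n" "\<Phi> y \<in> exponents n d" for y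
  proof
    assume "\<sigma> (\<Phi> y) = 0"
    hence "(\<Sum>i<n. real d * y i) = 0" using \<sigma>[OF y] by simp
    hence "\<forall>i\<in>{..<n}. real d * y i = 0"
      using y(1) by (subst (asm) sum_nonneg_eq_0_iff) (auto simp: nonneg_orthant_def)
    hence "y i = 0" for i using assms(1) y(1) by (cases "i < n") (auto simp: nonneg_orthant_def)
    hence "y = 0" by (simp add: fun_eq_iff)
    thus "\<Phi> y = 0" using compositions_0[OF \<Phi>(1)] by simp
  qed
  have add: "\<sigma> (\<Phi> y + \<Phi> z) = \<sigma> (\<Phi> y) + \<sigma> (\<Phi> z)"
    if "y \<in> nonneg_orthant n" "\<Phi> y \<in> exponents n d" "z \<in> nonneg_orthant n" "\<Phi> z \<in> exponents n d" for y z
  proof -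
    have yz: "y + z \<in> nonneg_orthant n" using that(1,3) by (auto simp: nonneg_orthant_def)
    have "\<Phi> (y + z) \<in> exponents n d"
      unfolding compositions_add[OF \<Phi>(1)] by (rule exponents_add[OF that(2,4)])
    from \<sigma>[OF yz this] have "real (\<sigma> (\<Phi> y + \<Phi> z)) = (\<Sum>i<n. real d * y i + real d * z i)"
      unfolding compositions_add[OF \<Phi>(1)] by (simp add: ring_distribs)
    also have "\<dots> = real (\<sigma> (\<Phi> y) + \<sigma> (\<Phi> z))"
      unfolding sum.distrib \<sigma>[OF that(1,2), symmetric] \<sigma>[OF that(3,4), symmetric]
      by simp
    finally show ?thesis by (simp only: of_nat_eq_iff)
  qed
  show ?thesis
  proof (intro exI[of _ \<sigma>] ballI conjI)
    fix a assume "a \<in> cone_exponents n d \<Gamma>"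
    then obtain y where y: "a = \<Phi> y" "y \<in> nonneg_orthant n" "\<Phi> y \<in> exponents n d"
      unfolding cone_exponents_def \<Phi>(2) by auto
    show "\<sigma> a = 0 \<longrightarrow> a = 0" unfolding y(1) by (rule zero[OF y(2,3)])
    fix b assume "b \<in> cone_exponents n d \<Gamma>"
    then obtain z where z: "b = \<Phi> z" "z \<in> nonneg_orthant n" "\<Phi> z \<in> exponents n d"
      unfolding cone_exponents_def \<Phi>(2) by auto
    show "\<sigma> (a + b) = \<sigma> a + \<sigma> b" unfolding y(1) z(1)
      by (rule add[OF y(2,3) z(2,3)])
  qed
qed

text \<open>
  A function on exponents may be defined by conditions in which its value at \<open>x\<close> depends on the values
  at proper divisors of \<open>x\<close>, that is on \<open>b\<close> with both \<open>b\<close> and \<open>x - b\<close> in the monoid: the total degree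
  decreases.  Inverses of units and lifted factors of polynomials are constructed this way.
\<close>

lemma cone_exponents_recursion:
  fixes P :: "((nat \<Rightarrow> real) \<Rightarrow> 'b) \<Rightarrow> (nat \<Rightarrow> real) \<Rightarrow> 'b \<Rightarrow> bool"
  assumes "d > 0" "\<Gamma> \<in> cones n"
  defines "M \<equiv> cone_exponents n d \<Gamma>"
  assumes adm: "\<And>f g x r. (\<And>b. b \<in> M \<Longrightarrow> x - b \<in> M \<Longrightarrow> b \<noteq> x \<Longrightarrow> f b = g b) \<Longrightarrow> P f x r = P g x r"
    and ex: "\<And>x f. (\<And>b. b \<in> M \<Longrightarrow> x - b \<in> M \<Longrightarrow> b \<noteq> x \<Longrightarrow> P f b (f b)) \<Longrightarrow> \<exists>r. P f x r"
  shows "\<exists>f. \<forall>x. P f x (f x)"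
proof -
  obtain \<sigma> :: "(nat \<Rightarrow> real) \<Rightarrow> nat"
    where grading: "\<forall>a\<in>M. (\<sigma> a = 0 \<longrightarrow> a = 0) \<and> (\<forall>b\<in>M. \<sigma> (a + b) = \<sigma> a + \<sigma> b)"
    using cone_exponents_grading[OF assms(1,2), folded M_def] by (rule exE)
  have \<sigma>: "\<And>a. a \<in> M \<Longrightarrow> \<sigma> a = 0 \<Longrightarrow> a = 0"
      "\<And>a b. a \<in> M \<Longrightarrow> b \<in> M \<Longrightarrow> \<sigma> (a + b) = \<sigma> a + \<sigma> b"
    using grading by simp_all
  define R where "R = {(b, x). b \<in> M \<and> x - b \<in> M \<and> b \<noteq> x}"
  have "R \<subseteq> measure \<sigma>"
  proof clarify
    fix b x assume "(b, x) \<in> R"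
    hence b: "b \<in> M" "x - b \<in> M" "b \<noteq> x" by (auto simp: R_def)
    have "\<sigma> x = \<sigma> b + \<sigma> (x - b)" using \<sigma>(2)[OF b(1,2)] by simp
    moreover have "\<sigma> (x - b) \<noteq> 0" using \<sigma>(1)[OF b(2)] b(3) by auto
    ultimately show "(b, x) \<in> measure \<sigma>" by simp
  qed
  hence "wf R" by (rule wf_subset[OF wf_measure])
  thus ?thesis
  proof (rule dependent_wf_choice)
    fix f g :: "(nat \<Rightarrow> real) \<Rightarrow> 'b" and x r
    assume "\<And>z. (z, x) \<in> R \<Longrightarrow> f z = g z"
    thus "P f x r = P g x r" by (intro adm) (auto simp: R_def)
  next
    fix x f assume "\<And>y. (y, x) \<in> R \<Longrightarrow> P f y (f y)"
    thus "\<exists>r. P f x r" by (intro ex) (auto simp: R_def)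
  qed
qed

section \<open>Translates of cone series and their inverses\<close>

text \<open>
  The sets \<open>x\<^sup>a k[[\<Gamma>, d]]\<close> for all \<open>d\<close>, \<open>\<Gamma>\<close> and \<open>a\<close>.  Their union is \<open>k((x))\<^sup>*\<close>, as inverses of nonzero elements
  have the same form.
\<close>

definition cone_laurent :: "nat \<Rightarrow> ((nat \<Rightarrow> real) \<Rightarrow> 'k::zero) set" where
  "cone_laurent n = {f. \<exists>d>0. \<exists>\<Gamma>\<in>cones n. \<exists>a\<in>exponents n d.
     \<forall>b. f b \<noteq> 0 \<longrightarrow> b \<in> exponents n d \<and> b - a \<in> \<Gamma>}"

lemma cone_laurentI:
  assumes "d > 0" "\<Gamma> \<in> cones n" "a \<in> exponents n d"
    "\<And>b. f b \<noteq> 0 \<Longrightarrow> b \<in> exponents n d" "\<And>b. f b \<noteq> 0 \<Longrightarrow> b - a \<in> \<Gamma>"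
  shows "f \<in> cone_laurent n"
  unfolding cone_laurent_def using assms by blast

lemma cone_laurentE:
  assumes "f \<in> cone_laurent n"
  obtains d \<Gamma> a where "d > 0" "\<Gamma> \<in> cones n" "a \<in> exponents n d"
    "\<And>b. f b \<noteq> 0 \<Longrightarrow> b \<in> exponents n d" "\<And>b. f b \<noteq> 0 \<Longrightarrow> b - a \<in> \<Gamma>"
  using assms unfolding cone_laurent_def by blast

lemma cone_laurent_0: "(\<lambda>_. 0) \<in> cone_laurent n"
  by (rule cone_laurentI[of 1, OF _ orthant_in_cones exponents_0]) auto

lemma cone_laurent_iterated:
  assumes "f \<in> cone_laurent n"
  shows "\<exists>d>0. f \<in> iterated_laurent d n"
proof -
  obtain d \<Gamma> a where *: "d > 0" "\<Gamma> \<in> cones n" "a \<in> exponents n d"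
    "\<And>b. f b \<noteq> 0 \<Longrightarrow> b \<in> exponents n d" "\<And>b. f b \<noteq> 0 \<Longrightarrow> b - a \<in> \<Gamma>"
    using assms by (rule cone_laurentE) blast
  have "f \<in> iterated_laurent d n"
    unfolding iterated_laurent_iff
    using laurent_support_translated_cone[OF *(2), of d a]
    by (rule laurent_support_mono) (use * in blast)
  thus ?thesis using *(1) by blast
qed

lemma cone_laurent_mono:
  assumes "f \<in> cone_laurent n" "n \<le> n'"
  shows "f \<in> cone_laurent n'"
proof -
  obtain d \<Gamma> a where *: "d > 0" "\<Gamma> \<in> cones n" "a \<in> exponents n d"
    "\<And>b. f b \<noteq> 0 \<Longrightarrow> b \<in> exponents n d" "\<And>b. f b \<noteq> 0 \<Longrightarrow> b - a \<in> \<Gamma>"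
    using assms(1) by (rule cone_laurentE) blast
  obtain \<Gamma>' where "\<Gamma>' \<in> cones n'" "\<Gamma> \<subseteq> \<Gamma>'"
    using cones_mono[OF *(2) assms(2)] by blast
  thus ?thesis
    using * exponents_mono[OF assms(2), of d d] by (intro cone_laurentI[of d \<Gamma>' n' a]) auto
qed

lemma cone_laurent_common2:
  assumes "f \<in> cone_laurent n" "g \<in> cone_laurent n"
  obtains d \<Gamma> a b
    where "d > 0" "\<Gamma> \<in> cones n" "a \<in> exponents n d" "b \<in> exponents n d"
    "\<And>c. f c \<noteq> 0 \<Longrightarrow> c \<in> exponents n d \<and> c - a \<in> \<Gamma>"
    "\<And>c. g c \<noteq> 0 \<Longrightarrow> c \<in> exponents n d \<and> c - b \<in> \<Gamma>"
proof -
  obtain d1 \<Gamma>1 a1 where 1: "d1 > 0" "\<Gamma>1 \<in> cones n" "a1 \<in> exponents n d1"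
    "\<And>b. f b \<noteq> 0 \<Longrightarrow> b \<in> exponents n d1" "\<And>b. f b \<noteq> 0 \<Longrightarrow> b - a1 \<in> \<Gamma>1"
    using assms(1) by (rule cone_laurentE) blast
  obtain d2 \<Gamma>2 a2 where 2: "d2 > 0" "\<Gamma>2 \<in> cones n" "a2 \<in> exponents n d2"
    "\<And>b. g b \<noteq> 0 \<Longrightarrow> b \<in> exponents n d2" "\<And>b. g b \<noteq> 0 \<Longrightarrow> b - a2 \<in> \<Gamma>2"
    using assms(2) by (rule cone_laurentE) blast
  obtain \<Gamma> where "\<Gamma> \<in> cones n" "\<Gamma>1 \<subseteq> \<Gamma>" "\<Gamma>2 \<subseteq> \<Gamma>"
    using cones_directed[OF 1(2) 2(2)] by blast
  moreover have "exponents n d1 \<subseteq> exponents n (d1 * d2)" "exponents n d2 \<subseteq> exponents n (d1 * d2)"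
    by (rule exponents_mono; simp)+
  moreover have "d1 * d2 > 0" using 1(1) 2(1) by simp
  ultimately show ?thesis using 1(3-5) 2(3-5) by (intro that[of "d1 * d2" \<Gamma> a1 a2]) blast+
qed

lemma cone_laurent_mult:
  assumes "f \<in> cone_laurent n" "g \<in> cone_laurent n"
  shows "series_mult f g \<in> cone_laurent n"
proof -
  obtain d \<Gamma> a b
    where *: "d > 0" "\<Gamma> \<in> cones n" "a \<in> exponents n d" "b \<in> exponents n d"
    "\<And>c. f c \<noteq> 0 \<Longrightarrow> c \<in> exponents n d \<and> c - a \<in> \<Gamma>"
    "\<And>c. g c \<noteq> 0 \<Longrightarrow> c \<in> exponents n d \<and> c - b \<in> \<Gamma>"
    using assms by (rule cone_laurent_common2) blast
  have "c \<in> exponents n d \<and> c - (a + b) \<in> \<Gamma>" if c: "series_mult f g c \<noteq> 0" for c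
  proof -
    obtain x y where xy: "f x \<noteq> 0" "g y \<noteq> 0" "c = x + y"
      using series_mult_nonzero[OF c] by blast
    have "c - (a + b) = (x - a) + (y - b)" using xy(3) by (simp add: algebra_simps)
    moreover have "(x - a) + (y - b) \<in> \<Gamma>" using *(5)[OF xy(1)] *(6)[OF xy(2)]
      by (intro cone_add[OF *(2)]) auto
    moreover have "c \<in> exponents n d" unfolding xy(3) using *(5)[OF xy(1)] *(6)[OF xy(2)]
      by (intro exponents_add) auto
    ultimately show ?thesis by (simp only:)
  qed
  thus ?thesis using * exponents_add by (intro cone_laurentI[of d \<Gamma> n "a + b"]) auto
qed

text \<open>
  Both summands are rewritten relative to the smaller of the two base points \<open>a\<close> and \<open>b\<close>.
\<close>

lemma cone_laurent_add:
  fixes f :: "(nat \<Rightarrow> real) \<Rightarrow> 'k::monoid_add"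
  assumes "f \<in> cone_laurent n" "g \<in> cone_laurent n"
  shows "(\<lambda>a. f a + g a) \<in> cone_laurent n"
proof -
  obtain d \<Gamma> a b
    where *: "d > 0" "\<Gamma> \<in> cones n" "a \<in> exponents n d" "b \<in> exponents n d"
    "\<And>c. f c \<noteq> 0 \<Longrightarrow> c \<in> exponents n d \<and> c - a \<in> \<Gamma>"
    "\<And>c. g c \<noteq> 0 \<Longrightarrow> c \<in> exponents n d \<and> c - b \<in> \<Gamma>"
    using assms by (rule cone_laurent_common2) blast
  define m where "m = (if lex_nonneg (b - a) then a else b)"
  have m: "m \<in> exponents n d" "lex_nonneg (a - m)" "lex_nonneg (b - m)"
    using lex_nonneg_total[of "b - a"] *(3,4) by (auto simp: m_def)
  have "\<exists>\<Delta>\<in>cones n. {a - m, b - m} \<subseteq> \<Delta>"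
    by (rule finite_lex_nonneg_subset_cone[OF *(1)]) (use m *(3,4) exponents_diff in auto)
  then obtain \<Delta>
    where \<Delta>: "\<Delta> \<in> cones n" "a - m \<in> \<Delta>" "b - m \<in> \<Delta>" by auto
  obtain \<Lambda> where \<Lambda>: "\<Lambda> \<in> cones n" "\<Gamma> \<subseteq> \<Lambda>" "\<Delta> \<subseteq> \<Lambda>"
    using cones_directed[OF *(2) \<Delta>(1)] by blast
  have "c \<in> exponents n d \<and> c - m \<in> \<Lambda>" if "f c + g c \<noteq> 0" for c
  proof -
    have "f c \<noteq> 0 \<or> g c \<noteq> 0" using that by auto
    hence c: "c \<in> exponents n d" "c - a \<in> \<Lambda> \<or> c - b \<in> \<Lambda>"
      using *(5,6) \<Lambda> by blast+
    have m\<Lambda>: "a - m \<in> \<Lambda>" "b - m \<in> \<Lambda>" using \<Delta> \<Lambda>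
      by blast+
    have eqs: "(c - a) + (a - m) = c - m" "(c - b) + (b - m) = c - m" by simp_all
    have "c - m \<in> \<Lambda>"
      using c(2) cone_add[OF \<Lambda>(1) _ m\<Lambda>(1), of "c - a"] cone_add[OF \<Lambda>(1) _ m\<Lambda>(2), of "c - b"]
      unfolding eqs by blast
    thus ?thesis using c(1) by blast
  qed
  thus ?thesis using * \<Lambda> m by (intro cone_laurentI[of d \<Lambda> n m]) auto
qed

lemma cone_laurent_subset_support:
  assumes "f \<in> cone_laurent n" "\<And>a. g a \<noteq> 0 \<Longrightarrow> f a \<noteq> 0"
  shows "g \<in> cone_laurent n"
  using assms unfolding cone_laurent_def by blast

lemma cone_laurent_monomial:
  assumes "d > 0" "e \<in> exponents n d"
  shows "(\<lambda>a. if a = e then x else 0) \<in> cone_laurent n"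
  by (rule cone_laurentI[OF assms(1) orthant_in_cones assms(2)])
     (use assms(2) cone_0[OF orthant_in_cones] in \<open>auto split: if_splits\<close>)

text \<open>
  The valuation ring of \<open>k((x))\<^sup>*\<close> is the union of the rings \<open>k[[\<Gamma>, d]]\<close>.
\<close>

lemma cone_laurent_lex_nonneg:
  assumes "f \<in> cone_laurent n" "\<And>a. f a \<noteq> 0 \<Longrightarrow> lex_nonneg a"
  obtains d \<Gamma> where "d > 0" "\<Gamma> \<in> cones n" "\<And>a. f a \<noteq> 0 \<Longrightarrow> a \<in> cone_exponents n d \<Gamma>"
proof -
  obtain d \<Gamma> a where *: "d > 0" "\<Gamma> \<in> cones n" "a \<in> exponents n d"
    "\<And>b. f b \<noteq> 0 \<Longrightarrow> b \<in> exponents n d" "\<And>b. f b \<noteq> 0 \<Longrightarrow> b - a \<in> \<Gamma>"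
    using assms(1) by (rule cone_laurentE) blast
  have "\<exists>\<Delta>\<in>cones n. \<forall>b\<in>{b. f b \<noteq> 0}. b - 0 \<in> \<Delta>"
    by (rule cone_absorbs_translate[OF *(1,2) _ *(3) exponents_0]) (use * assms(2) in auto)
  then obtain \<Delta>
    where \<Delta>: "\<Delta> \<in> cones n" "\<And>b. f b \<noteq> 0 \<Longrightarrow> b - 0 \<in> \<Delta>"
      by blast
  have "b \<in> cone_exponents n d \<Delta>" if "f b \<noteq> 0" for b
    using \<Delta>(2)[OF that] *(4)[OF that] unfolding cone_exponents_def by simp
  thus ?thesis by (rule that[OF *(1) \<Delta>(1)])
qed

lemma cone_laurent_lex_least:
  assumes "f \<in> cone_laurent n" "f a \<noteq> 0"
  obtains c where "f c \<noteq> 0" "\<And>b. f b \<noteq> 0 \<Longrightarrow> lex_nonneg (b - c)"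
proof -
  obtain d where "d > 0" "f \<in> iterated_laurent d n" using cone_laurent_iterated[OF assms(1)]
    by blast
  thus ?thesis using laurent_support_lex_least[of d n "{a. f a \<noteq> 0}"] assms(2) that
    unfolding iterated_laurent_iff by blast
qed

lemma cone_laurent_translate:
  assumes "f \<in> cone_laurent n" "d > 0" "e \<in> exponents n d"
  shows "(\<lambda>a. f (a + e)) \<in> cone_laurent n"
proof -
  have "series_mult (\<lambda>a. if a = - e then 1 else 0 :: int) (\<lambda>a. if f a = 0 then 0 else 1) \<in> cone_laurent n"
    using assms exponents_uminus
    by (intro cone_laurent_mult cone_laurent_monomial[of d] cone_laurent_subset_support[OF assms(1)]) (auto split: if_splits)
  thus ?thesis by (rule cone_laurent_subset_support) (simp add: series_mult_single)
qed

text \<open>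
  The equation \<open>u v = 1\<close> determines the coefficients of \<open>v\<close> recursively, since \<open>u 0\<close> is invertible.
\<close>

lemma cone_unit_inverse:
  fixes u :: "(nat \<Rightarrow> real) \<Rightarrow> 'k::field"
  assumes "d > 0" "\<Gamma> \<in> cones n" "\<And>a. u a \<noteq> 0 \<Longrightarrow> a \<in> cone_exponents n d \<Gamma>" "u 0 \<noteq> 0"
  shows "\<exists>v. (\<forall>a. v a \<noteq> 0 \<longrightarrow> a \<in> cone_exponents n d \<Gamma>) \<and> series_mult u v = (\<lambda>a. if a = 0 then 1 else 0)"
proof -
  define M where "M = cone_exponents n d \<Gamma>"
  define D where "D x = {b \<in> M. x - b \<in> M}" for x
  have fin: "finite (D x)" for x unfolding D_def M_def
    by (rule cone_exponents_finite[OF assms(1,2)])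
  have M0: "0 \<in> M" unfolding M_def by (rule cone_exponents_0[OF assms(2)])
  define P where "P v x r \<longleftrightarrow> r = (if x \<in> M then
     ((if x = 0 then 1 else 0) - (\<Sum>b\<in>D x - {0}. u b * v (x - b))) / u 0 else 0)" for v x and r :: 'k
  have "\<exists>v. \<forall>x. P v x (v x)"
  proof (rule cone_exponents_recursion[OF assms(1,2), folded M_def])
    fix f g :: "(nat \<Rightarrow> real) \<Rightarrow> 'k" and x r
    assume eq: "\<And>b. b \<in> M \<Longrightarrow> x - b \<in> M \<Longrightarrow> b \<noteq> x \<Longrightarrow> f b = g b"
    have "(\<Sum>b\<in>D x - {0}. u b * f (x - b)) = (\<Sum>b\<in>D x - {0}. u b * g (x - b))"
      by (rule sum.cong[OF refl]) (auto simp: D_def eq)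
    thus "P f x r = P g x r" unfolding P_def by presburger
  qed (auto simp: P_def)
  then obtain v where v: "\<And>x. P v x (v x)" by blast
  have vM: "v a \<noteq> 0 \<Longrightarrow> a \<in> M" for a using v[of a] unfolding P_def
    by presburger
  have "series_mult u v x = (if x = 0 then 1 else 0)" for x
  proof -
    have eq: "series_mult u v x = (\<Sum>b\<in>D x. u b * v (x - b))"
      using fin by (rule series_mult_eq) (use vM assms(3) in \<open>auto simp: D_def M_def\<close>)
    show ?thesis
    proof (cases "x \<in> M")
      case True
      have split: "(\<Sum>b\<in>D x. u b * v (x - b)) = u 0 * v x + (\<Sum>b\<in>D x - {0}. u b * v (x - b))"
        using sum.remove[OF fin, of 0 x "\<lambda>b. u b * v (x - b)"] True M0 by (simp add: D_def)
      have "u 0 * v x = (if x = 0 then 1 else 0) - (\<Sum>b\<in>D x - {0}. u b * v (x - b))"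
        using v[of x] True assms(4) unfolding P_def by simp
      thus ?thesis unfolding eq split by simp
    next
      case False
      have "D x = {}"
      proof (rule ccontr)
        assume "D x \<noteq> {}"
        then obtain b where "b \<in> M" "x - b \<in> M" unfolding D_def by blast
        hence "b + (x - b) \<in> M" unfolding M_def by (intro cone_exponents_add[OF assms(2)])
        thus False using False by simp
      qed
      thus ?thesis using eq False M0 by auto
    qed
  qed
  thus ?thesis using vM unfolding M_def by blast
qed

text \<open>
  After division by \<open>x\<^sup>c\<close>, where \<open>c\<close> is the least exponent, the series is a unit of a cone ring.
\<close>

lemma cone_laurent_inverse:
  fixes f :: "(nat \<Rightarrow> real) \<Rightarrow> 'k::field"
  assumes "f \<in> cone_laurent n" "f \<noteq> (\<lambda>_. 0)"
  shows "\<exists>g\<in>cone_laurent n. series_mult f g = (\<lambda>a. if a = 0 then 1 else 0)"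
proof -
  obtain a0 where "f a0 \<noteq> 0" using assms(2) by blast
  then obtain c where c: "f c \<noteq> 0" "\<And>b. f b \<noteq> 0 \<Longrightarrow> lex_nonneg (b - c)"
    using cone_laurent_lex_least[OF assms(1)] by blast
  obtain d0 \<Gamma>0 a where *: "d0 > 0" "\<Gamma>0 \<in> cones n" "a \<in> exponents n d0"
    "\<And>b. f b \<noteq> 0 \<Longrightarrow> b \<in> exponents n d0" "\<And>b. f b \<noteq> 0 \<Longrightarrow> b - a \<in> \<Gamma>0"
    using assms(1) by (rule cone_laurentE) blast
  note ce = *(4)[OF c(1)]
  define u where "u = (\<lambda>b. f (b + c))"
  have u: "u \<in> cone_laurent n" unfolding u_def using assms(1) *(1) ce
    by (rule cone_laurent_translate)
  have ul: "lex_nonneg b" if "u b \<noteq> 0" for b using c(2)[of "b + c"] that by (simp add: u_def)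
  obtain d \<Gamma> where d: "d > 0" "\<Gamma> \<in> cones n" "\<And>a. u a \<noteq> 0 \<Longrightarrow> a \<in> cone_exponents n d \<Gamma>"
    using cone_laurent_lex_nonneg[OF u ul] by blast
  have "u 0 \<noteq> 0" using c(1) by (simp add: u_def)
  with d have "\<exists>v. (\<forall>a. v a \<noteq> 0 \<longrightarrow> a \<in> cone_exponents n d \<Gamma>) \<and> series_mult u v = (\<lambda>a. if a = 0 then 1 else 0)"
    by (intro cone_unit_inverse)
  then obtain v where v: "\<And>a. v a \<noteq> 0 \<Longrightarrow> a \<in> cone_exponents n d \<Gamma>"
    "series_mult u v = (\<lambda>a. if a = 0 then 1 else 0)" by blast
  have "v \<in> cone_laurent n"
    by (rule cone_laurentI[OF d(1,2) exponents_0]) (use v(1) in \<open>auto simp: cone_exponents_def\<close>)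
  hence g: "(\<lambda>a. v (a + c)) \<in> cone_laurent n" using *(1) ce
    by (rule cone_laurent_translate)
  have "series_mult f (\<lambda>a. v (a + c)) x = series_mult u v x" for x
    unfolding series_mult_altdef u_def
    by (rule sum.reindex_bij_witness[of _ "\<lambda>b. b + c" "\<lambda>b. b - c"]) (auto simp: algebra_simps)
  thus ?thesis using g v(2) by (intro bexI[of _ "\<lambda>a. v (a + c)"]) auto
qed

lemma cone_laurent_union_common:
  assumes "f \<in> (\<Union>n. cone_laurent n)" "g \<in> (\<Union>n. cone_laurent n)"
  shows "\<exists>n. f \<in> cone_laurent n \<and> g \<in> cone_laurent n"
proof -
  obtain m n where "f \<in> cone_laurent m" "g \<in> cone_laurent n" using assms by blast
  thus ?thesis using cone_laurent_mono[of f m "max m n"] cone_laurent_mono[of g n "max m n"] by auto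
qed

text \<open>
  Every two of the fields \<open>K\<^sub>n\<^sub>,\<^sub>d\<close>, of equal or different dimensions, lie in a third one.
\<close>

lemma iterated_laurent_common:
  assumes "d > 0" "e > 0"
  shows "\<exists>r>0. \<exists>l. iterated_laurent d m \<subseteq> (iterated_laurent r l :: ((nat \<Rightarrow> real) \<Rightarrow> 'k::zero) set) \<and>
    iterated_laurent e n \<subseteq> (iterated_laurent r l :: ((nat \<Rightarrow> real) \<Rightarrow> 'k::zero) set)"
proof (rule exI[of _ "d * e"], rule conjI, rule_tac [2] exI[of _ "max m n"], rule_tac [2] conjI)
  show "d * e > 0" using assms by simp
  show "iterated_laurent d m \<subseteq> (iterated_laurent (d * e) (max m n) :: ((nat \<Rightarrow> real) \<Rightarrow> 'k::zero) set)"
    using laurent_support_mult laurent_support_mono_dim[of _ m _ "max m n"]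
    by (auto simp: iterated_laurent_iff)
  show "iterated_laurent e n \<subseteq> (iterated_laurent (d * e) (max m n) :: ((nat \<Rightarrow> real) \<Rightarrow> 'k::zero) set)"
    using laurent_support_mult[of e _ _ d] laurent_support_mono_dim[of _ n _ "max m n"]
    by (auto simp: iterated_laurent_iff mult.commute)
qed

lemma cone_laurent_common3:
  fixes f g h :: "(nat \<Rightarrow> real) \<Rightarrow> 'k::zero"
  assumes "f \<in> (\<Union>n. cone_laurent n)" "g \<in> (\<Union>n. cone_laurent n)" "h \<in> (\<Union>n. cone_laurent n)"
  shows "\<exists>d>0. \<exists>n. f \<in> iterated_laurent d n \<and> g \<in> iterated_laurent d n \<and> h \<in> iterated_laurent d n"
proof -
  obtain l m n where lmn: "f \<in> cone_laurent l" "g \<in> cone_laurent m" "h \<in> cone_laurent n"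
    using assms by blast
  obtain a where a: "a > 0" "f \<in> iterated_laurent a l" using cone_laurent_iterated[OF lmn(1)]
    by blast
  obtain b where b: "b > 0" "g \<in> iterated_laurent b m" using cone_laurent_iterated[OF lmn(2)]
    by blast
  obtain c where c: "c > 0" "h \<in> iterated_laurent c n" using cone_laurent_iterated[OF lmn(3)]
    by blast
  obtain r s where r: "r > 0" "f \<in> iterated_laurent r s" "g \<in> iterated_laurent r s"
    using iterated_laurent_common[OF a(1) b(1), of l m, where ?'k = 'k] a b by blast
  show ?thesis using iterated_laurent_common[OF r(1) c(1), of s n, where ?'k = 'k] r c by blast
qed

section \<open>The field of all such series\<close>

text \<open>
  Series of all dimensions together form a single field, so that polynomials over it are available as
  a type.  The dimension \<open>n\<close> reappears as a subfield.
\<close>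

typedef (overloaded) 'k cone_quot = "\<Union>n. cone_laurent n :: ((nat \<Rightarrow> real) \<Rightarrow> 'k::zero) set"
  morphisms coefs Abs_cone_quot
  by (rule exI, rule UN_I[of 0], rule UNIV_I, rule cone_laurent_0)

setup_lifting type_definition_cone_quot

instantiation cone_quot :: (field) comm_ring_1
begin

lift_definition zero_cone_quot :: "'a cone_quot" is "\<lambda>_. 0"
  by (rule UN_I[of 0], rule UNIV_I, rule cone_laurent_0)

lift_definition one_cone_quot :: "'a cone_quot" is "\<lambda>a. if a = 0 then 1 else 0"
  by (rule UN_I[of 0], rule UNIV_I, rule cone_laurent_monomial[OF zero_less_one exponents_0])

lift_definition plus_cone_quot :: "'a cone_quot \<Rightarrow> 'a cone_quot \<Rightarrow> 'a cone_quot" is "\<lambda>f g a. f a + g a"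
proof -
  fix f g :: "(nat \<Rightarrow> real) \<Rightarrow> 'a"
  assume "f \<in> \<Union> (range cone_laurent)" "g \<in> \<Union> (range cone_laurent)"
  then obtain n where "f \<in> cone_laurent n" "g \<in> cone_laurent n"
    using cone_laurent_union_common by blast
  hence "(\<lambda>a. f a + g a) \<in> cone_laurent n" by (rule cone_laurent_add)
  thus "(\<lambda>a. f a + g a) \<in> \<Union> (range cone_laurent)" by (rule UN_I[OF UNIV_I])
qed

lift_definition uminus_cone_quot :: "'a cone_quot \<Rightarrow> 'a cone_quot" is "\<lambda>f a. - f a"
proof -
  fix f :: "(nat \<Rightarrow> real) \<Rightarrow> 'a" assume "f \<in> \<Union> (range cone_laurent)"
  then obtain n where "f \<in> cone_laurent n" by blast
  hence "(\<lambda>a. - f a) \<in> cone_laurent n" by (rule cone_laurent_subset_support) simp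
  thus "(\<lambda>a. - f a) \<in> \<Union> (range cone_laurent)" by (rule UN_I[OF UNIV_I])
qed

lift_definition times_cone_quot :: "'a cone_quot \<Rightarrow> 'a cone_quot \<Rightarrow> 'a cone_quot" is series_mult
proof -
  fix f g :: "(nat \<Rightarrow> real) \<Rightarrow> 'a"
  assume "f \<in> \<Union> (range cone_laurent)" "g \<in> \<Union> (range cone_laurent)"
  then obtain n where "f \<in> cone_laurent n" "g \<in> cone_laurent n"
    using cone_laurent_union_common by blast
  hence "series_mult f g \<in> cone_laurent n" by (rule cone_laurent_mult)
  thus "series_mult f g \<in> \<Union> (range cone_laurent)" by (rule UN_I[OF UNIV_I])
qed

definition minus_cone_quot :: "'a cone_quot \<Rightarrow> 'a cone_quot \<Rightarrow> 'a cone_quot" where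
  "minus_cone_quot f g = f + - g"

instance
proof
  fix a b c :: "'a cone_quot"
  show "a * b * c = a * (b * c)"
  proof transfer
    fix f g h :: "(nat \<Rightarrow> real) \<Rightarrow> 'a"
    assume "f \<in> \<Union> (range cone_laurent)" "g \<in> \<Union> (range cone_laurent)" "h \<in> \<Union> (range cone_laurent)"
    from cone_laurent_common3[OF this]
    show "series_mult (series_mult f g) h = series_mult f (series_mult g h)"
      using series_mult_assoc by blast
  qed
  show "(a + b) * c = a * c + b * c"
  proof transfer
    fix f g h :: "(nat \<Rightarrow> real) \<Rightarrow> 'a"
    assume "f \<in> \<Union> (range cone_laurent)" "g \<in> \<Union> (range cone_laurent)" "h \<in> \<Union> (range cone_laurent)"
    from cone_laurent_common3[OF this]
    have "series_mult h (\<lambda>a. f a + g a) = (\<lambda>a. series_mult h f a + series_mult h g a)"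
      using series_mult_add_right by blast
    thus "series_mult (\<lambda>a. f a + g a) h = (\<lambda>a. series_mult f h a + series_mult g h a)"
      by (simp add: series_mult_commute)
  qed
  show "a * b = b * a" by transfer (rule series_mult_commute)
  show "1 * a = a" by transfer (rule ext, simp add: series_mult_single)
  show "(0 :: 'a cone_quot) \<noteq> 1" by transfer (auto dest!: fun_cong[where x = 0])
  show "a + b + c = a + (b + c)" by transfer (simp add: add.assoc)
  show "a + b = b + a" by transfer (simp add: add.commute)
  show "0 + a = a" by transfer simp
  show "- a + a = 0" by transfer simp
  show "a - b = a + - b" by (rule minus_cone_quot_def)
qed

end

instantiation cone_quot :: (field) field
begin

definition inverse_cone_quot :: "'a cone_quot \<Rightarrow> 'a cone_quot" where
  "inverse_cone_quot f = (if f = 0 then 0 else (SOME g. f * g = 1))"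

definition divide_cone_quot :: "'a cone_quot \<Rightarrow> 'a cone_quot \<Rightarrow> 'a cone_quot" where
  "divide_cone_quot f g = f * inverse g"

instance
proof
  fix a b :: "'a cone_quot"
  show "a div b = a * inverse b" by (rule divide_cone_quot_def)
  show "inverse (0 :: 'a cone_quot) = 0" by (simp add: inverse_cone_quot_def)
  assume "a \<noteq> 0"
  moreover have "\<exists>g. a * g = 1" if "a \<noteq> 0"
  proof -
    obtain n where n: "coefs a \<in> cone_laurent n" using coefs[of a] by blast
    have "coefs a \<noteq> (\<lambda>_. 0)" using that by transfer
    then obtain g where g: "g \<in> cone_laurent n" "series_mult (coefs a) g = (\<lambda>a. if a = 0 then 1 else 0)"
      using cone_laurent_inverse[OF n] by blast
    have "g \<in> \<Union> (range cone_laurent)" using g(1) by (rule UN_I[OF UNIV_I])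
    hence "coefs (a * Abs_cone_quot g) = coefs 1"
      using g(2) by (simp add: times_cone_quot.rep_eq one_cone_quot.rep_eq Abs_cone_quot_inverse)
    thus ?thesis by (auto simp: coefs_inject)
  qed
  ultimately have "a * (SOME g. a * g = 1) = 1" using someI_ex[of "\<lambda>g. a * g = 1"] by blast
  thus "inverse a * a = 1" using \<open>a \<noteq> 0\<close>
    by (simp add: inverse_cone_quot_def mult.commute)
qed

end

lemma coefs_0 [simp]: "coefs 0 a = 0" by transfer simp
lemma coefs_1: "coefs 1 a = (if a = 0 then 1 else 0)" by transfer simp
lemma coefs_add [simp]: "coefs (f + g) a = coefs f a + coefs g a" by transfer simp
lemma coefs_uminus [simp]: "coefs (- f) a = - coefs f a" by transfer simp
lemma coefs_mult: "coefs (f * g) = series_mult (coefs f) (coefs g)" by transfer simp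
lemma coefs_sum [simp]: "coefs (sum f A) a = (\<Sum>x\<in>A. coefs (f x) a)"
  by (induction A rule: infinite_finite_induct) auto
lemma cone_quot_eqI: "(\<And>a. coefs f a = coefs g a) \<Longrightarrow> f = g"
  by (metis coefs_inject ext)

lemma coefs_of_nat: "coefs (of_nat m) a = (if a = 0 then of_nat m else 0)"
  by (induction m) (auto simp: coefs_1)

instance cone_quot :: (field_char_0) field_char_0
proof
  show "inj (of_nat :: nat \<Rightarrow> 'a cone_quot)"
  proof (rule injI)
    fix x y assume "(of_nat x :: 'a cone_quot) = of_nat y"
    hence "coefs (of_nat x :: 'a cone_quot) 0 = coefs (of_nat y :: 'a cone_quot) 0" by simp
    thus "x = y" by (simp add: coefs_of_nat)
  qed
qed

section \<open>Polynomials over a field\<close>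

text \<open>From here on \<open>degree\<close>, \<open>coeff\<close> and their companions refer to the type \<open>'a poly\<close>.\<close>

hide_const (open) Polynomials.degree Polynomials.lead_coeff up_ring.monom up_ring.coeff module.smult

text \<open>
  The linear equation that each step of Hensel lifting has to solve; reduction modulo \<open>g\<close> yields the
  degree bounds.
\<close>

lemma bezout_with_degree_bounds:
  fixes g h r :: "'k::field poly"
  assumes "s * g + t * h = 1" "degree g > 0" "degree h > 0" "degree r < degree g + degree h"
  shows "\<exists>u v. g * v + h * u = r \<and> degree u < degree g \<and> degree v < degree h"
proof -
  have nz: "g \<noteq> 0" "h \<noteq> 0" using assms(2,3) by auto
  define u where "u = (t * r) mod g"
  have du: "degree u < degree g"
    using degree_mod_less[OF nz(1), of "t * r"] assms(2) by (auto simp: u_def)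
  have u: "u = t * r - g * (t * r div g)"
    unfolding u_def by (simp add: minus_mult_div_eq_mod)
  have "r = (s * g + t * h) * r" using assms(1) by simp
  hence "r - h * u = g * (s * r + h * (t * r div g))"
    unfolding u by (simp add: algebra_simps)
  then obtain v where v: "r - h * u = g * v" by blast
  have "degree v < degree h"
  proof (cases "v = 0")
    case True thus ?thesis using assms(3) by simp
  next
    case False
    have "degree (h * u) \<le> degree h + degree u" by (rule degree_mult_le)
    hence "degree (r - h * u) < degree g + degree h"
      using assms(4) du by (intro degree_diff_less) auto
    thus ?thesis using False nz unfolding v by (simp add: degree_mult_eq)
  qed
  moreover have "g * v + h * u = r" using v by (simp add: algebra_simps)
  ultimately show ?thesis using du by blast
qed

text \<open>
  With \<open>e = h / h(c)\<close> the polynomial \<open>1 - e\<close> is a multiple of \<open>T - c\<close>, hence its \<open>m\<close>-th power is a multiple of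
  \<open>(T - c)\<^sup>m\<close>, while \<open>1 - (1 - e)\<^sup>m\<close> is a multiple of \<open>e\<close>.
\<close>

lemma bezout_linear_power:
  fixes h :: "'k::field poly"
  assumes "poly h c \<noteq> 0"
  shows "\<exists>s t. s * [:-c, 1:] ^ m + t * h = 1"
proof -
  define e where "e = smult (inverse (poly h c)) h"
  have "poly (1 - e) c = 0" using assms by (simp add: e_def)
  hence "[:-c, 1:] dvd 1 - e" unfolding poly_eq_0_iff_dvd .
  then obtain q where q: "1 - e = [:-c, 1:] * q" by (rule dvdE)
  have "1 - (1 - e) ^ m = (1 - (1 - e)) * (\<Sum>i<m. (1 - e) ^ i)"
    by (rule one_diff_power_eq)
  hence "1 = (1 - e) ^ m + e * (\<Sum>i<m. (1 - e) ^ i)" by (simp add: algebra_simps)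
  also have "(1 - e) ^ m = q ^ m * [:-c, 1:] ^ m" unfolding q power_mult_distrib
    by (rule mult.commute)
  also have "e * (\<Sum>i<m. (1 - e) ^ i) = smult (inverse (poly h c)) (\<Sum>i<m. (1 - e) ^ i) * h"
    by (simp add: e_def mult.commute)
  finally show ?thesis by metis
qed

lemma coeff_shift_degree:
  fixes p :: "'a::comm_ring_1 poly"
  assumes "degree p \<le> m"
  shows "coeff (pcompose p [:c, 1:]) m = coeff p m"
  using assms
proof (induction p arbitrary: m)
  case (pCons a p)
  show ?case
  proof (cases m)
    case 0
    hence "p = 0" using pCons.prems by (auto split: if_splits)
    thus ?thesis using 0 by simp
  next
    case (Suc k)
    hence dp: "degree p \<le> k" using pCons.prems by (auto split: if_splits)
    have "coeff (pcompose p [:c, 1:]) (Suc k) = coeff p (Suc k)" using pCons.IH[of "Suc k"] dp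
      by simp
    moreover have "coeff p (Suc k) = 0" using dp by (simp add: coeff_eq_0)
    ultimately show ?thesis using pCons.IH[OF dp] Suc by (simp add: pcompose_pCons coeff_pCons)
  qed
qed simp

text \<open>
  The substitution \<open>T \<mapsto> T + c\<close> moves the coefficient next to the leading one of a polynomial of degree
  \<open>m + 1\<close> by \<open>(m + 1) c\<close> times the leading coefficient.  In characteristic zero this serves to kill that
  coefficient, and to recognize the powers of linear polynomials for which it vanishes.
\<close>

lemma coeff_shift_subleading:
  fixes p :: "'a::comm_ring_1 poly"
  assumes "degree p \<le> Suc m"
  shows "coeff (pcompose p [:c, 1:]) m = coeff p m + of_nat (Suc m) * c * coeff p (Suc m)"
  using assms
proof (induction p arbitrary: m)
  case (pCons a p)
  have dp: "degree p \<le> m" using pCons.prems by (auto split: if_splits)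
  show ?case
  proof (cases m)
    case 0
    have "coeff (pcompose p [:c, 1:]) 0 = coeff p 0" using coeff_shift_degree[of p 0] dp 0 by simp
    thus ?thesis using 0 by (simp add: pcompose_pCons)
  next
    case (Suc k)
    have "coeff (pcompose p [:c, 1:]) m = coeff p m" by (rule coeff_shift_degree[OF dp])
    moreover have "coeff (pcompose p [:c, 1:]) k = coeff p k + of_nat (Suc k) * c * coeff p (Suc k)"
      using pCons.IH[of k] dp Suc by simp
    ultimately show ?thesis using Suc by (simp add: pcompose_pCons coeff_pCons algebra_simps)
  qed
qed simp

lemma pcompose_monom_1: "pcompose (monom 1 m) q = (q :: 'a::comm_semiring_1 poly) ^ m"
  by (induction m) (simp_all add: monom_Suc pcompose_pCons pcompose_1)

text \<open>
  Split off all factors \<open>T - c\<close> for one root \<open>c\<close>.  If nothing were left, the polynomial would be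
  \<open>(T - c)\<^sup>m\<close>; its coefficient \<open>- m c\<close> vanishes only for \<open>c = 0\<close>, which leaves \<open>T\<^sup>m\<close> and contradicts the
  nonzero lower coefficient.
\<close>

lemma monic_coprime_factorization:
  fixes q :: "'k::{alg_closed_field, field_char_0} poly"
  assumes "lead_coeff q = 1" "coeff q (degree q - 1) = 0" "degree q > 1" "i < degree q" "coeff q i \<noteq> 0"
  shows "\<exists>g h s t. q = g * h \<and> lead_coeff g = 1 \<and> lead_coeff h = 1 \<and> degree g > 0 \<and> degree h > 0 \<and>
    s * g + t * h = 1"
proof -
  obtain c where c: "poly q c = 0" using alg_closed_imp_poly_has_root[of q] assms(3) by auto
  have "q \<noteq> 0" using assms(3) by auto
  define m where "m = Polynomial.order c q"
  define g where "g = [:-c, 1:] ^ m"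
  obtain h where h: "q = g * h" "\<not> [:-c, 1:] dvd h"
    using order_decomp[OF \<open>q \<noteq> 0\<close>, of c] unfolding g_def m_def by blast
  have "m > 0" using c \<open>q \<noteq> 0\<close> order_root[of q c] unfolding m_def by auto
  have g: "lead_coeff g = 1" "degree g = m" unfolding g_def
    by (simp_all add: degree_power_eq coeff_linear_power)
  have lh: "lead_coeff h = 1" using assms(1) g(1) unfolding h(1) lead_coeff_mult by simp
  have "degree h > 0"
  proof (rule ccontr)
    assume "\<not> degree h > 0"
    hence "h = 1" using lh by (metis degree_eq_zeroE gr0I lead_coeff_pCons(2) one_pCons)
    hence q: "q = g" using h by simp
    hence m: "m = degree q" using g by simp
    have "q = pcompose (monom 1 m) [:-c, 1:]" unfolding q g_def by (simp add: pcompose_monom_1)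
    hence "coeff q (m - 1) = of_nat m * (- c)"
      using coeff_shift_subleading[of "monom 1 m" "m - 1" "- c"] \<open>m > 0\<close>
      by (simp add: degree_monom_eq del: of_nat_Suc)
    hence "c = 0" using assms(2) m \<open>m > 0\<close> by simp
    hence "q = monom 1 m" unfolding q g_def by (simp add: monom_altdef)
    hence "coeff q i = coeff (monom 1 m) i" by (rule arg_cong)
    thus False using assms(4,5) m by simp
  qed
  moreover have "poly h c \<noteq> 0" using h(2) by (simp add: poly_eq_0_iff_dvd)
  then obtain s t where "s * g + t * h = 1" using bezout_linear_power unfolding g_def by blast
  ultimately show ?thesis using h(1) g lh \<open>m > 0\<close> by blast
qed

section \<open>Subfields and cone rings of a given dimension\<close>

text \<open>
  The field \<open>k((x))\<^sup>*\<close> of dimension \<open>n\<close>.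
\<close>

definition cone_quots :: "nat \<Rightarrow> 'k::field cone_quot set" where
  "cone_quots n = {f. coefs f \<in> cone_laurent n}"

text \<open>
  The ring \<open>k[[\<Gamma>, d]]\<close>.
\<close>

definition cone_ring :: "nat \<Rightarrow> nat \<Rightarrow> (nat \<Rightarrow> real) set \<Rightarrow> 'k::field cone_quot set" where
  "cone_ring n d \<Gamma> = {f. \<forall>a. coefs f a \<noteq> 0 \<longrightarrow> a \<in> cone_exponents n d \<Gamma>}"

lemma Abs_cone_quot_coefs:
  "f \<in> cone_laurent n \<Longrightarrow> coefs (Abs_cone_quot f) = f"
  by (rule Abs_cone_quot_inverse, rule UN_I[of n], rule UNIV_I)

lemma cone_quots_0: "0 \<in> cone_quots n"
  unfolding cone_quots_def by (simp add: zero_cone_quot.rep_eq cone_laurent_0)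

lemma cone_quots_1: "1 \<in> cone_quots n"
  unfolding cone_quots_def using cone_laurent_monomial[of 1 0 n 1]
  by (simp add: one_cone_quot.rep_eq)

lemma cone_quots_add: "f \<in> cone_quots n \<Longrightarrow> g \<in> cone_quots n \<Longrightarrow> f + g \<in> cone_quots n"
  unfolding cone_quots_def by (simp add: plus_cone_quot.rep_eq cone_laurent_add)

lemma cone_quots_mult: "f \<in> cone_quots n \<Longrightarrow> g \<in> cone_quots n \<Longrightarrow> f * g \<in> cone_quots n"
  unfolding cone_quots_def by (simp add: times_cone_quot.rep_eq cone_laurent_mult)

lemma cone_quots_uminus:
  assumes "f \<in> cone_quots n" shows "- f \<in> cone_quots n"
proof -
  have "coefs (- f) \<in> cone_laurent n"
    by (rule cone_laurent_subset_support[of "coefs f"]) (use assms in \<open>auto simp: cone_quots_def\<close>)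
  thus ?thesis by (simp add: cone_quots_def)
qed

lemma cone_quots_inverse:
  assumes "f \<in> cone_quots n" shows "inverse f \<in> cone_quots n"
proof (cases "f = 0")
  case True thus ?thesis by (simp add: cone_quots_0)
next
  case False
  hence "coefs f \<noteq> (\<lambda>_. 0)" by transfer
  then obtain g where g: "g \<in> cone_laurent n" "series_mult (coefs f) g = (\<lambda>a. if a = 0 then 1 else 0)"
    using cone_laurent_inverse[of "coefs f" n] assms by (auto simp: cone_quots_def)
  have "coefs (f * Abs_cone_quot g) = coefs 1"
    using g by (simp add: times_cone_quot.rep_eq one_cone_quot.rep_eq Abs_cone_quot_coefs)
  hence "f * Abs_cone_quot g = 1" by (simp add: coefs_inject)
  hence "inverse f = Abs_cone_quot g" by (rule inverse_unique)
  thus ?thesis using g(1) by (simp add: cone_quots_def Abs_cone_quot_coefs)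
qed

lemma cone_quots_divide: "f \<in> cone_quots n \<Longrightarrow> g \<in> cone_quots n \<Longrightarrow> f / g \<in> cone_quots n"
  unfolding divide_inverse by (intro cone_quots_mult cone_quots_inverse)

lemma cone_quots_power: "f \<in> cone_quots n \<Longrightarrow> f ^ m \<in> cone_quots n"
  by (induction m) (auto intro: cone_quots_1 cone_quots_mult)

lemma cone_quots_of_nat: "of_nat m \<in> cone_quots n"
  by (induction m) (auto intro: cone_quots_0 cone_quots_1 cone_quots_add)

lemma cone_quots_sum: "(\<And>x. x \<in> A \<Longrightarrow> f x \<in> cone_quots n) \<Longrightarrow> sum f A \<in> cone_quots n"
  by (induction A rule: infinite_finite_induct) (auto intro: cone_quots_0 cone_quots_add)

lemma cone_ring_subset_cone_quots:
  assumes "d > 0" "\<Gamma> \<in> cones n"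
  shows "cone_ring n d \<Gamma> \<subseteq> cone_quots n"
  unfolding cone_ring_def cone_quots_def cone_exponents_def
  by (auto intro!: cone_laurentI[OF assms exponents_0])

lemma cone_ring_mono:
  assumes "\<Gamma> \<subseteq> \<Delta>" "d dvd e" "n \<le> m"
  shows "cone_ring n d \<Gamma> \<subseteq> cone_ring m e \<Delta>"
  using exponents_mono[OF assms(3,2)] assms(1) unfolding cone_ring_def cone_exponents_def by blast

lemma lex_nonneg_in_cone_ring:
  assumes "f \<in> cone_quots n" "\<And>a. coefs f a \<noteq> 0 \<Longrightarrow> lex_nonneg a"
  shows "\<exists>d>0. \<exists>\<Gamma>\<in>cones n. f \<in> cone_ring n d \<Gamma>"
proof -
  obtain d \<Gamma> where "d > 0" "\<Gamma> \<in> cones n" "\<And>a. coefs f a \<noteq> 0 \<Longrightarrow> a \<in> cone_exponents n d \<Gamma>"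
    using cone_laurent_lex_nonneg[of "coefs f" n] assms by (auto simp: cone_quots_def)
  thus ?thesis unfolding cone_ring_def by blast
qed

lemma cone_rings_directed:
  assumes "finite F" "\<And>f. f \<in> F \<Longrightarrow> \<exists>d>0. \<exists>\<Gamma>\<in>cones n. f \<in> cone_ring n d \<Gamma>"
  shows "\<exists>d>0. \<exists>\<Gamma>\<in>cones n. F \<subseteq> cone_ring n d \<Gamma>"
  using assms
proof (induction F)
  case empty
  thus ?case using orthant_in_cones by (intro exI[of _ 1]) auto
next
  case (insert f F)
  obtain d \<Gamma> where d: "d > 0" "\<Gamma> \<in> cones n" "F \<subseteq> cone_ring n d \<Gamma>"
    using insert by auto
  obtain e \<Delta> where e: "e > 0" "\<Delta> \<in> cones n" "f \<in> cone_ring n e \<Delta>"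
    using insert.prems[of f] by blast
  obtain \<Lambda> where \<Lambda>: "\<Lambda> \<in> cones n" "\<Gamma> \<subseteq> \<Lambda>" "\<Delta> \<subseteq> \<Lambda>"
    using cones_directed[OF d(2) e(2)] by blast
  have "insert f F \<subseteq> cone_ring n (d * e) \<Lambda>"
    using cone_ring_mono[OF \<Lambda>(2), of d "d * e" n n] cone_ring_mono[OF \<Lambda>(3), of e "d * e" n n] d(3) e(3)
    by auto
  thus ?case using \<Lambda>(1) d(1) e(1) by (intro exI[of _ "d * e"]) auto
qed

lemma coefs_mult_cone_ring:
  assumes "d > 0" "\<Gamma> \<in> cones n" "f \<in> cone_ring n d \<Gamma>" "g \<in> cone_ring n d \<Gamma>"
  shows "coefs (f * g) x = (\<Sum>b | b \<in> cone_exponents n d \<Gamma> \<and> x - b \<in> cone_exponents n d \<Gamma>. coefs f b * coefs g (x - b))"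
  unfolding coefs_mult
  by (rule series_mult_eq[OF cone_exponents_finite[OF assms(1,2)]]) (use assms(3,4) in \<open>auto simp: cone_ring_def\<close>)

section \<open>Lifting coprime factorizations\<close>

text \<open>
  A polynomial over \<open>k[[\<Gamma>, d]]\<close> is the same as a family of polynomials over \<open>k\<close> of bounded degree, indexed by
  the exponents.
\<close>

lemma poly_from_coefficient_polys:
  fixes F :: "(nat \<Rightarrow> real) \<Rightarrow> 'k::field poly"
  assumes "d > 0" "\<Gamma> \<in> cones n" "\<And>x. x \<notin> cone_exponents n d \<Gamma> \<Longrightarrow> F x = 0" "\<And>x. degree (F x) \<le> m"
  shows "\<exists>G. degree G \<le> m \<and> (\<forall>i. coeff G i \<in> cone_ring n d \<Gamma>) \<and> (\<forall>i x. coefs (coeff G i) x = coeff (F x) i)"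
proof -
  define c where "c i = Abs_cone_quot (\<lambda>x. coeff (F x) i)" for i
  have lau: "(\<lambda>x. coeff (F x) i) \<in> cone_laurent n" for i
    by (rule cone_laurentI[OF assms(1,2) exponents_0]) (use assms(3) in \<open>force simp: cone_exponents_def\<close>)+
  have c: "coefs (c i) x = coeff (F x) i" for i x by (simp add: c_def Abs_cone_quot_coefs[OF lau])
  define G where "G = (\<Sum>i\<le>m. monom (c i) i)"
  have G: "coeff G i = (if i \<le> m then c i else 0)" for i
    unfolding G_def coeff_sum by simp
  have cG: "coefs (coeff G i) x = coeff (F x) i" for i x
    using assms(4)[of x] by (auto simp: G c coeff_eq_0)
  have "degree G \<le> m" by (rule degree_le) (simp add: G)
  moreover have "coeff G i \<in> cone_ring n d \<Gamma>" for i
    unfolding cone_ring_def using assms(3) by (auto simp: cG) (metis coeff_0)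
  ultimately show ?thesis using cG by blast
qed

text \<open>
  Write \<open>p = \<Sum> P x\<close> as a family of polynomials over \<open>k\<close>, indexed by exponents \<open>x\<close>.  The factors are built
  as such families, with \<open>g0\<close> and \<open>h0\<close> at exponent 0.  At \<open>x \<noteq> 0\<close> the unknowns \<open>u\<close> and \<open>v\<close> satisfy
  \<open>g0 v + h0 u = P x - \<dots>\<close>, where the dots involve proper divisors of \<open>x\<close> only; the right-hand side has
  degree below that of \<open>p\<close> because \<open>p\<close> is monic, so the equation is solvable within the degree bounds
  that keep both factors monic.
\<close>

lemma hensel_cone_ring:
  fixes p :: "'k::field cone_quot poly"
  assumes d: "d > 0" "\<Gamma> \<in> cones n" and p: "\<And>i. coeff p i \<in> cone_ring n d \<Gamma>" "lead_coeff p = 1"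
    and p0: "\<And>i. coeff (g0 * h0) i = coefs (coeff p i) 0"
    and gh: "lead_coeff g0 = 1" "lead_coeff h0 = 1" "degree g0 > 0" "degree h0 > 0"
    and bez: "s * g0 + t * h0 = 1"
  shows "\<exists>G H. p = G * H \<and> lead_coeff G = 1 \<and> degree G = degree g0 \<and> degree H = degree h0 \<and>
    (\<forall>i. coeff G i \<in> cone_ring n d \<Gamma>)"
proof -
  define M where "M = cone_exponents n d \<Gamma>"
  define D where "D x = {b. b \<in> M \<and> x - b \<in> M}" for x
  have fin: "finite (D x)" for x unfolding D_def M_def using cone_exponents_finite[OF d] by simp
  have M0: "0 \<in> M" unfolding M_def by (rule cone_exponents_0[OF d(2)])
  have D0: "D 0 = {0}"
  proof -
    have "b = 0" if "b \<in> M" "- b \<in> M" for b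
      using that cone_lex_nonneg[OF d(2)] lex_nonneg_antisym unfolding M_def cone_exponents_def
      by blast
    thus ?thesis using M0 by (auto simp: D_def)
  qed
  have D_empty: "D x = {}" if "x \<notin> M" for x
  proof (rule ccontr)
    assume "D x \<noteq> {}"
    then obtain b where "b \<in> M" "x - b \<in> M" unfolding D_def by blast
    hence "b + (x - b) \<in> M" unfolding M_def by (intro cone_exponents_add[OF d(2)])
    thus False using that by simp
  qed
  define N where "N = degree g0 + degree h0"
  have nz: "g0 \<noteq> 0" "h0 \<noteq> 0" using gh by auto
  define P where "P x = map_poly (\<lambda>f. coefs f x) p" for x
  have cP: "coeff (P x) i = coefs (coeff p i) x" for x i by (simp add: P_def coeff_map_poly)
  have P_0: "P 0 = g0 * h0" by (rule poly_eqI) (simp add: cP p0)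
  have P_out: "P x = 0" if "x \<notin> M" for x
    by (rule poly_eqI) (use p(1) that in \<open>auto simp: cP cone_ring_def M_def\<close>)
  have degp: "degree p = N"
  proof (rule antisym)
    have "coefs (coeff p N) 0 = 1"
      using gh(1,2) p0[of N] unfolding N_def coeff_mult_degree_sum by simp
    thus "N \<le> degree p" by (intro le_degree) auto
    have "coeff (g0 * h0) (degree p) \<noteq> 0" using p0[of "degree p"] p(2) by (simp add: coefs_1)
    hence "degree p \<le> degree (g0 * h0)" by (rule le_degree)
    thus "degree p \<le> N" using nz by (simp add: N_def degree_mult_eq)
  qed
  have degP: "degree (P x) < N" if "x \<noteq> 0" for x
  proof -
    have "coeff (P x) i = 0" if "i \<ge> N" for i
      using that \<open>x \<noteq> 0\<close> p(2) degp
      by (cases "i = N") (auto simp: cP coefs_1 coeff_eq_0)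
    thus ?thesis using gh(3) by (intro degree_lessI) (auto simp: N_def)
  qed
  \<comment> \<open>\<open>r\<close> is an admissible pair of coefficients at exponent \<open>x\<close>, given the pairs \<open>F b\<close> at proper divisors \<open>b\<close>\<close>
  define Q where "Q F x r \<longleftrightarrow> (if x \<notin> M then r = (0, 0) else if x = 0 then r = (g0, h0) else
     degree (fst r) < degree g0 \<and> degree (snd r) < degree h0 \<and>
     g0 * snd r + h0 * fst r = P x - (\<Sum>b\<in>D x - {0, x}. fst (F b) * snd (F (x - b))))"
    for F and x and r :: "'k poly \<times> 'k poly"
  have "\<exists>F. \<forall>x. Q F x (F x)"
  proof (rule cone_exponents_recursion[OF d, folded M_def])
    fix F F' :: "(nat \<Rightarrow> real) \<Rightarrow> 'k poly \<times> 'k poly" and x r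
    assume eq: "\<And>b. b \<in> M \<Longrightarrow> x - b \<in> M \<Longrightarrow> b \<noteq> x \<Longrightarrow> F b = F' b"
    have "(\<Sum>b\<in>D x - {0, x}. fst (F b) * snd (F (x - b))) = (\<Sum>b\<in>D x - {0, x}. fst (F' b) * snd (F' (x - b)))"
    proof (rule sum.cong[OF refl])
      fix b assume b: "b \<in> D x - {0, x}"
      have "F b = F' b" using b by (intro eq) (auto simp: D_def)
      moreover have "F (x - b) = F' (x - b)" using b by (intro eq) (auto simp: D_def)
      ultimately show "fst (F b) * snd (F (x - b)) = fst (F' b) * snd (F' (x - b))" by simp
    qed
    thus "Q F x r = Q F' x r" unfolding Q_def by presburger
  next
    fix x and F :: "(nat \<Rightarrow> real) \<Rightarrow> 'k poly \<times> 'k poly"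
    assume IH: "\<And>b. b \<in> M \<Longrightarrow> x - b \<in> M \<Longrightarrow> b \<noteq> x \<Longrightarrow> Q F b (F b)"
    show "\<exists>r. Q F x r"
    proof (cases "x \<in> M \<and> x \<noteq> 0")
      case True
      define R where "R = P x - (\<Sum>b\<in>D x - {0, x}. fst (F b) * snd (F (x - b)))"
      have "degree (fst (F b) * snd (F (x - b))) < N" if b: "b \<in> D x - {0, x}" for b
      proof -
        have b': "b \<in> M" "x - b \<in> M" "b \<noteq> x" "b \<noteq> 0" "x - b \<noteq> 0" "x - b \<noteq> x" "x - (x - b) \<in> M"
          using b by (auto simp: D_def)
        have "degree (fst (F b)) < degree g0" using IH[of b] b' unfolding Q_def by auto
        moreover have "degree (snd (F (x - b))) < degree h0" using IH[of "x - b"] b' unfolding Q_def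
          by auto
        ultimately show ?thesis
          using degree_mult_le[of "fst (F b)" "snd (F (x - b))"] unfolding N_def by linarith
      qed
      hence "degree (\<Sum>b\<in>D x - {0, x}. fst (F b) * snd (F (x - b))) < N"
        using gh(3) by (intro degree_sum_less) (auto simp: N_def)
      hence "degree R < degree g0 + degree h0"
        unfolding R_def using degP True unfolding N_def by (intro degree_diff_less) auto
      from bezout_with_degree_bounds[OF bez gh(3,4) this]
      obtain u v where "g0 * v + h0 * u = R" "degree u < degree g0" "degree v < degree h0" by blast
      thus ?thesis using True by (intro exI[of _ "(u, v)"]) (simp add: Q_def R_def)
    next
      case False
      thus ?thesis by (intro exI[of _ "if x \<notin> M then (0, 0) else (g0, h0)"]) (auto simp: Q_def)
    qed
  qed
  then obtain F where F: "\<And>x. Q F x (F x)" by blast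
  have F_out: "F x = (0, 0)" if "x \<notin> M" for x using F[of x] that by (simp add: Q_def)
  have F_0: "F 0 = (g0, h0)" using F[of 0] M0 by (simp add: Q_def)
  have F_deg: "degree (fst (F x)) < degree g0" "degree (snd (F x)) < degree h0" if "x \<noteq> 0" for x
    using F[of x] that gh(3,4) by (auto simp: Q_def split: if_splits)
  have F_le: "degree (fst (F x)) \<le> degree g0" "degree (snd (F x)) \<le> degree h0" for x
    using F_deg[of x] F_0 by (cases "x = 0"; simp)+
  have conv: "(\<Sum>b\<in>D x. fst (F b) * snd (F (x - b))) = P x" for x
  proof (cases "x \<in> M \<and> x \<noteq> 0")
    case True
    have "D x = insert 0 (insert x (D x - {0, x}))" using True M0 by (auto simp: D_def)
    hence "(\<Sum>b\<in>D x. fst (F b) * snd (F (x - b))) =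
        (\<Sum>b\<in>insert 0 (insert x (D x - {0, x})). fst (F b) * snd (F (x - b)))" by (rule arg_cong)
    also have "\<dots> = g0 * snd (F x) + (fst (F x) * h0 + (\<Sum>b\<in>D x - {0, x}. fst (F b) * snd (F (x - b))))"
      using True fin[of x] F_0 by (subst sum.insert; simp)+
    also have "\<dots> = P x" using F[of x] True by (simp add: Q_def algebra_simps)
    finally show ?thesis .
  next
    case False
    thus ?thesis using D_empty P_out D0 F_0 P_0 by (cases "x = 0") auto
  qed
  obtain G where G: "degree G \<le> degree g0" "\<And>i. coeff G i \<in> cone_ring n d \<Gamma>" "\<And>i x. coefs (coeff G i) x = coeff (fst (F x)) i"
    using poly_from_coefficient_polys[OF d, of "\<lambda>x. fst (F x)" "degree g0"] F_out F_le
    by (auto simp: M_def)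
  obtain H where H: "degree H \<le> degree h0" "\<And>i. coeff H i \<in> cone_ring n d \<Gamma>" "\<And>i x. coefs (coeff H i) x = coeff (snd (F x)) i"
    using poly_from_coefficient_polys[OF d, of "\<lambda>x. snd (F x)" "degree h0"] F_out F_le
    by (auto simp: M_def)
  have "p = G * H"
  proof (rule poly_eqI, rule cone_quot_eqI)
    fix i x
    have "coefs (coeff (G * H) i) x = (\<Sum>j\<le>i. \<Sum>b\<in>D x. coeff (fst (F b)) j * coeff (snd (F (x - b))) (i - j))"
      unfolding coeff_mult coefs_sum D_def M_def coefs_mult_cone_ring[OF d G(2) H(2)] G(3) H(3) ..
    also have "\<dots> = coeff (\<Sum>b\<in>D x. fst (F b) * snd (F (x - b))) i"
      unfolding coeff_sum coeff_mult by (rule sum.swap)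
    also have "\<dots> = coefs (coeff p i) x" unfolding conv cP ..
    finally show "coefs (coeff p i) x = coefs (coeff (G * H) i) x" ..
  qed
  moreover have cG: "coeff G (degree g0) = 1"
  proof (rule cone_quot_eqI)
    fix x show "coefs (coeff G (degree g0)) x = coefs 1 x"
      using F_deg(1)[of x] gh(1) F_0 by (cases "x = 0") (auto simp: G(3) coefs_1 coeff_eq_0)
  qed
  moreover have cH: "coeff H (degree h0) = 1"
  proof (rule cone_quot_eqI)
    fix x show "coefs (coeff H (degree h0)) x = coefs 1 x"
      using F_deg(2)[of x] gh(2) F_0 by (cases "x = 0") (auto simp: H(3) coefs_1 coeff_eq_0)
  qed
  moreover have "degree G = degree g0" using G(1) le_degree[of G "degree g0"] cG by simp
  moreover have "degree H = degree h0" using H(1) le_degree[of H "degree h0"] cH by simp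
  ultimately show ?thesis using G(2) by metis
qed

section \<open>Monomials and Newton slopes\<close>

lemma finite_lex_minimal:
  assumes "finite I" "I \<noteq> {}"
  shows "\<exists>i\<in>I. \<forall>j\<in>I. lex_nonneg (w j - w i)"
  using assms
proof (induction I rule: finite_ne_induct)
  case (insert k I)
  then obtain i where i: "i \<in> I" "\<forall>j\<in>I. lex_nonneg (w j - w i)" by blast
  show ?case
  proof (cases "lex_nonneg (w k - w i)")
    case True
    hence "\<forall>j\<in>insert k I. lex_nonneg (w j - w i)" using i(2) by (simp only: ball_simps)
    thus ?thesis by (rule bexI) (rule insertI2, rule i(1))
  next
    case False
    hence ki: "lex_nonneg (w i - w k)" using lex_nonneg_total[of "w k - w i"] by simp
    have kj: "lex_nonneg (w j - w k)" if "j \<in> I" for j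
      using lex_nonneg_add[OF i(2)[rule_format, OF that] ki] by simp
    show ?thesis
    proof (intro bexI[of _ k] ballI)
      fix j assume "j \<in> insert k I"
      thus "lex_nonneg (w j - w k)" using kj by (cases "j = k") simp_all
    qed simp
  qed
next
  case (singleton k)
  have "lex_nonneg (w k - w k)" by simp
  thus ?case by (intro bexI[of _ k]) (simp_all only: singleton_iff ball_simps)
qed

definition monomial :: "(nat \<Rightarrow> real) \<Rightarrow> 'k::field cone_quot" where
  "monomial e = Abs_cone_quot (\<lambda>a. if a = e then 1 else 0)"

lemma coefs_monomial:
  assumes "d > 0" "e \<in> exponents n d"
  shows "coefs (monomial e) a = (if a = e then 1 else 0)"
  unfolding monomial_def Abs_cone_quot_coefs[OF cone_laurent_monomial[OF assms]] ..

lemma monomial_in_cone_quots: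
  assumes "d > 0" "e \<in> exponents n d"
  shows "monomial e \<in> cone_quots n"
  unfolding cone_quots_def monomial_def mem_Collect_eq Abs_cone_quot_coefs[OF cone_laurent_monomial[OF assms]]
  by (rule cone_laurent_monomial[OF assms])

lemma coefs_monomial_mult:
  assumes "d > 0" "e \<in> exponents n d"
  shows "coefs (monomial e * f) a = coefs f (a - e)"
  unfolding coefs_mult coefs_monomial[OF assms, abs_def] series_mult_single by simp

lemma monomial_0 [simp]: "monomial 0 = 1"
  by (rule cone_quot_eqI) (simp add: coefs_monomial[OF zero_less_one exponents_0[of 0]] coefs_1)

lemma monomial_nonzero:
  assumes "d > 0" "e \<in> exponents n d"
  shows "(monomial e :: 'k::field cone_quot) \<noteq> 0"
proof
  assume "(monomial e :: 'k cone_quot) = 0"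
  hence "coefs (monomial e :: 'k cone_quot) e = 0" by simp
  thus False by (simp add: coefs_monomial[OF assms])
qed

lemma monomial_add:
  assumes "d > 0" "e \<in> exponents n d" "e' \<in> exponents n d"
  shows "monomial (e + e') = monomial e * monomial e'"
proof (rule cone_quot_eqI)
  fix a
  have "a - e = e' \<longleftrightarrow> a = e + e'" by (auto simp: algebra_simps)
  thus "coefs (monomial (e + e')) a = coefs (monomial e * monomial e') a"
    by (simp add: coefs_monomial_mult[OF assms(1,2)] coefs_monomial[OF assms(1,3)]
      coefs_monomial[OF assms(1) exponents_add[OF assms(2,3)]])
qed

lemma exponents_scale_nat: "e \<in> exponents n d \<Longrightarrow> (\<lambda>i. real k * e i) \<in> exponents n d"
proof -
  assume e: "e \<in> exponents n d"
  have "real d * (real k * e i) \<in> \<int>" for i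
    using Ints_mult[OF Ints_of_nat[of k] exponentsD(1)[OF e, of i]] by (simp add: mult_ac)
  thus ?thesis using e unfolding exponents_def by auto
qed

lemma monomial_power:
  assumes "d > 0" "e \<in> exponents n d"
  shows "monomial e ^ k = monomial (\<lambda>i. real k * e i)"
proof (induction k)
  case 0
  have "(\<lambda>i. real 0 * e i) = 0" by auto
  thus ?case by simp
next
  case (Suc k)
  have "(\<lambda>i. real (Suc k) * e i) = e + (\<lambda>i. real k * e i)"
    by (auto simp: fun_eq_iff algebra_simps)
  thus ?case by (simp only: power_Suc Suc monomial_add[OF assms exponents_scale_nat[OF assms(2), of k]])
qed

lemma coefs_divide_monomial:
  assumes "d > 0" "e \<in> exponents n d"
  shows "coefs (f / monomial e) a = coefs f (a + e)"
proof -
  have "coefs f (a + e) = coefs (monomial e * (f / monomial e)) (a + e)"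
    by (simp add: monomial_nonzero[OF assms])
  also have "\<dots> = coefs (f / monomial e) (a + e - e)" by (rule coefs_monomial_mult[OF assms])
  also have "a + e - e = a" by simp
  finally show ?thesis ..
qed

lemma coeffs_pcompose_linear_in_cone_quots:
  assumes "\<And>i. coeff p i \<in> cone_quots n" "c \<in> cone_quots n"
  shows "coeff (pcompose p [:c, 1:]) i \<in> cone_quots n"
  using assms(1)
proof (induction p arbitrary: i)
  case (pCons a p)
  have a: "a \<in> cone_quots n" using pCons.prems[of 0] by simp
  have "coeff p i \<in> cone_quots n" for i using pCons.prems[of "Suc i"] by simp
  hence IH: "coeff (pcompose p [:c, 1:]) i \<in> cone_quots n" for i by (rule pCons.IH)
  have "coeff [:a:] i \<in> cone_quots n" for i using a cone_quots_0 by (cases i) auto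
  moreover have "coeff ([:c, 1:] * pcompose p [:c, 1:]) i \<in> cone_quots n"
    unfolding coeff_mult
  proof (intro cone_quots_sum cone_quots_mult IH)
    fix j show "coeff [:c, 1:] j \<in> cone_quots n"
      using assms(2) cone_quots_0 cone_quots_1 by (auto simp: coeff_pCons split: nat.split)
  qed
  ultimately show ?case by (simp add: pcompose_pCons cone_quots_add)
qed (simp add: cone_quots_0)

text \<open>
  Let \<open>w i\<close> be the least exponent of the \<open>i\<close>-th coefficient and \<open>N\<close> the degree.  The exponent \<open>e\<close> is the least of the
  slopes \<open>w i / (N - i)\<close>; it exists since the value group is divisible.  Scaling the variable by \<open>x\<^sup>e\<close>
  then makes all coefficients integral, and some coefficient below the leading one a unit.
\<close>

lemma newton_slope:
  fixes q :: "'k::field cone_quot poly"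
  assumes "\<And>i. coeff q i \<in> cone_quots n" "lead_coeff q = 1" "i1 < degree q" "coeff q i1 \<noteq> 0"
  shows "\<exists>d e i. d > 0 \<and> e \<in> exponents n d \<and> i < degree q \<and>
    coefs (coeff q i) (\<lambda>l. real (degree q - i) * e l) \<noteq> 0 \<and>
    (\<forall>j a. j < degree q \<longrightarrow> coefs (coeff q j) a \<noteq> 0 \<longrightarrow> lex_nonneg (a - (\<lambda>l. real (degree q - j) * e l)))"
proof -
  define N where "N = degree q"
  define I where "I = {i. i < N \<and> coeff q i \<noteq> 0}"
  have fin: "finite I" "I \<noteq> {}" using assms(3,4) by (auto simp: I_def N_def)
  have "\<exists>c. coefs (coeff q i) c \<noteq> 0 \<and> (\<forall>b. coefs (coeff q i) b \<noteq> 0 \<longrightarrow> lex_nonneg (b - c))" if "i \<in> I" for i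
  proof -
    have "coeff q i \<noteq> 0" using that by (simp add: I_def)
    then obtain a where "coefs (coeff q i) a \<noteq> 0" using cone_quot_eqI[of "coeff q i" 0]
      by auto
    moreover have "coefs (coeff q i) \<in> cone_laurent n" using assms(1)
      by (simp add: cone_quots_def)
    ultimately show ?thesis using cone_laurent_lex_least by metis
  qed
  then obtain w where w: "\<And>i. i \<in> I \<Longrightarrow> coefs (coeff q i) (w i) \<noteq> 0"
    "\<And>i b. i \<in> I \<Longrightarrow> coefs (coeff q i) b \<noteq> 0 \<Longrightarrow> lex_nonneg (b - w i)"
      by metis
  define \<gamma> where "\<gamma> i = (\<lambda>l. w i l / real (N - i))" for i
  have \<gamma>: "(\<lambda>l. real (N - i) * \<gamma> i l) = w i" if "i \<in> I" for i
    using that by (auto simp: \<gamma>_def I_def)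
  obtain i where i: "i \<in> I" "\<forall>j\<in>I. lex_nonneg (\<gamma> j - \<gamma> i)"
    using finite_lex_minimal[OF fin] by blast
  have "coefs (coeff q i) \<in> cone_laurent n" using assms(1) by (simp add: cone_quots_def)
  then obtain d0 where d0: "d0 > 0" "w i \<in> exponents n d0"
    using w(1)[OF i(1)] by (elim cone_laurentE) blast
  have Ni: "N - i > 0" using i(1) by (simp add: I_def)
  have exps: "\<gamma> i \<in> exponents n (d0 * (N - i))"
  proof -
    have "real (d0 * (N - i)) * \<gamma> i l = real d0 * w i l" for l using Ni
      by (simp add: \<gamma>_def)
    thus ?thesis using exponentsD[OF d0(2)] unfolding exponents_def
      by (auto simp: \<gamma>_def simp del: of_nat_mult)
  qed
  have pos: "lex_nonneg (a - (\<lambda>l. real (N - j) * \<gamma> i l))" if "j < N" "coefs (coeff q j) a \<noteq> 0" for j a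
  proof -
    have j: "j \<in> I" using that by (auto simp: I_def)
    have "lex_nonneg (\<lambda>l. real (N - j) * (\<gamma> j - \<gamma> i) l)"
      by (rule lex_nonneg_scale[OF i(2)[rule_format, OF j]]) simp
    also have "(\<lambda>l. real (N - j) * (\<gamma> j - \<gamma> i) l) = w j - (\<lambda>l. real (N - j) * \<gamma> i l)"
      using \<gamma>[OF j] by (auto simp: fun_eq_iff algebra_simps)
    finally have "lex_nonneg ((a - w j) + (w j - (\<lambda>l. real (N - j) * \<gamma> i l)))"
      by (rule lex_nonneg_add[OF w(2)[OF j that(2)]])
    thus ?thesis by simp
  qed
  have attained: "coefs (coeff q i) (\<lambda>l. real (N - i) * \<gamma> i l) \<noteq> 0"
    using w(1)[OF i(1)] \<gamma>[OF i(1)] by simp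
  have "d0 * (N - i) > 0" "i < N" using d0(1) Ni by simp_all
  hence "\<exists>d e i. d > 0 \<and> e \<in> exponents n d \<and> i < N \<and>
    coefs (coeff q i) (\<lambda>l. real (N - i) * e l) \<noteq> 0 \<and>
    (\<forall>j a. j < N \<longrightarrow> coefs (coeff q j) a \<noteq> 0 \<longrightarrow> lex_nonneg (a - (\<lambda>l. real (N - j) * e l)))"
    by (intro exI conjI allI impI) (assumption, rule exps, assumption, rule attained, rule pos)
  thus ?thesis unfolding N_def .
qed

section \<open>Existence of roots\<close>

text \<open>
  The coefficients lie in a common cone ring, and the residue polynomial at exponent 0 has a coprime
  factorization by the hypotheses on the coefficients, so Hensel's lemma applies.
\<close>

lemma integral_poly_factorization:
  fixes p :: "'k::{alg_closed_field, field_char_0} cone_quot poly"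
  assumes p: "\<And>i. coeff p i \<in> cone_quots n" "\<And>i a. coefs (coeff p i) a \<noteq> 0 \<Longrightarrow> lex_nonneg a"
    and N: "lead_coeff p = 1" "degree p > 1" "coeff p (degree p - 1) = 0"
    and i: "i < degree p" "coefs (coeff p i) 0 \<noteq> 0"
  obtains G H where "p = G * H" "lead_coeff G = 1" "0 < degree G" "degree G < degree p"
    "\<And>i. coeff G i \<in> cone_quots n"
proof -
  have "\<exists>d>0. \<exists>\<Gamma>\<in>cones n. coeff p ` {..degree p} \<subseteq> cone_ring n d \<Gamma>"
  proof (rule cone_rings_directed)
    fix f assume "f \<in> coeff p ` {..degree p}"
    then obtain j where f: "f = coeff p j" by blast
    show "\<exists>d>0. \<exists>\<Gamma>\<in>cones n. f \<in> cone_ring n d \<Gamma>"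
      unfolding f using p by (rule lex_nonneg_in_cone_ring)
  qed simp
  then obtain d \<Gamma>
    where d: "d > 0" "\<Gamma> \<in> cones n" "coeff p ` {..degree p} \<subseteq> cone_ring n d \<Gamma>"
      by blast
  have pd: "coeff p j \<in> cone_ring n d \<Gamma>" for j
  proof (cases "j \<le> degree p")
    case False
    thus ?thesis by (simp add: coeff_eq_0 cone_ring_def)
  qed (use d in auto)
  define p0 where "p0 = map_poly (\<lambda>f. coefs f 0) p"
  have cp0: "coeff p0 j = coefs (coeff p j) 0" for j by (simp add: p0_def coeff_map_poly)
  have deg0: "degree p0 = degree p"
  proof (rule antisym)
    show "degree p0 \<le> degree p" by (rule degree_le) (simp add: cp0 coeff_eq_0)
    show "degree p \<le> degree p0"
      by (rule le_degree) (use N(1) in \<open>simp add: cp0 coefs_1\<close>)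
  qed
  have "\<exists>g h s t. p0 = g * h \<and> lead_coeff g = 1 \<and> lead_coeff h = 1 \<and> degree g > 0 \<and> degree h > 0 \<and> s * g + t * h = 1"
    by (rule monic_coprime_factorization[of _ i]) (use N i in \<open>simp_all add: deg0 cp0 coefs_1\<close>)
  then obtain g h s t
    where gh: "p0 = g * h" "lead_coeff g = 1" "lead_coeff h = 1" "degree g > 0" "degree h > 0"
    "s * g + t * h = 1" by blast
  have "degree p = degree g + degree h"
    unfolding deg0[symmetric] gh(1) using gh(4,5) by (intro degree_mult_eq) auto
  moreover have "coeff (g * h) j = coefs (coeff p j) 0" for j unfolding gh(1)[symmetric]
    by (rule cp0)
  from hensel_cone_ring[OF d(1,2) pd N(1) this gh(2-6)]
  obtain G H where "p = G * H" "lead_coeff G = 1" "degree G = degree g" "\<forall>j. coeff G j \<in> cone_ring n d \<Gamma>"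
    by (elim exE conjE) (rule that)
  moreover from this(4) have "coeff G j \<in> cone_quots n" for j
    using subsetD[OF cone_ring_subset_cone_quots[OF d(1,2)], of "coeff G j"] by simp
  ultimately show ?thesis using gh(4,5) by (intro that[of G H]) simp_all
qed

text \<open>
  The Newton-Puiseux argument, by induction on the degree \<open>N\<close>.  The translation by \<open>c\<close> kills the coefficient of
  degree \<open>N - 1\<close>.  If all lower coefficients vanish, 0 is a root; otherwise the polynomial rescaled
  along its Newton slope has a proper monic factor, and a root of the factor is carried back.
\<close>

theorem cone_quots_monic_root:
  fixes p :: "'k::{alg_closed_field, field_char_0} cone_quot poly"
  assumes "\<And>i. coeff p i \<in> cone_quots n" "lead_coeff p = 1" "degree p > 0"
  shows "\<exists>x\<in>cone_quots n. poly p x = 0"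
  using assms
proof (induction "degree p" arbitrary: p rule: less_induct)
  case (less p)
  define N where "N = degree p"
  have "N > 0" using less.prems by (simp add: N_def)
  define c where "c = - coeff p (N - 1) / of_nat N"
  have c: "c \<in> cone_quots n"
    unfolding c_def by (intro cone_quots_divide cone_quots_uminus less.prems cone_quots_of_nat)
  define q where "q = pcompose p [:c, 1:]"
  have q: "coeff q i \<in> cone_quots n" for i
    unfolding q_def using less.prems(1) c by (rule coeffs_pcompose_linear_in_cone_quots)
  have dq: "degree q = N" by (simp add: q_def N_def degree_pcompose)
  have lq: "coeff q N = 1"
    using less.prems(2) coeff_shift_degree[of p N c] by (simp add: q_def N_def)
  have sq: "coeff q (N - 1) = 0"
  proof -
    have "coeff q (N - 1) = coeff p (N - 1) + of_nat (Suc (N - 1)) * c * coeff p (Suc (N - 1))"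
      unfolding q_def
      by (rule coeff_shift_subleading) (use \<open>N > 0\<close> in \<open>simp add: N_def\<close>)
    also have "Suc (N - 1) = N" using \<open>N > 0\<close> by simp
    also have "coeff p N = 1" using less.prems(2) by (simp add: N_def)
    finally show ?thesis using \<open>N > 0\<close> by (simp add: c_def)
  qed
  have "\<exists>y\<in>cone_quots n. poly q y = 0"
  proof (cases "\<exists>i<N. coeff q i \<noteq> 0")
    case False
    have "poly q 0 = coeff q 0" by (rule poly_0_coeff_0)
    also have "\<dots> = 0" using False \<open>N > 0\<close> by blast
    finally show ?thesis using cone_quots_0 by blast
  next
    case True
    then obtain i1 where i1: "i1 < N" "coeff q i1 \<noteq> 0" by blast
    have "N \<noteq> 1" using i1 sq by (cases "N = 1") auto
    obtain d e i where e: "d > 0" "e \<in> exponents n d" "i < N"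
      "coefs (coeff q i) (\<lambda>l. real (N - i) * e l) \<noteq> 0"
      "\<forall>j a. j < N \<longrightarrow> coefs (coeff q j) a \<noteq> 0 \<longrightarrow> lex_nonneg (a - (\<lambda>l. real (N - j) * e l))"
      using newton_slope[of q n i1, unfolded dq, OF q lq i1] by (elim exE conjE) (rule that)
    define T :: "'k cone_quot" where "T = monomial e"
    have T: "T \<noteq> 0" "T \<in> cone_quots n"
      unfolding T_def using monomial_nonzero[OF e(1,2)] monomial_in_cone_quots[OF e(1,2)] by auto
    define r where "r = smult (1 / T ^ N) (pcompose q [:0, T:])"
    have cr: "coeff r j = coeff q j * T ^ j / T ^ N" for j
      unfolding r_def by (simp add: coeff_pcompose_linear mult.commute)
    have cr': "coeff r j = coeff q j / monomial (\<lambda>l. real (N - j) * e l)" if "j \<le> N" for j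
    proof -
      have "T ^ N = T ^ j * T ^ (N - j)" using that by (simp flip: power_add)
      hence "coeff r j = coeff q j / T ^ (N - j)" using T(1) by (simp add: cr)
      thus ?thesis by (simp add: T_def monomial_power[OF e(1,2)])
    qed
    have crc: "coefs (coeff r j) a = coefs (coeff q j) (a + (\<lambda>l. real (N - j) * e l))" if "j \<le> N" for j a
      unfolding cr'[OF that] by (rule coefs_divide_monomial[OF e(1) exponents_scale_nat[OF e(2)]])
    have rN: "coeff r N = 1" using T(1) lq by (simp add: cr)
    have r_out: "coeff r j = 0" if "j > N" for j using that dq by (simp add: cr coeff_eq_0)
    have dr: "degree r = N"
      using rN r_out by (intro antisym degree_le le_degree) auto
    obtain G H where G: "r = G * H" "lead_coeff G = 1" "0 < degree G" "degree G < degree r" "\<And>i. coeff G i \<in> cone_quots n"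
    proof (rule integral_poly_factorization[of r n i])
      show "coeff r j \<in> cone_quots n" for j
        unfolding cr using q T(2) by (intro cone_quots_divide cone_quots_mult cone_quots_power)
      show "lex_nonneg a" if a: "coefs (coeff r j) a \<noteq> 0" for j a
      proof -
        consider "j < N" | "j = N" | "j > N" by linarith
        thus ?thesis
        proof cases
          case 1
          thus ?thesis using e(5)[rule_format, of j "a + (\<lambda>l. real (N - j) * e l)"] a
            by (simp add: crc)
        next
          case 2
          thus ?thesis using a rN by (auto simp: coefs_1 split: if_splits)
        qed (use a r_out in auto)
      qed
      show "coefs (coeff r i) 0 \<noteq> 0" using e(3,4) by (simp add: crc)
      show "lead_coeff r = 1" "degree r > 1" "i < degree r"
        using rN dr \<open>N > 0\<close> \<open>N \<noteq> 1\<close> e(3) by auto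
      show "coeff r (degree r - 1) = 0" unfolding dr cr sq by simp
    qed blast
    have "\<exists>y\<in>cone_quots n. poly G y = 0"
      by (rule less.hyps) (use G dr in \<open>auto simp: N_def\<close>)
    then obtain y where y: "y \<in> cone_quots n" "poly G y = 0" by blast
    have "poly r y = 0" using y(2) G(1) by simp
    hence "poly q (T * y) = 0" using T(1) by (simp add: r_def poly_pcompose mult.commute)
    thus ?thesis using cone_quots_mult[OF T(2) y(1)] by blast
  qed
  then obtain y where y: "y \<in> cone_quots n" "poly q y = 0" by blast
  have "poly p (c + y) = 0" using y(2) by (simp add: q_def poly_pcompose)
  thus ?case using cone_quots_add[OF c y(1)] by blast
qed

section \<open>Fractions of cone series\<close>

lemma cone_ring_0: "0 \<in> cone_ring n d \<Gamma>"
  by (simp add: cone_ring_def)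

lemma cone_ring_1: "\<Gamma> \<in> cones n \<Longrightarrow> 1 \<in> cone_ring n d \<Gamma>"
  using cone_exponents_0[of \<Gamma> n d] by (auto simp: cone_ring_def coefs_1 split: if_splits)

lemma cone_ring_add:
  assumes "f \<in> cone_ring n d \<Gamma>" "g \<in> cone_ring n d \<Gamma>"
  shows "f + g \<in> cone_ring n d \<Gamma>"
  unfolding cone_ring_def
proof (rule CollectI, intro allI impI)
  fix a assume "coefs (f + g) a \<noteq> 0"
  hence "coefs f a \<noteq> 0 \<or> coefs g a \<noteq> 0" by auto
  thus "a \<in> cone_exponents n d \<Gamma>" using assms unfolding cone_ring_def by blast
qed

lemma cone_ring_uminus: "f \<in> cone_ring n d \<Gamma> \<Longrightarrow> - f \<in> cone_ring n d \<Gamma>"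
  by (simp add: cone_ring_def)

lemma cone_ring_mult:
  assumes "\<Gamma> \<in> cones n" "f \<in> cone_ring n d \<Gamma>" "g \<in> cone_ring n d \<Gamma>"
  shows "f * g \<in> cone_ring n d \<Gamma>"
  unfolding cone_ring_def
proof (rule CollectI, intro allI impI)
  fix c assume "coefs (f * g) c \<noteq> 0"
  from series_mult_nonzero[OF this[unfolded coefs_mult]] obtain a b
    where ab: "coefs f a \<noteq> 0" "coefs g b \<noteq> 0" "c = a + b" by blast
  show "c \<in> cone_exponents n d \<Gamma>"
    unfolding ab(3) using assms ab(1,2) by (intro cone_exponents_add) (auto simp: cone_ring_def)
qed

text \<open>
  Either \<open>f\<close> or its quotient by its leading monomial \<open>x\<^sup>c\<close> can be the numerator: if \<open>c\<close> is nonnegative then \<open>f\<close> is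
  integral itself, and otherwise the denominator \<open>x\<^sup>-\<^sup>c\<close> is integral.
\<close>

lemma cone_quots_fraction:
  assumes "f \<in> cone_quots n"
  shows "\<exists>d>0. \<exists>\<Gamma>\<in>cones n. \<exists>p\<in>cone_ring n d \<Gamma>. \<exists>q\<in>cone_ring n d \<Gamma>. q \<noteq> 0 \<and> f = p / q"
proof -
  have wit: ?thesis if "p \<in> cone_quots n" "\<And>a. coefs p a \<noteq> 0 \<Longrightarrow> lex_nonneg a"
    "q \<in> cone_quots n" "\<And>a. coefs q a \<noteq> 0 \<Longrightarrow> lex_nonneg a" "q \<noteq> 0" "f = p / q" for p q
  proof -
    have "\<exists>d>0. \<exists>\<Gamma>\<in>cones n. {p, q} \<subseteq> cone_ring n d \<Gamma>"
    proof (rule cone_rings_directed)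
      fix g assume "g \<in> {p, q}"
      hence "g = p \<or> g = q" by simp
      thus "\<exists>d>0. \<exists>\<Gamma>\<in>cones n. g \<in> cone_ring n d \<Gamma>"
        using lex_nonneg_in_cone_ring[OF that(1,2)] lex_nonneg_in_cone_ring[OF that(3,4)] by metis
    qed simp
    then obtain d \<Gamma>
      where "d > 0" "\<Gamma> \<in> cones n" "p \<in> cone_ring n d \<Gamma>" "q \<in> cone_ring n d \<Gamma>"
        by auto
    thus ?thesis using that(5,6) by blast
  qed
  have one: "coefs 1 a \<noteq> 0 \<Longrightarrow> lex_nonneg a" for a
    by (auto simp: coefs_1 split: if_splits)
  show ?thesis
  proof (cases "f = 0")
    case True
    show ?thesis by (rule wit[OF cone_quots_0 _ cone_quots_1 one]) (use True in auto)
  next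
    case False
    then obtain a where a: "coefs f a \<noteq> 0" using cone_quot_eqI[of f 0] by auto
    have lf: "coefs f \<in> cone_laurent n" using assms by (simp add: cone_quots_def)
    obtain c where c: "coefs f c \<noteq> 0" "\<And>b. coefs f b \<noteq> 0 \<Longrightarrow> lex_nonneg (b - c)"
      using lf a by (rule cone_laurent_lex_least) blast
    obtain d where d: "d > 0" "c \<in> exponents n d" using lf c(1) by (elim cone_laurentE) blast
    show ?thesis
    proof (cases "lex_nonneg c")
      case True
      have "lex_nonneg b" if "coefs f b \<noteq> 0" for b
        using lex_nonneg_add[OF True c(2)[OF that]] by simp
      thus ?thesis by (intro wit[OF assms _ cone_quots_1 one]) auto
    next
      case False
      hence mc: "lex_nonneg (- c)" using lex_nonneg_total by blast
      have md: "- c \<in> exponents n d" using d(2) by (rule exponents_uminus)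
      show ?thesis
      proof (rule wit)
        show "f / monomial c \<in> cone_quots n"
          by (intro cone_quots_divide assms monomial_in_cone_quots[OF d])
        show "lex_nonneg b" if "coefs (f / monomial c) b \<noteq> 0" for b
          using c(2)[of "b + c"] that by (simp add: coefs_divide_monomial[OF d])
        show "monomial (- c) \<in> cone_quots n" by (rule monomial_in_cone_quots[OF d(1) md])
        show "lex_nonneg b" if "coefs (monomial (- c) :: 'a cone_quot) b \<noteq> 0" for b
          using that mc by (simp add: coefs_monomial[OF d(1) md] split: if_splits)
        show nz: "(monomial (- c) :: 'a cone_quot) \<noteq> 0"
          by (rule monomial_nonzero[OF d(1) md])
        have "monomial c * monomial (- c) = (1 :: 'a cone_quot)"
          using monomial_add[OF d md, where ?'a = 'a] by simp
        thus "f = f / monomial c / monomial (- c)" by (simp add: field_simps)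
      qed
    qed
  qed
qed

text \<open>
  The ring \<open>R\<close> of the statement; its field of fractions follows.
\<close>

definition integral_series :: "nat \<Rightarrow> 'k::field cone_quot set" where
  "integral_series n = (\<Union>\<Gamma>\<in>cones n. cone_ring n 1 \<Gamma>)"

definition integral_fractions :: "nat \<Rightarrow> 'k::field cone_quot set" where
  "integral_fractions n = {f / g | f g. f \<in> integral_series n \<and> g \<in> integral_series n \<and> g \<noteq> 0}"

lemma integral_series_pair:
  assumes "f \<in> integral_series n" "g \<in> integral_series n"
  obtains \<Gamma> where "\<Gamma> \<in> cones n" "f \<in> cone_ring n 1 \<Gamma>" "g \<in> cone_ring n 1 \<Gamma>"
proof -
  obtain \<Gamma> \<Delta>
    where *: "\<Gamma> \<in> cones n" "\<Delta> \<in> cones n" "f \<in> cone_ring n 1 \<Gamma>" "g \<in> cone_ring n 1 \<Delta>"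
    using assms unfolding integral_series_def by blast
  obtain \<Lambda> where \<Lambda>: "\<Lambda> \<in> cones n" "\<Gamma> \<subseteq> \<Lambda>" "\<Delta> \<subseteq> \<Lambda>"
    using cones_directed[OF *(1,2)] by blast
  show ?thesis
    using that[OF \<Lambda>(1)] *(3,4) cone_ring_mono[OF \<Lambda>(2), of 1 1 n n] cone_ring_mono[OF \<Lambda>(3), of 1 1 n n]
    by auto
qed

lemma integral_series_0: "0 \<in> integral_series n"
  unfolding integral_series_def by (rule UN_I[OF orthant_in_cones cone_ring_0])

lemma integral_series_1: "1 \<in> integral_series n"
  unfolding integral_series_def
  by (rule UN_I, rule orthant_in_cones, rule cone_ring_1, rule orthant_in_cones)

lemma integral_series_uminus: "f \<in> integral_series n \<Longrightarrow> - f \<in> integral_series n"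
  unfolding integral_series_def by (auto intro: cone_ring_uminus)

lemma integral_series_add:
  assumes "f \<in> integral_series n" "g \<in> integral_series n"
  shows "f + g \<in> integral_series n"
  using assms by (rule integral_series_pair) (auto simp: integral_series_def intro: cone_ring_add)

lemma integral_series_mult:
  assumes "f \<in> integral_series n" "g \<in> integral_series n"
  shows "f * g \<in> integral_series n"
  using assms by (rule integral_series_pair) (auto simp: integral_series_def intro: cone_ring_mult)

lemma integral_series_subset: "integral_series n \<subseteq> cone_quots n"
  unfolding integral_series_def
  by (rule UN_least, rule cone_ring_subset_cone_quots[OF zero_less_one])

lemma integral_fractionsI:
  "f \<in> integral_series n \<Longrightarrow> g \<in> integral_series n \<Longrightarrow> g \<noteq> 0 \<Longrightarrow> f / g \<in> integral_fractions n"
  unfolding integral_fractions_def by blast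

lemma integral_fractionsE:
  assumes "x \<in> integral_fractions n"
  obtains f g where "f \<in> integral_series n" "g \<in> integral_series n" "g \<noteq> 0" "x = f / g"
  using assms unfolding integral_fractions_def by blast

lemma integral_series_subset_fractions: "f \<in> integral_series n \<Longrightarrow> f \<in> integral_fractions n"
  using integral_fractionsI[OF _ integral_series_1, of f] by simp

lemma integral_fractions_subset: "integral_fractions n \<subseteq> cone_quots n"
proof
  fix x assume "x \<in> integral_fractions n"
  then obtain f g where "f \<in> integral_series n" "g \<in> integral_series n" "x = f / g"
    by (elim integral_fractionsE)
  thus "x \<in> cone_quots n"
    using integral_series_subset[THEN subsetD, of f n] integral_series_subset[THEN subsetD, of g n]
    by (simp add: cone_quots_divide)
qed

lemma integral_fractions_uminus:
  assumes "x \<in> integral_fractions n"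
  shows "- x \<in> integral_fractions n"
proof -
  obtain f g where "f \<in> integral_series n" "g \<in> integral_series n" "g \<noteq> 0" "x = f / g"
    using assms by (rule integral_fractionsE)
  thus ?thesis using integral_fractionsI[OF integral_series_uminus, of f n g] by simp
qed

lemma integral_fractions_add:
  assumes "x \<in> integral_fractions n" "y \<in> integral_fractions n"
  shows "x + y \<in> integral_fractions n"
proof -
  obtain f g where f: "f \<in> integral_series n" "g \<in> integral_series n" "g \<noteq> 0" "x = f / g"
    using assms(1) by (rule integral_fractionsE)
  obtain h k where h: "h \<in> integral_series n" "k \<in> integral_series n" "k \<noteq> 0" "y = h / k"
    using assms(2) by (rule integral_fractionsE)
  have "x + y = (f * k + h * g) / (g * k)" using f h by (simp add: field_simps)
  also have "\<dots> \<in> integral_fractions n"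
    using f h by (intro integral_fractionsI integral_series_add integral_series_mult) auto
  finally show ?thesis .
qed

lemma integral_fractions_mult:
  assumes "x \<in> integral_fractions n" "y \<in> integral_fractions n"
  shows "x * y \<in> integral_fractions n"
proof -
  obtain f g where f: "f \<in> integral_series n" "g \<in> integral_series n" "g \<noteq> 0" "x = f / g"
    using assms(1) by (rule integral_fractionsE)
  obtain h k where h: "h \<in> integral_series n" "k \<in> integral_series n" "k \<noteq> 0" "y = h / k"
    using assms(2) by (rule integral_fractionsE)
  have "x * y = (f * h) / (g * k)" using f h by simp
  also have "\<dots> \<in> integral_fractions n"
    using f h by (intro integral_fractionsI integral_series_mult) auto
  finally show ?thesis .
qed

lemma integral_fractions_inverse:
  assumes "x \<in> integral_fractions n" "x \<noteq> 0"
  shows "inverse x \<in> integral_fractions n"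
proof -
  obtain f g where f: "f \<in> integral_series n" "g \<in> integral_series n" "g \<noteq> 0" "x = f / g"
    using assms(1) by (rule integral_fractionsE)
  have "inverse x = g / f" using f(4) by simp
  thus ?thesis using integral_fractionsI[OF f(2,1)] f(4) assms(2) by auto
qed

section \<open>Algebraicity over the series with integral exponents\<close>

text \<open>
  The part of a series whose exponents lie in the class of \<open>r\<close> modulo \<open>\<int>\<^sup>n\<close>, represented by
  fractional parts.
\<close>

definition residue_part :: "'k::field cone_quot \<Rightarrow> (nat \<Rightarrow> real) \<Rightarrow> 'k cone_quot" where
  "residue_part f r = Abs_cone_quot (\<lambda>a. if (\<lambda>i. frac (a i)) = r then coefs f a else 0)"

lemma coefs_residue_part: "coefs (residue_part f r) a = (if (\<lambda>i. frac (a i)) = r then coefs f a else 0)"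
proof -
  obtain n where "coefs f \<in> cone_laurent n" using coefs[of f] by blast
  hence "(\<lambda>a. if (\<lambda>i. frac (a i)) = r then coefs f a else 0) \<in> cone_laurent n"
    by (rule cone_laurent_subset_support) (auto split: if_splits)
  thus ?thesis unfolding residue_part_def by (simp add: Abs_cone_quot_coefs)
qed

lemma finite_residues:
  assumes "d > 0"
  shows "finite ((\<lambda>a i. frac (a i)) ` exponents n d)"
proof (rule finite_subset)
  let ?B = "{u. real d * u \<in> \<int> \<and> 0 \<le> u \<and> u \<le> 1}"
  show "finite {f. \<forall>x. (x \<in> {..<n} \<longrightarrow> f x \<in> ?B) \<and> (x \<notin> {..<n} \<longrightarrow> f x = 0)}"
    by (intro finite_set_of_finite_funs finite_scaled_ints_between assms) simp
  show "(\<lambda>a i. frac (a i)) ` exponents n d \<subseteq> {f. \<forall>x. (x \<in> {..<n} \<longrightarrow> f x \<in> ?B) \<and> (x \<notin> {..<n} \<longrightarrow> f x = 0)}"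
  proof clarify
    fix a x assume a: "a \<in> exponents n d"
    have "real d * frac (a x) = real d * a x - real d * of_int \<lfloor>a x\<rfloor>"
      by (simp add: frac_def algebra_simps)
    also have "\<dots> \<in> \<int>"
      by (intro Ints_diff exponentsD(1)[OF a] Ints_mult[OF Ints_of_nat Ints_of_int])
    finally have "real d * frac (a x) \<in> \<int>" .
    moreover have "frac (a x) \<le> 1" using frac_lt_1[of "a x"] by linarith
    moreover have "frac (a x) = 0" if "x \<notin> {..<n}" using that exponentsD(2)[OF a, of x]
      by simp
    ultimately show "(x \<in> {..<n} \<longrightarrow> frac (a x) \<in> ?B) \<and> (x \<notin> {..<n} \<longrightarrow> frac (a x) = 0)"
      by simp
  qed
qed

lemma sum_residue_parts:
  assumes "d > 0" "f \<in> cone_ring n d \<Gamma>"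
  shows "f = (\<Sum>r\<in>(\<lambda>a i. frac (a i)) ` exponents n d. residue_part f r)"
proof (rule cone_quot_eqI)
  fix a
  let ?R = "(\<lambda>a i. frac (a i)) ` exponents n d"
  have "(\<Sum>r\<in>?R. coefs (residue_part f r) a) = (if (\<lambda>i. frac (a i)) \<in> ?R then coefs f a else 0)"
    unfolding coefs_residue_part by (rule sum.delta'[OF finite_residues[OF assms(1)]])
  also have "\<dots> = coefs f a" using assms(2) by (auto simp: cone_ring_def cone_exponents_def)
  finally show "coefs f a = coefs (\<Sum>r\<in>?R. residue_part f r) a" by simp
qed

text \<open>
  Exponents of the \<open>k\<close>-th power are congruent to \<open>k r\<close> modulo \<open>\<int>\<^sup>n\<close>, and \<open>d r\<close> is integral.
\<close>

lemma residue_part_power: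
  assumes "d > 0" "\<Gamma> \<in> cones n" "f \<in> cone_ring n d \<Gamma>"
  shows "residue_part f r ^ d \<in> integral_series n"
proof (cases "residue_part f r = 0")
  case True
  thus ?thesis using assms(1) integral_series_0[of n] by (simp add: zero_power)
next
  case False
  then obtain a where "coefs (residue_part f r) a \<noteq> 0"
    using cone_quot_eqI[of "residue_part f r" 0] by auto
  hence a: "r = (\<lambda>i. frac (a i))" "a \<in> exponents n d"
    using assms(3) by (auto simp: coefs_residue_part cone_ring_def cone_exponents_def split: if_splits)
  have r: "real d * r i \<in> \<int>" for i
  proof -
    have "real d * r i = real d * a i - real d * of_int \<lfloor>a i\<rfloor>"
      by (simp add: a(1) frac_def algebra_simps)
    also have "\<dots> \<in> \<int>"
      by (intro Ints_diff exponentsD(1)[OF a(2)] Ints_mult[OF Ints_of_nat Ints_of_int])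
    finally show ?thesis .
  qed
  have part: "residue_part f r \<in> cone_ring n d \<Gamma>"
    using assms(3) by (auto simp: coefs_residue_part cone_ring_def)
  have pow: "residue_part f r ^ k \<in> cone_ring n d \<Gamma> \<and>
      (\<forall>b. coefs (residue_part f r ^ k) b \<noteq> 0 \<longrightarrow> (\<forall>i. b i - real k * r i \<in> \<int>))" for k
  proof (induction k)
    case 0
    thus ?case using cone_ring_1[OF assms(2)] by (auto simp: coefs_1 split: if_splits)
  next
    case (Suc k)
    have "b i - real (Suc k) * r i \<in> \<int>" if b: "coefs (residue_part f r ^ Suc k) b \<noteq> 0" for b i
    proof -
      have "series_mult (coefs (residue_part f r)) (coefs (residue_part f r ^ k)) b \<noteq> 0"
        using b by (simp add: coefs_mult)
      from series_mult_nonzero[OF this] obtain x y where xy: "coefs (residue_part f r) x \<noteq> 0"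
        "coefs (residue_part f r ^ k) y \<noteq> 0" "b = x + y" by blast
      have "r = (\<lambda>i. frac (x i))" using xy(1)
        by (auto simp: coefs_residue_part split: if_splits)
      hence "b i - real (Suc k) * r i = of_int \<lfloor>x i\<rfloor> + (y i - real k * r i)"
        using xy(3) by (simp add: frac_def algebra_simps)
      also have "\<dots> \<in> \<int>" using Suc xy(2) by (intro Ints_add) auto
      finally show ?thesis .
    qed
    thus ?case using Suc cone_ring_mult[OF assms(2) part] by simp
  qed
  have "b \<in> cone_exponents n 1 \<Gamma>" if b: "coefs (residue_part f r ^ d) b \<noteq> 0" for b
  proof -
    have b': "b \<in> cone_exponents n d \<Gamma>" using pow[of d] b by (auto simp: cone_ring_def)
    have "b i \<in> \<int>" for i
    proof -
      have "b i - real d * r i \<in> \<int>" using pow[of d] b by blast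
      hence "(b i - real d * r i) + real d * r i \<in> \<int>" by (rule Ints_add[OF _ r])
      thus ?thesis by simp
    qed
    thus ?thesis using b' by (auto simp: cone_exponents_def exponents_def)
  qed
  thus ?thesis unfolding integral_series_def cone_ring_def using assms(2) by blast
qed

section \<open>The rings of the statement\<close>

lemma cone_series_eq:
  assumes "d > 0" "\<Gamma> \<in> cones n"
  shows "cone_series n \<Gamma> d = coefs ` cone_ring n d \<Gamma>"
proof (intro equalityI subsetI)
  fix f :: "(nat \<Rightarrow> real) \<Rightarrow> 'a" assume f: "f \<in> cone_series n \<Gamma> d"
  have supp: "a \<in> cone_exponents n d \<Gamma>" if "f a \<noteq> 0" for a
    using f that laurent_support_exponents[of d n "{a. f a \<noteq> 0}"]
    unfolding cone_series_def newton_diagram_def iterated_laurent_iff cone_exponents_def by blast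
  have "f \<in> cone_laurent n"
    by (rule cone_laurentI[OF assms exponents_0]) (use supp in \<open>auto simp: cone_exponents_def\<close>)
  hence "coefs (Abs_cone_quot f) = f" by (rule Abs_cone_quot_coefs)
  moreover from this have "Abs_cone_quot f \<in> cone_ring n d \<Gamma>" using supp
    by (simp add: cone_ring_def)
  ultimately show "f \<in> coefs ` cone_ring n d \<Gamma>" by (metis imageI)
next
  fix f :: "(nat \<Rightarrow> real) \<Rightarrow> 'a" assume "f \<in> coefs ` cone_ring n d \<Gamma>"
  then obtain g where g: "f = coefs g" "g \<in> cone_ring n d \<Gamma>" by blast
  have "{a. f a \<noteq> 0} \<subseteq> cone_exponents n d \<Gamma>" using g
    by (auto simp: cone_ring_def)
  moreover have "laurent_support d n {a. f a \<noteq> 0}"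
    using cone_exponents_laurent_support[OF assms(2)] calculation by (rule laurent_support_mono)
  ultimately show "f \<in> cone_series n \<Gamma> d"
    unfolding cone_series_def newton_diagram_def iterated_laurent_iff cone_exponents_def by blast
qed

lemma zero_coefs: "(\<lambda>_. 0) = coefs 0"
  by (simp add: zero_cone_quot.rep_eq)

lemma one_coefs: "(\<lambda>a. if a = (\<lambda>_. 0) then 1 else 0) = coefs 1"
  by (simp add: one_cone_quot.rep_eq zero_fun_def)

text \<open>
  Inverses in the ambient ring are defined by unique description over all iterated Laurent series, not
  only over those supported in cones; associativity there gives uniqueness.
\<close>

lemma laurent_union_inverse:
  fixes f :: "'k::field cone_quot"
  assumes "f \<in> cone_quots n" "f \<noteq> 0"
  shows "inv\<^bsub>laurent_union n\<^esub> (coefs f) = coefs (inverse f)"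
proof -
  let ?F = "laurent_union n :: ((nat \<Rightarrow> real) \<Rightarrow> 'k) ring"
  have ops: "mult ?F = series_mult" "one ?F = coefs 1" "carrier ?F = (\<Union>d\<in>{0<..}. iterated_laurent d n)"
    by (simp_all add: laurent_union_def one_coefs)
  have mem: "coefs g \<in> carrier ?F" if "g \<in> cone_quots n" for g :: "'k cone_quot"
    using cone_laurent_iterated[of "coefs g" n] that by (auto simp: ops cone_quots_def)
  have eq: "series_mult (coefs f) (coefs (inverse f)) = coefs 1" "series_mult (coefs (inverse f)) (coefs f) = coefs 1"
    using assms(2) by (simp_all flip: coefs_mult)
  show ?thesis
    unfolding m_inv_def ops(1,2)
  proof (rule the_equality)
    show "coefs (inverse f) \<in> carrier ?F \<and> series_mult (coefs f) (coefs (inverse f)) = coefs 1 \<and>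
      series_mult (coefs (inverse f)) (coefs f) = coefs 1"
      using eq mem[OF cone_quots_inverse[OF assms(1)]] by blast
    fix y assume y: "y \<in> carrier ?F \<and> series_mult (coefs f) y = coefs 1 \<and> series_mult y (coefs f) = coefs 1"
    obtain d1 where d1: "d1 > 0" "y \<in> iterated_laurent d1 n" using y by (auto simp: ops)
    obtain d2 where d2: "d2 > 0" "coefs f \<in> iterated_laurent d2 n"
      using mem[OF assms(1)] by (auto simp: ops)
    obtain d3 where d3: "d3 > 0" "coefs (inverse f) \<in> iterated_laurent d3 n"
      using mem[OF cone_quots_inverse[OF assms(1)]] by (auto simp: ops)
    obtain r s where r: "r > 0" "y \<in> iterated_laurent r s" "coefs f \<in> iterated_laurent r s"
      using iterated_laurent_common[OF d1(1) d2(1), of n n, where ?'k = 'k] d1 d2 by blast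
    obtain r' s' where r': "r' > 0" "y \<in> iterated_laurent r' s'" "coefs f \<in> iterated_laurent r' s'"
      "coefs (inverse f) \<in> iterated_laurent r' s'"
      using iterated_laurent_common[OF r(1) d3(1), of s n, where ?'k = 'k] r d3 by blast
    have one: "series_mult (coefs 1) g = g" for g :: "(nat \<Rightarrow> real) \<Rightarrow> 'k"
      unfolding one_cone_quot.rep_eq by (rule ext) (simp add: series_mult_single)
    have "y = series_mult (series_mult (coefs (inverse f)) (coefs f)) y" by (simp add: eq one)
    also have "\<dots> = series_mult (coefs (inverse f)) (series_mult (coefs f) y)"
      by (rule series_mult_assoc[OF r'(1,4,3,2)])
    also have "\<dots> = coefs (inverse f)"
      using y one by (simp add: series_mult_commute[of _ "coefs 1"])
    finally show "y = coefs (inverse f)" .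
  qed
qed

lemma fractions_coefs:
  assumes "A \<subseteq> cone_quots n"
  shows "fractions (laurent_union n) (coefs ` A) = coefs ` {f / g | f g. f \<in> A \<and> g \<in> A \<and> g \<noteq> 0}"
proof -
  have frac: "coefs f \<otimes>\<^bsub>laurent_union n\<^esub> inv\<^bsub>laurent_union n\<^esub> coefs g = coefs (f / g)"
    if "f \<in> A" "g \<in> A" "g \<noteq> 0" for f g
    using laurent_union_inverse[of g n] that assms
    by (simp add: laurent_union_def divide_inverse coefs_mult subset_iff)
  have zero: "\<zero>\<^bsub>laurent_union n\<^esub> = coefs 0"
    by (simp add: laurent_union_def zero_coefs)
  show ?thesis
  proof (intro equalityI subsetI)
    fix x assume "x \<in> fractions (laurent_union n) (coefs ` A)"
    then obtain f g where "f \<in> A" "g \<in> A" "coefs g \<noteq> coefs 0"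
      "x = coefs f \<otimes>\<^bsub>laurent_union n\<^esub> inv\<^bsub>laurent_union n\<^esub> coefs g"
      unfolding fractions_def zero by blast
    thus "x \<in> coefs ` {f / g | f g. f \<in> A \<and> g \<in> A \<and> g \<noteq> 0}"
      using frac[of f g] by auto
  next
    fix x assume "x \<in> coefs ` {f / g | f g. f \<in> A \<and> g \<in> A \<and> g \<noteq> 0}"
    then obtain f g where fg: "f \<in> A" "g \<in> A" "g \<noteq> 0" "x = coefs (f / g)" by blast
    have "coefs g \<in> coefs ` A - {coefs 0}" using fg by (simp add: coefs_inject)
    moreover have "coefs f \<in> coefs ` A" using fg(1) by (rule imageI)
    moreover have "x = coefs f \<otimes>\<^bsub>laurent_union n\<^esub> inv\<^bsub>laurent_union n\<^esub> coefs g"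
      using frac[OF fg(1-3)] fg(4) by (rule trans[OF _ sym, rotated])
    ultimately show "x \<in> fractions (laurent_union n) (coefs ` A)"
      unfolding fractions_def zero by blast
  qed
qed

lemma fractions_integral_series:
  "fractions (laurent_union n) (\<Union>\<Gamma>\<in>cones n. cone_series n \<Gamma> 1 :: ((nat \<Rightarrow> real) \<Rightarrow> 'k::field) set) =
    coefs ` integral_fractions n"
proof -
  have "(\<Union>\<Gamma>\<in>cones n. cone_series n \<Gamma> 1 :: ((nat \<Rightarrow> real) \<Rightarrow> 'k) set) = coefs ` integral_series n"
    unfolding integral_series_def image_UN by (rule SUP_cong) (simp_all add: cone_series_eq)
  thus ?thesis unfolding integral_fractions_def
    by (simp only: fractions_coefs[OF integral_series_subset])
qed

lemma carrier_laurent_star: "carrier (laurent_star n) = coefs ` (cone_quots n :: 'k::field cone_quot set)"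
proof -
  define Q :: "(nat \<Rightarrow> real) set \<Rightarrow> nat \<Rightarrow> 'k cone_quot set"
    where "Q \<Gamma> d = {f / g | f g. f \<in> cone_ring n d \<Gamma> \<and> g \<in> cone_ring n d \<Gamma> \<and> g \<noteq> 0}" for \<Gamma> d
  have "fractions (laurent_union n) (cone_series n \<Gamma> d) = coefs ` Q \<Gamma> d" if "\<Gamma> \<in> cones n" "d > 0" for \<Gamma> d
    unfolding Q_def cone_series_eq[OF that(2,1)]
    by (rule fractions_coefs[OF cone_ring_subset_cone_quots[OF that(2,1)]])
  hence "carrier (laurent_star n) = (\<Union>\<Gamma>\<in>cones n. \<Union>d\<in>{0<..}. coefs ` Q \<Gamma> d)"
    unfolding laurent_star_def by simp
  also have "\<dots> = coefs ` (\<Union>\<Gamma>\<in>cones n. \<Union>d\<in>{0<..}. Q \<Gamma> d)"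
    by (simp only: image_UN)
  also have "(\<Union>\<Gamma>\<in>cones n. \<Union>d\<in>{0<..}. Q \<Gamma> d) = cone_quots n"
  proof (intro equalityI subsetI)
    fix x assume "x \<in> (\<Union>\<Gamma>\<in>cones n. \<Union>d\<in>{0<..}. Q \<Gamma> d)"
    then obtain \<Gamma> d f g
      where *: "\<Gamma> \<in> cones n" "d > 0" "f \<in> cone_ring n d \<Gamma>" "g \<in> cone_ring n d \<Gamma>" "x = f / g"
      unfolding Q_def by auto
    show "x \<in> cone_quots n"
      unfolding *(5) using *(3,4)
      by (intro cone_quots_divide subsetD[OF cone_ring_subset_cone_quots[OF *(2,1)]])
  next
    fix x :: "'k cone_quot" assume "x \<in> cone_quots n"
    from cone_quots_fraction[OF this] obtain \<Gamma> d
      where "\<Gamma> \<in> cones n" "d > 0" "x \<in> Q \<Gamma> d"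
      unfolding Q_def by blast
    thus "x \<in> (\<Union>\<Gamma>\<in>cones n. \<Union>d\<in>{0<..}. Q \<Gamma> d)" by auto
  qed
  finally show ?thesis .
qed

lemma laurent_star_ops:
  "coefs f \<otimes>\<^bsub>laurent_star n\<^esub> coefs g = coefs (f * g)"
  "coefs f \<oplus>\<^bsub>laurent_star n\<^esub> coefs g = coefs (f + g)"
  "\<one>\<^bsub>laurent_star n\<^esub> = coefs 1" "\<zero>\<^bsub>laurent_star n\<^esub> = coefs 0"
  by (simp_all add: laurent_star_def laurent_union_def coefs_mult zero_coefs one_coefs plus_cone_quot.rep_eq)

lemma field_laurent_star: "field (laurent_star n)"
proof -
  let ?L = "laurent_star n :: ((nat \<Rightarrow> real) \<Rightarrow> 'a) ring"
  note simps = carrier_laurent_star laurent_star_ops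
  have "abelian_group ?L"
    by (rule abelian_groupI)
       (auto simp: simps coefs_inject algebra_simps intro: cone_quots_0 cone_quots_add intro!: bexI[OF _ cone_quots_uminus])
  moreover have "comm_monoid ?L"
    by (rule comm_monoidI) (auto simp: simps coefs_inject algebra_simps intro: cone_quots_1 cone_quots_mult)
  ultimately have "cring ?L"
    by (rule cringI) (auto simp: simps coefs_inject algebra_simps)
  thus ?thesis
  proof (rule cring.cring_fieldI2)
    show "\<zero>\<^bsub>?L\<^esub> \<noteq> \<one>\<^bsub>?L\<^esub>"
      by (simp add: simps coefs_inject)
    fix a assume "a \<in> carrier ?L" "a \<noteq> \<zero>\<^bsub>?L\<^esub>"
    then obtain f where f: "a = coefs f" "f \<in> cone_quots n" "f \<noteq> 0"
      by (auto simp: simps coefs_inject)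
    thus "\<exists>b\<in>carrier ?L. a \<otimes>\<^bsub>?L\<^esub> b = \<one>\<^bsub>?L\<^esub>"
      unfolding simps
      by (intro bexI[of _ "coefs (inverse f)"]) (simp_all add: simps cone_quots_inverse)
  qed
qed

lemma laurent_star_inv:
  assumes "f \<in> cone_quots n" "f \<noteq> 0"
  shows "inv\<^bsub>laurent_star n\<^esub> (coefs f) = coefs (inverse f)"
proof -
  interpret field "laurent_star n :: ((nat \<Rightarrow> real) \<Rightarrow> 'a) ring"
    by (rule field_laurent_star)
  show ?thesis
    by (rule inv_unique'[symmetric]) (use assms cone_quots_inverse in \<open>auto simp: carrier_laurent_star laurent_star_ops\<close>)
qed

lemma laurent_star_minus:
  assumes "f \<in> cone_quots n"
  shows "\<ominus>\<^bsub>laurent_star n\<^esub> (coefs f) = coefs (- f)"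
proof -
  interpret field "laurent_star n :: ((nat \<Rightarrow> real) \<Rightarrow> 'a) ring"
    by (rule field_laurent_star)
  show ?thesis
    by (rule minus_equality) (use assms cone_quots_uminus in \<open>auto simp: carrier_laurent_star laurent_star_ops\<close>)
qed

lemma laurent_star_pow: "coefs f [^]\<^bsub>laurent_star n\<^esub> (k::nat) = coefs (f ^ k)"
proof -
  interpret field "laurent_star n :: ((nat \<Rightarrow> real) \<Rightarrow> 'a) ring"
    by (rule field_laurent_star)
  show ?thesis by (induction k) (simp_all add: laurent_star_ops mult.commute)
qed

text \<open>
  Coefficient lists are written with the leading coefficient first in the one representation of
  polynomials and last in the other.
\<close>

lemma laurent_star_eval:
  "ring.eval (laurent_star n) (map coefs ps) (coefs f) = coefs (poly (Poly (rev ps)) f)"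
proof -
  interpret field "laurent_star n :: ((nat \<Rightarrow> real) \<Rightarrow> 'a) ring"
    by (rule field_laurent_star)
  show ?thesis
    by (induction ps) (simp_all add: laurent_star_ops laurent_star_pow Poly_snoc poly_monom add.commute)
qed

lemma subfield_integral_fractions: 
  "subfield (coefs ` integral_fractions n) (laurent_star n :: ((nat \<Rightarrow> real) \<Rightarrow> 'k::field) ring)"
proof -
  let ?L = "laurent_star n :: ((nat \<Rightarrow> real) \<Rightarrow> 'k) ring"
  interpret field "laurent_star n :: ((nat \<Rightarrow> real) \<Rightarrow> 'k) ring"
    by (rule field_laurent_star)
  note sub = subsetD[OF integral_fractions_subset]
  show ?thesis
  proof (rule subfieldI')
    show "subring (coefs ` integral_fractions n) ?L"
    proof (rule subringI)
      show "coefs ` integral_fractions n \<subseteq> carrier ?L"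
        using integral_fractions_subset by (auto simp: carrier_laurent_star)
      show "\<one>\<^bsub>?L\<^esub> \<in> coefs ` integral_fractions n"
        by (simp add: laurent_star_ops integral_series_subset_fractions[OF integral_series_1])
    next
      fix h :: "(nat \<Rightarrow> real) \<Rightarrow> 'k" assume "h \<in> coefs ` integral_fractions n"
      thus "\<ominus>\<^bsub>?L\<^esub> h \<in> coefs ` integral_fractions n"
        by (auto simp: laurent_star_minus[OF sub] intro: integral_fractions_uminus)
    next
      fix h1 h2 :: "(nat \<Rightarrow> real) \<Rightarrow> 'k" assume "h1 \<in> coefs ` integral_fractions n" "h2 \<in> coefs ` integral_fractions n"
      thus "h1 \<otimes>\<^bsub>?L\<^esub> h2 \<in> coefs ` integral_fractions n"
        "h1 \<oplus>\<^bsub>?L\<^esub> h2 \<in> coefs ` integral_fractions n"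
        by (auto simp: laurent_star_ops intro: integral_fractions_mult integral_fractions_add)
    qed
    fix k :: "(nat \<Rightarrow> real) \<Rightarrow> 'k" assume "k \<in> coefs ` integral_fractions n - {\<zero>\<^bsub>?L\<^esub>}"
    then obtain f where f: "k = coefs f" "f \<in> integral_fractions n" "f \<noteq> 0"
      by (auto simp: laurent_star_ops)
    thus "inv\<^bsub>?L\<^esub> k \<in> coefs ` integral_fractions n"
      by (simp add: laurent_star_inv[OF sub] integral_fractions_inverse)
  qed
qed

lemma cone_quots_poly_root:
  fixes ps :: "'k::{alg_closed_field, field_char_0} cone_quot list"
  assumes "set ps \<subseteq> cone_quots n" "length ps > 1" "hd ps \<noteq> 0"
  shows "\<exists>x\<in>cone_quots n. poly (Poly (rev ps)) x = 0"
proof -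
  define q where "q = Poly (rev ps)"
  have cq: "coeff q i \<in> cone_quots n" for i
    unfolding q_def coeff_Poly_eq nth_default_def using assms(1) cone_quots_0 nth_mem[of i "rev ps"]
    by auto
  have "coeff q (length ps - 1) = hd ps"
  proof -
    have "ps \<noteq> []" using assms(2) by auto
    thus ?thesis by (simp add: q_def nth_default_def rev_nth hd_conv_nth)
  qed
  hence dq: "degree q = length ps - 1" "lead_coeff q = hd ps"
  proof -
    have "degree q \<le> length ps - 1"
      by (rule degree_le) (auto simp: q_def nth_default_def)
    moreover have "length ps - 1 \<le> degree q"
      using \<open>coeff q (length ps - 1) = hd ps\<close> assms(3) by (intro le_degree) simp
    ultimately show "degree q = length ps - 1" by simp
    thus "lead_coeff q = hd ps" using \<open>coeff q (length ps - 1) = hd ps\<close> by simp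
  qed
  have "degree q > 0" using assms(2) dq(1) by simp
  define r where "r = smult (inverse (lead_coeff q)) q"
  have "\<exists>x\<in>cone_quots n. poly r x = 0"
  proof (rule cone_quots_monic_root)
    show "coeff r i \<in> cone_quots n" for i
      unfolding r_def coeff_smult by (intro cone_quots_mult cone_quots_inverse cq)
    show "lead_coeff r = 1" "degree r > 0" using dq assms(3) \<open>degree q > 0\<close>
      by (auto simp: r_def)
  qed
  then obtain x where x: "x \<in> cone_quots n" "poly r x = 0" by blast
  have "poly q x = 0" using x(2) dq assms(3) by (simp add: r_def)
  thus ?thesis using x(1) unfolding q_def by blast
qed

lemma algebraically_closed_laurent_star:
  "algebraically_closed (laurent_star n :: ((nat \<Rightarrow> real) \<Rightarrow> 'k::{alg_closed_field, field_char_0}) ring)"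
proof -
  let ?L = "laurent_star n :: ((nat \<Rightarrow> real) \<Rightarrow> 'k) ring"
  interpret field ?L by (rule field_laurent_star)
  show ?thesis
  proof (rule algebraically_closedI)
    fix p assume p: "p \<in> carrier (poly_ring ?L)" and deg: "1 < Polynomials.degree p"
    have pol: "set p \<subseteq> coefs ` cone_quots n" "p \<noteq> []" "hd p \<noteq> coefs 0"
      using p deg unfolding univ_poly_carrier[symmetric] polynomial_def carrier_laurent_star laurent_star_ops
      by auto
    have "p \<in> lists (coefs ` cone_quots n)" using pol(1) by auto
    then obtain ps where ps: "p = map coefs ps" "set ps \<subseteq> cone_quots n"
      unfolding lists_image by auto
    have ps_ne: "ps \<noteq> []" "hd ps \<noteq> 0" using pol(2,3) ps(1) by (auto simp: hd_map)
    have "length ps > 1" using deg ps(1) by simp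
    from cone_quots_poly_root[OF ps(2) this ps_ne(2)]
    obtain x where x: "x \<in> cone_quots n" "poly (Poly (rev ps)) x = 0" by blast
    hence "eval p (coefs x) = \<zero>\<^bsub>?L\<^esub>"
      unfolding ps(1) laurent_star_eval laurent_star_ops by simp
    thus "\<exists>x\<in>carrier ?L. eval p x = \<zero>\<^bsub>?L\<^esub>" using x(1)
      unfolding carrier_laurent_star by blast
  qed
qed

text \<open>
  The list \<open>ps\<close> represents \<open>T\<^sup>d - f\<^sup>d\<close>.
\<close>

lemma power_algebraic:
  assumes "f \<in> cone_quots n" "d > 0" "f ^ d \<in> integral_fractions n"
  shows "(ring.algebraic (laurent_star n) over coefs ` integral_fractions n) (coefs f)"
proof -
  let ?L = "laurent_star n :: ((nat \<Rightarrow> real) \<Rightarrow> 'a) ring"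
  interpret field ?L by (rule field_laurent_star)
  define ps where "ps = 1 # replicate (d - 1) 0 @ [- (f ^ d)]"
  have "set (map coefs ps) \<subseteq> coefs ` integral_fractions n"
    using integral_series_subset_fractions[OF integral_series_1, of n]
      integral_series_subset_fractions[OF integral_series_0, of n] integral_fractions_uminus[OF assms(3)]
    by (auto simp: ps_def)
  moreover have "hd (map coefs ps) \<noteq> coefs 0" by (simp add: ps_def coefs_inject)
  ultimately have "map coefs ps \<in> carrier ((coefs ` integral_fractions n)[X]\<^bsub>?L\<^esub>)"
    unfolding univ_poly_carrier[symmetric] polynomial_def laurent_star_ops by blast
  moreover have "poly (Poly (rev ps)) f = 0"
    using assms(2) by (simp add: ps_def Poly_snoc poly_monom power_Suc[symmetric] del: power_Suc)
  hence "eval (map coefs ps) (coefs f) = \<zero>\<^bsub>?L\<^esub>"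
    unfolding laurent_star_eval laurent_star_ops by simp
  moreover have "map coefs ps \<noteq> []" by (simp add: ps_def)
  ultimately show ?thesis by (intro algebraicI)
qed

text \<open>
  The algebraic elements form a field.  It contains the residue class parts of every cone series, hence
  all cone series, which are finite sums of such parts, hence all fractions.
\<close>

lemma laurent_star_algebraic:
  assumes "x \<in> carrier (laurent_star n)"
  shows "(ring.algebraic (laurent_star n) over coefs ` integral_fractions n) x"
proof -
  let ?L = "laurent_star n :: ((nat \<Rightarrow> real) \<Rightarrow> 'a) ring"
  interpret field ?L by (rule field_laurent_star)
  define B where "B = {x \<in> carrier ?L. (algebraic over coefs ` integral_fractions n) x}"
  have B: "subfield B ?L" unfolding B_def
    by (rule subfield_of_algebraics[OF subfield_integral_fractions])
  have add: "coefs (f + g) \<in> B" if "coefs f \<in> B" "coefs g \<in> B" for f g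
    using subringE(7)[OF subfieldE(1)[OF B] that] by (simp add: laurent_star_ops)
  have ring: "coefs f \<in> B" if d: "d > 0" "\<Gamma> \<in> cones n" "f \<in> cone_ring n d \<Gamma>" for d \<Gamma> f
  proof -
    have part: "coefs (residue_part f r) \<in> B" for r
    proof -
      have "residue_part f r \<in> cone_ring n d \<Gamma>"
        using d(3) by (auto simp: coefs_residue_part cone_ring_def)
      hence "residue_part f r \<in> cone_quots n" using cone_ring_subset_cone_quots[OF d(1,2)]
        by blast
      moreover from power_algebraic[OF this d(1)]
      have "(algebraic over coefs ` integral_fractions n) (coefs (residue_part f r))"
        using integral_series_subset_fractions[OF residue_part_power[OF d]] by blast
      ultimately show ?thesis unfolding B_def carrier_laurent_star by blast
    qed
    have "coefs (\<Sum>r\<in>S. residue_part f r) \<in> B" if "finite S" for S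
      using that
    proof (induction S rule: finite_induct)
      case (insert r S)
      show ?case unfolding sum.insert[OF insert.hyps] by (rule add[OF part insert.IH])
    qed (use subringE(2)[OF subfieldE(1)[OF B]] in \<open>simp_all only: laurent_star_ops sum.empty\<close>)
    thus ?thesis using sum_residue_parts[OF d(1,3)] finite_residues[OF d(1)] by metis
  qed
  obtain f where f: "x = coefs f" "f \<in> cone_quots n" using assms
    by (auto simp: carrier_laurent_star)
  obtain d \<Gamma> p q
    where *: "d > 0" "\<Gamma> \<in> cones n" "p \<in> cone_ring n d \<Gamma>" "q \<in> cone_ring n d \<Gamma>" "q \<noteq> 0" "f = p / q"
    using cone_quots_fraction[OF f(2)] by blast
  have "q \<in> cone_quots n" using cone_ring_subset_cone_quots[OF *(1,2)] *(4) by blast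
  have "coefs q \<in> B - {\<zero>\<^bsub>?L\<^esub>}" using ring[OF *(1,2,4)] *(5)
    by (simp add: laurent_star_ops coefs_inject)
  hence "coefs (inverse q) \<in> B"
    using subfield_m_inv(1)[OF B] laurent_star_inv[OF \<open>q \<in> cone_quots n\<close> *(5)]
    by force
  from subringE(6)[OF subfieldE(1)[OF B] ring[OF *(1-3)] this]
  have "coefs (p * inverse q) \<in> B" unfolding laurent_star_ops .
  thus ?thesis using f(1) *(6) unfolding B_def by (simp add: divide_inverse)
qed

theorem corollary33:
  fixes n :: nat
    and R :: "((nat \<Rightarrow> real) \<Rightarrow> 'k::{alg_closed_field, field_char_0}) set"
  assumes "n > 1"
    and "R = (\<Union>\<Gamma>\<in>cones n. cone_series n \<Gamma> 1)"
  shows "algebraic_closure (laurent_star n) (fractions (laurent_union n) R)"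
proof -
  let ?L = "laurent_star n :: ((nat \<Rightarrow> real) \<Rightarrow> 'k) ring"
  interpret algebraically_closed ?L by (rule algebraically_closed_laurent_star)
  have R: "fractions (laurent_union n) R = coefs ` integral_fractions n"
    unfolding assms(2) by (rule fractions_integral_series)
  have sub: "subfield (coefs ` integral_fractions n) ?L" by (rule subfield_integral_fractions)
  show ?thesis
    unfolding R
  proof (intro algebraic_closure.intro algebraic_closure_axioms.intro field_laurent_star sub)
    fix x assume "x \<in> carrier ?L"
    thus "(algebraic over coefs ` integral_fractions n) x" by (rule laurent_star_algebraic)
  next
    fix p assume "p \<in> carrier ((coefs ` integral_fractions n)[X]\<^bsub>?L\<^esub>)"
    hence "p \<in> carrier (poly_ring ?L)"
      using carrier_polynomial[OF subfieldE(1)[OF sub]] unfolding univ_poly_carrier[symmetric]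
      by blast
    thus "splitted p" by (rule roots_over_carrier)
  qed
qed

end
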